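(* For all integers $r \geq 3$ and $t \geq r+3$, $$tn + \Omega\left(e'_{r,t}[n+o(n)]\right) \leq \mathrm{tsat}(n,K_r,t) \leq tn + O\left(e'_{r,t}[n+o(n)]\right),$$ i.e. there exist functions $a(n)=n+o(n)$ and $b(n)=n+o(n)$ and constants $c,C>0$ (depending on $r,t$) such that for all sufficiently large $n$, $tn + c\, e'_{r,t}(a(n)) \leq \mathrm{tsat}(n,K_r,t) \leq tn + C\, e'_{r,t}(b(n))$.
   Context: All graphs are finite and simple; $\delta(G)$ is the minimum degree. Two distinct vertices are twins if they have the same neighbourhood. A graph is $K_r$-saturated if it contains no $K_r$ but adding any missing edge creates a $K_r$. For $r\ge3$, $t\ge r-2$ and large $n$, $\mathrm{tsat}(n,K_r,t)$ is the minimum number of edges in a $K_r$-saturated graph $G$ on $n$ vertices with $\delta(G)\ge t$ in which every pair of twins has a common neighbour of degree exactly $t$. An $r$-system is a pair $(H,\mathcal{F})$ with $H$ a graph and $\mathcal{F}$ a family of subsets of $V(H)$ such that: (i) $H$ has no $K_r$; (ii) each $S\in\mathcal{F}$ is maximally $K_{r-1}$-free ($H[S]$ has no $K_{r-1}$ but $H[S\cup\{v\}]$ has a $K_{r-1}$ for every $v\notin S$); (iii) $H[S\cap T]$ contains a $K_{r-2}$ for distinct $S,T\in\mathcal{F}$. It is maximal if for every non-edge $e$ of $H$, either $H+e$ contains $K_r$ or $(H+e)[S]$ contains $K_{r-1}$ for some $S\in\mathcal{F}$. A maximal $(r,t)$-system is a maximal $r$-system in which $\mathcal{F}$ has no repeated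 elements and all its sets have size $t$. For $t\ge r$, $e'_{r,t}(s)$ is the minimum number of edges of $H$ over maximal $(r,t)$-systems $(H,\mathcal{F})$ with $|\mathcal{F}|=s$. *)

theory Defs
  imports Complex_Main "HOL-Library.Ramsey" "HOL-Library.Multiset" "HOL-Library.Landau_Symbols"
begin

type_synonym 'a graph = "'a set \<times> 'a set set"

abbreviation verts :: "'a graph \<Rightarrow> 'a set" where "verts G \<equiv> fst G"
abbreviation edges :: "'a graph \<Rightarrow> 'a set set" where "edges G \<equiv> snd G"

definition simple_graph :: "'a graph \<Rightarrow> bool" where
  "simple_graph G \<longleftrightarrow> finite (verts G) \<and> edges G \<subseteq> [verts G]\<^bsup>2\<^esup>"

definition non_edges :: "'a graph \<Rightarrow> 'a set set" where
  "non_edges G = [verts G]\<^bsup>2\<^esup> - edges G"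

definition add_edge :: "'a graph \<Rightarrow> 'a set \<Rightarrow> 'a graph" where
  "add_edge G e = (verts G, insert e (edges G))"

definition induced :: "'a graph \<Rightarrow> 'a set \<Rightarrow> 'a graph" where
  "induced G S = (verts G \<inter> S, {e \<in> edges G. e \<subseteq> S})"

definition contains_K :: "nat \<Rightarrow> 'a graph \<Rightarrow> bool" where
  "contains_K k G \<longleftrightarrow> (\<exists>A \<in> [verts G]\<^bsup>k\<^esup>. clique A (edges G))"

definition neighbourhood :: "'a graph \<Rightarrow> 'a \<Rightarrow> 'a set" where
  "neighbourhood G v = {u \<in> verts G. {u, v} \<in> edges G}"

definition degree :: "'a graph \<Rightarrow> 'a \<Rightarrow> nat" where
  "degree G v = card (neighbourhood G v)"

definition min_degree :: "'a graph \<Rightarrow> nat" where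
  "min_degree G = Min (degree G ` verts G)"

definition twins :: "'a graph \<Rightarrow> 'a \<Rightarrow> 'a \<Rightarrow> bool" where
  "twins G u v \<longleftrightarrow> u \<in> verts G \<and> v \<in> verts G \<and> u \<noteq> v \<and>
     neighbourhood G u = neighbourhood G v"

definition K_saturated :: "nat \<Rightarrow> 'a graph \<Rightarrow> bool" where
  "K_saturated r G \<longleftrightarrow> \<not> contains_K r G \<and> (\<forall>e \<in> non_edges G. contains_K r (add_edge G e))"

definition tsat_graph :: "nat \<Rightarrow> nat \<Rightarrow> nat \<Rightarrow> 'a graph \<Rightarrow> bool" where
  "tsat_graph n r t G \<longleftrightarrow> simple_graph G \<and> card (verts G) = n \<and> K_saturated r G \<and>
     min_degree G \<ge> t \<and>
     (\<forall>u v. twins G u v \<longrightarrow>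
        (\<exists>w \<in> neighbourhood G u \<inter> neighbourhood G v. degree G w = t))"

text \<open>
  Since every finite graph is isomorphic to one with vertices in \<open>nat\<close>, the extremal functions
  below range over graphs on \<open>nat\<close>. Minima are taken with \<open>Inf\<close> on \<open>nat\<close>, which is the least
  element of a nonempty set and \<open>0\<close> for the empty set.
\<close>

definition tsat :: "nat \<Rightarrow> nat \<Rightarrow> nat \<Rightarrow> nat" where
  "tsat n r t = Inf {card (edges G) | G :: nat graph. tsat_graph n r t G}"

definition maximally_K_free :: "nat \<Rightarrow> 'a graph \<Rightarrow> 'a set \<Rightarrow> bool" where
  "maximally_K_free k H S \<longleftrightarrow> \<not> contains_K k (induced H S) \<and>
     (\<forall>v \<in> verts H - S. contains_K k (induced H (insert v S)))"

text \<open>The family is a multiset, because repeated members are allowed in a general \<open>r\<close>-system.\<close>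

definition r_system :: "nat \<Rightarrow> 'a graph \<Rightarrow> 'a set multiset \<Rightarrow> bool" where
  "r_system r H F \<longleftrightarrow> simple_graph H \<and> (\<forall>S \<in># F. S \<subseteq> verts H) \<and>
     \<not> contains_K r H \<and>
     (\<forall>S \<in># F. maximally_K_free (r - 1) H S) \<and>
     (\<forall>S \<in># F. \<forall>T \<in># F. S \<noteq> T \<longrightarrow> contains_K (r - 2) (induced H (S \<inter> T)))"

definition maximal_r_system :: "nat \<Rightarrow> 'a graph \<Rightarrow> 'a set multiset \<Rightarrow> bool" where
  "maximal_r_system r H F \<longleftrightarrow> r_system r H F \<and>
     (\<forall>e \<in> non_edges H. contains_K r (add_edge H e) \<or>
        (\<exists>S \<in># F. contains_K (r - 1) (induced (add_edge H e) S)))"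

definition maximal_rt_system :: "nat \<Rightarrow> nat \<Rightarrow> 'a graph \<Rightarrow> 'a set multiset \<Rightarrow> bool" where
  "maximal_rt_system r t H F \<longleftrightarrow> maximal_r_system r H F \<and>
     (\<forall>S. count F S \<le> 1) \<and> (\<forall>S \<in># F. card S = t)"

definition e' :: "nat \<Rightarrow> nat \<Rightarrow> nat \<Rightarrow> nat" where
  "e' r t s = Inf {card (edges H) | (H :: nat graph) F. maximal_rt_system r t H F \<and> size F = s}"

end

theory Submission
  imports Defs "HOL-Algebra.Algebraic_Closure_Type" "HOL-Library.Z2"
begin

text \<open>
  A maximal \<open>(r,t)\<close>-system \<open>(H, \<F>)\<close> turns into a \<open>K\<^sub>r\<close>-saturated graph by adding, for every \<open>S \<in> \<F>\<close>,
  a new vertex joined exactly to \<open>S\<close>.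

  Lower bound. In a saturated graph let \<open>M\<close> be the set of vertices of degree more than \<open>4t\<close>. A
  Bollobas-type set-pair argument, applied to \<open>(r-2)\<close>-cliques in neighbourhoods, shows that all but
  boundedly many vertices outside \<open>M\<close> have all their neighbours in \<open>M\<close>, and that all but boundedly
  many vertices of \<open>M\<close> have at least \<open>4t\<close> neighbours in the core, which is \<open>M\<close> together with the
  exceptional vertices. The vertices of degree \<open>t\<close> outside the core are then independent and
  twin-free, their neighbourhoods form a maximal \<open>(r,t)\<close>-system on the remaining vertex set \<open>C\<close>, and
  \<open>C\<close> spans at least \<open>(t+1)|C| - O(1)\<close> edges.

  Upper bound. In an optimal system with slightly more than \<open>n\<close> sets one deletes vertices of degree
  less than \<open>t\<close> (with the sets containing them) and twins lying in no set, and then discards sets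
  until \<open>n\<close> vertices are left. Each of these steps costs boundedly many edges, because a non-edge
  blocked by a deleted set lies inside that set.

  That \<open>e'(s) = o(s)\<close> follows from a construction with points and curves over the field with
  \<open>q = 2\<^sup>j\<close> elements: quadratic against cubic curves, non-incidence as adjacency.
\<close>

section \<open>Cliques and maximal systems\<close>

text \<open>The estimate \<open>e'(s) = o(s)\<close> does more than size the bounds: it shows that
  maximal systems exist for every large \<open>s\<close>, so that the infimum in \<open>e'\<close>
  is attained and not the default \<open>0\<close>, and it makes all shifts of the argument of order
  \<open>e'\<close> equal to \<open>o(n)\<close>. The hypothesis \<open>t \<ge> r + 3\<close> enters
  through its construction: for \<open>r = 3\<close> a member has two curves, three points and at
  least one vertex of a common block, by which any two members meet. In place of monotonicity of
  \<open>e'\<close> there is only \<open>e'(s) \<le> e'(s+1) + t^2\<close>; \<open>b(n)\<close> is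
  defined by minimality so that this suffices. The lower bound rests on the surplus
  \<open>tsat - tn = e(C) - t|C|\<close>. The core estimate
  \<open>(t+1)|C| \<le> e(C) + O(1)\<close> makes it at least \<open>|C| - O(1)\<close> and, for
  large \<open>n\<close>, at least a constant multiple of \<open>e(C)\<close>. The second fact gives
  the term \<open>c e'(a(n))\<close> with \<open>a(n) = n - |C|\<close>; the first, joined with the
  upper bound for \<open>tsat\<close>, gives \<open>|C| = o(n)\<close>. The threshold
  \<open>4t\<close> is chosen because halving a degree sum leaves \<open>2t \<ge> t + 1\<close>
  edges per vertex.\<close>

definition has_clique :: "nat \<Rightarrow> 'a set set \<Rightarrow> 'a set \<Rightarrow> bool" where
  "has_clique k E U \<longleftrightarrow> (\<exists>Q\<subseteq>U. finite Q \<and> card Q = k \<and> clique Q E)"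

lemma has_clique_mono: "has_clique k E U \<Longrightarrow> E \<subseteq> E' \<Longrightarrow> U \<subseteq> U' \<Longrightarrow> has_clique k E' U'"
  unfolding has_clique_def clique_def by (metis subsetD subset_trans)

lemma clique_restrict: "Q \<subseteq> S \<Longrightarrow> clique Q {e \<in> E. e \<subseteq> S} \<longleftrightarrow> clique Q E"
  unfolding clique_def by auto

lemma clique_subset: "clique Q E \<Longrightarrow> P \<subseteq> Q \<Longrightarrow> clique P E"
  unfolding clique_def by blast

lemma contains_K_iff_has_clique: "contains_K k G \<longleftrightarrow> has_clique k (edges G) (verts G)"
  unfolding contains_K_def has_clique_def nsets_def by auto

lemma contains_K_induced:
  assumes "S \<subseteq> verts G"
  shows "contains_K k (induced G S) \<longleftrightarrow> has_clique k (edges G) S"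
proof -
  have "verts G \<inter> S = S" using assms by blast
  then show ?thesis
    unfolding contains_K_iff_has_clique has_clique_def induced_def by (auto simp: clique_restrict)
qed

lemma clique_insert_edge_contains:
  assumes "clique Q (insert e E)" "\<not> clique Q E"
  shows "e \<subseteq> Q"
  using assms unfolding clique_def by blast

lemma has_clique_insert_vertexE:
  assumes "has_clique k E (insert v S)" "\<not> has_clique k E S"
  obtains Q where "Q \<subseteq> S" "v \<notin> Q" "finite Q" "card Q = k - 1" "clique Q E" "\<forall>q\<in>Q. {q, v} \<in> E"
proof -
  obtain Q where Q: "Q \<subseteq> insert v S" "finite Q" "card Q = k" "clique Q E"
    using assms(1) unfolding has_clique_def by blast
  have v: "v \<in> Q" using Q assms(2) unfolding has_clique_def by blast
  show thesis
    by (rule that[of "Q - {v}"]) (use Q v in \<open>auto simp: clique_def\<close>)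
qed

lemma has_clique_insert_edgeE:
  assumes "has_clique k (insert {u, v} E) V" "\<not> has_clique k E V" "u \<noteq> v"
  obtains Q where "Q \<subseteq> V" "u \<notin> Q" "v \<notin> Q" "u \<in> V" "v \<in> V" "finite Q" "card Q = k - 2" "clique Q E"
    "\<forall>q\<in>Q. {q, u} \<in> E" "\<forall>q\<in>Q. {q, v} \<in> E"
proof -
  obtain Q where Q: "Q \<subseteq> V" "finite Q" "card Q = k" "clique Q (insert {u, v} E)"
    using assms(1) unfolding has_clique_def by blast
  have "{u, v} \<subseteq> Q"
    using clique_insert_edge_contains[OF Q(4)] Q assms(2) unfolding has_clique_def by blast
  moreover from this have "card (Q - {u, v}) = k - 2"
    using Q assms(3) by (simp add: card_Diff_subset)
  ultimately show thesis
    by (intro that[of "Q - {u, v}"]) (use Q in \<open>auto simp: clique_def doubleton_eq_iff\<close>)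
qed

text \<open>A multiset with all multiplicities at most one is a set, so \<open>\<F>\<close> is a
  plain set here; it is finite as a part of \<open>Pow V\<close>.\<close>

definition max_sys :: "nat \<Rightarrow> nat \<Rightarrow> 'a set \<Rightarrow> 'a set set \<Rightarrow> 'a set set \<Rightarrow> bool" where
  "max_sys r t V E \<F> \<longleftrightarrow> finite V \<and> E \<subseteq> [V]\<^bsup>2\<^esup> \<and> (\<forall>S\<in>\<F>. S \<subseteq> V \<and> card S = t) \<and>
     \<not> has_clique r E V \<and>
     (\<forall>S\<in>\<F>. \<not> has_clique (r - 1) E S \<and> (\<forall>v\<in>V - S. has_clique (r - 1) E (insert v S))) \<and>
     (\<forall>S\<in>\<F>. \<forall>T\<in>\<F>. S \<noteq> T \<longrightarrow> has_clique (r - 2) E (S \<inter> T)) \<and>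
     (\<forall>e\<in>[V]\<^bsup>2\<^esup> - E. has_clique r (insert e E) V \<or> (\<exists>S\<in>\<F>. has_clique (r - 1) (insert e E) S))"

lemma max_sysD:
  assumes "max_sys r t V E \<F>"
  shows "finite V" "E \<subseteq> [V]\<^bsup>2\<^esup>" "finite E" "finite \<F>" "\<And>S. S \<in> \<F> \<Longrightarrow> S \<subseteq> V" "\<And>S. S \<in> \<F> \<Longrightarrow> card S = t"
    "\<And>S. S \<in> \<F> \<Longrightarrow> finite S"
    "\<not> has_clique r E V" "\<And>S. S \<in> \<F> \<Longrightarrow> \<not> has_clique (r - 1) E S"
    "\<And>S v. S \<in> \<F> \<Longrightarrow> v \<in> V \<Longrightarrow> v \<notin> S \<Longrightarrow> has_clique (r - 1) E (insert v S)"
    "\<And>S T. S \<in> \<F> \<Longrightarrow> T \<in> \<F> \<Longrightarrow> S \<noteq> T \<Longrightarrow> has_clique (r - 2) E (S \<inter> T)"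
    "\<And>e. e \<in> [V]\<^bsup>2\<^esup> \<Longrightarrow> e \<notin> E \<Longrightarrow> has_clique r (insert e E) V \<or> (\<exists>S\<in>\<F>. has_clique (r - 1) (insert e E) S)"
proof -
  show fV: "finite V" using assms unfolding max_sys_def by simp
  show E: "E \<subseteq> [V]\<^bsup>2\<^esup>" using assms unfolding max_sys_def by simp
  show S: "\<And>S. S \<in> \<F> \<Longrightarrow> S \<subseteq> V" using assms unfolding max_sys_def by simp
  show "finite E" using finite_subset[OF E] finite_imp_finite_nsets[OF fV] by simp
  show "finite \<F>" by (rule finite_subset[of _ "Pow V"]) (use S fV in auto)
  show "\<And>S. S \<in> \<F> \<Longrightarrow> finite S" using S fV by (metis finite_subset)
qed (use assms in \<open>simp add: max_sys_def\<close>)+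

lemma maximal_rt_system_imp_max_sys:
  assumes "maximal_rt_system r t H F"
  shows "max_sys r t (verts H) (edges H) (set_mset F)" "size F = card (set_mset F)"
proof -
  note defs = maximal_rt_system_def maximal_r_system_def r_system_def simple_graph_def
  have sub: "S \<subseteq> verts H" if "S \<in># F" for S
    using assms that unfolding defs by blast
  have mf: "maximally_K_free (r - 1) H S" if "S \<in># F" for S
    using assms that unfolding defs by blast
  have cap: "contains_K (r - 2) (induced H (S \<inter> T))" if "S \<in># F" "T \<in># F" "S \<noteq> T" for S T
    using assms that unfolding defs by metis
  have c: "contains_K k (induced H U) \<longleftrightarrow> has_clique k (edges H) U" if "U \<subseteq> verts H" for k U
    using contains_K_induced[OF that] .
  have d: "contains_K k (induced (add_edge H e) U) \<longleftrightarrow> has_clique k (insert e (edges H)) U" if "U \<subseteq> verts H" for k U e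
    using contains_K_induced[of U "add_edge H e" k] that by (simp add: add_edge_def)
  show "max_sys r t (verts H) (edges H) (set_mset F)"
    unfolding max_sys_def
  proof (intro conjI ballI impI)
    fix S T assume "S \<in># F" "T \<in># F" "S \<noteq> T"
    moreover from this have "S \<inter> T \<subseteq> verts H" using sub by blast
    ultimately show "has_clique (r - 2) (edges H) (S \<inter> T)"
      using cap[of S T] c[of "S \<inter> T"] by simp
  next
    fix S v assume "S \<in># F" "v \<in> verts H - S"
    moreover from this have "insert v S \<subseteq> verts H" using sub by blast
    ultimately show "has_clique (r - 1) (edges H) (insert v S)"
      using mf[of S] c[of "insert v S"] unfolding maximally_K_free_def by auto
  next
    fix S assume "S \<in># F"
    then show "\<not> has_clique (r - 1) (edges H) S"
      using mf[of S] c[OF sub] unfolding maximally_K_free_def by simp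
  next
    fix e assume "e \<in> [verts H]\<^bsup>2\<^esup> - edges H"
    then have "contains_K r (add_edge H e) \<or> (\<exists>S \<in># F. contains_K (r - 1) (induced (add_edge H e) S))"
      using assms unfolding defs non_edges_def by blast
    then show "has_clique r (insert e (edges H)) (verts H) \<or> (\<exists>S\<in>set_mset F. has_clique (r - 1) (insert e (edges H)) S)"
      using d sub by (auto simp: contains_K_iff_has_clique add_edge_def)
  qed (use assms in \<open>auto simp: defs contains_K_iff_has_clique\<close>)
  have "count F S = (if S \<in># F then 1 else 0)" for S
    using assms unfolding maximal_rt_system_def by (metis Suc_leI antisym count_greater_zero_iff not_in_iff One_nat_def)
  then have "F = mset_set (set_mset F)"
    by (intro multiset_eqI) (simp add: count_mset_set')
  then show "size F = card (set_mset F)" by (metis size_mset_set)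
qed

lemma max_sys_imp_maximal_rt_system:
  assumes m: "max_sys r t V E \<F>"
  shows "maximal_rt_system r t (V, E) (mset_set \<F>)"
proof -
  note D = max_sysD[OF m]
  note defs = maximal_rt_system_def maximal_r_system_def r_system_def simple_graph_def
  have c: "contains_K k (induced (V, E) U) \<longleftrightarrow> has_clique k E U" if "U \<subseteq> V" for k U
    using contains_K_induced[of U "(V, E)"] that by simp
  have d: "contains_K k (induced (add_edge (V, E) e) U) \<longleftrightarrow> has_clique k (insert e E) U" if "U \<subseteq> V" for k U e
    using contains_K_induced[of U "add_edge (V, E) e" k] that by (simp add: add_edge_def)
  have [simp]: "set_mset (mset_set \<F>) = \<F>" using D(4) by simp
  have 1: "maximally_K_free (r - 1) (V, E) S" if "S \<in> \<F>" for S
    using that D(5,9,10)[OF that] c[of S] c[of "insert _ S"] unfolding maximally_K_free_def by simp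
  have 2: "contains_K (r - 2) (induced (V, E) (S \<inter> T))" if "S \<in> \<F>" "T \<in> \<F>" "S \<noteq> T" for S T
    using D(5)[OF that(1)] D(11)[OF that] c[of "S \<inter> T"] by blast
  have 3: "contains_K r (add_edge (V, E) e) \<or> (\<exists>S \<in> \<F>. contains_K (r - 1) (induced (add_edge (V, E) e) S))"
    if "e \<in> non_edges (V, E)" for e
  proof -
    have "has_clique r (insert e E) V \<or> (\<exists>S\<in>\<F>. has_clique (r - 1) (insert e E) S)"
      using that D(12) by (simp add: non_edges_def)
    then show ?thesis using d D(5) by (auto simp: contains_K_iff_has_clique add_edge_def)
  qed
  show ?thesis
    unfolding defs using D(1,2,5,6,8) 1 2 3
    by (auto simp: contains_K_iff_has_clique count_mset_set')
qed

lemma e'_le_card_edges: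
  assumes "max_sys r t (V :: nat set) E \<F>"
  shows "e' r t (card \<F>) \<le> card E"
  unfolding e'_def
  by (rule cInf_lower) (use max_sys_imp_maximal_rt_system[OF assms] in force)+

text \<open>Some system with \<open>card \<F>\<close> members must be supplied: over an empty
  collection \<open>Inf\<close> on \<open>nat\<close> returns \<open>0\<close>, which nothing
  attains.\<close>

lemma e'_attained:
  assumes "max_sys r t (V :: nat set) E \<F>"
  obtains V' :: "nat set" and E' \<F>' where "max_sys r t V' E' \<F>'" "card \<F>' = card \<F>" "card E' = e' r t (card \<F>)"
proof -
  let ?U = "{card (edges H) | (H :: nat graph) F. maximal_rt_system r t H F \<and> size F = card \<F>}"
  have "card E \<in> ?U" using max_sys_imp_maximal_rt_system[OF assms] by force
  then have "Inf ?U \<in> ?U" by (rule wellorder_InfI)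
  then obtain H :: "nat graph" and F where H: "maximal_rt_system r t H F" "size F = card \<F>" "card (edges H) = e' r t (card \<F>)"
    unfolding e'_def by fastforce
  show thesis
    using that[OF maximal_rt_system_imp_max_sys(1)[OF H(1)]] maximal_rt_system_imp_max_sys(2)[OF H(1)] H(2,3) by simp
qed

text \<open>The new edges are controlled because every non-edge of \<open>E\<close> was blocked, and a block that
  survives the restriction still blocks.\<close>

lemma max_sys_restrict:
  assumes m: "max_sys r t V E \<F>" and "V' \<subseteq> V" "\<F>' \<subseteq> \<F>" and sub: "\<And>S. S \<in> \<F>' \<Longrightarrow> S \<subseteq> V'"
  obtains E' where "max_sys r t V' E' \<F>'" "{e \<in> E. e \<subseteq> V'} \<subseteq> E'"
    "\<And>e. e \<in> E' \<Longrightarrow> e \<notin> E \<Longrightarrow> (\<exists>S\<in>\<F> - \<F>'. e \<subseteq> S) \<or>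
       (\<exists>Q\<subseteq>V. \<not> Q \<subseteq> V' \<and> finite Q \<and> card Q = r \<and> e \<subseteq> Q \<and> clique Q (insert e E))"
proof -
  note D = max_sysD[OF m]
  let ?E1 = "{e \<in> E. e \<subseteq> V'}"
  \<comment> \<open>Adding edges can only break the two clique-free conditions; domination and
    intersection persist, and the failure to enlarge an element of \<open>U\<close> by an edge is
    exactly the maximality condition. Any inclusion-maximal element of \<open>U\<close> therefore
    works.\<close>
  define U where "U = {E'. ?E1 \<subseteq> E' \<and> E' \<subseteq> [V']\<^bsup>2\<^esup> \<and> \<not> has_clique r E' V' \<and> (\<forall>S\<in>\<F>'. \<not> has_clique (r - 1) E' S)}"
  have fV': "finite V'" using D(1) assms(2) finite_subset by metis
  have "U \<subseteq> Pow ([V']\<^bsup>2\<^esup>)" unfolding U_def by blast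
  then have "finite U" using fV' finite_imp_finite_nsets by (metis finite_Pow_iff finite_subset)
  moreover have "\<not> has_clique (r - 1) ?E1 S" if "S \<in> \<F>'" for S
    using that assms(3) D(9)[of S] has_clique_mono[of "r - 1" ?E1 S E S] by blast
  moreover have "\<not> has_clique r ?E1 V'" using D(8) assms(2) has_clique_mono[of r ?E1 V' E V] by blast
  ultimately have "finite U" "?E1 \<in> U"
    unfolding U_def using D(2) by (auto simp: nsets_def)
  then obtain E' where E': "E' \<in> U" "\<And>E''. E'' \<in> U \<Longrightarrow> E' \<subseteq> E'' \<Longrightarrow> E'' = E'"
    using finite_has_maximal[of U] by (metis empty_iff)
  have sub2: "{e \<in> E. e \<subseteq> V'} \<subseteq> E'" and E'2: "E' \<subseteq> [V']\<^bsup>2\<^esup>" and noK: "\<not> has_clique r E' V'"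
    and noKS: "\<And>S. S \<in> \<F>' \<Longrightarrow> \<not> has_clique (r - 1) E' S"
    using E'(1) unfolding U_def by auto
  have lift: "has_clique k E' Y" if "has_clique k E Y" "Y \<subseteq> V'" for k Y
  proof -
    obtain Q where Q: "Q \<subseteq> Y" "finite Q" "card Q = k" "clique Q E"
      using \<open>has_clique k E Y\<close> unfolding has_clique_def by blast
    then have "clique Q E'" using sub2 \<open>Y \<subseteq> V'\<close> unfolding clique_def by blast
    then show ?thesis using Q unfolding has_clique_def by blast
  qed
  have liftc: "clique Q E'" if "clique Q (insert e E)" "Q \<subseteq> V'" "e \<in> E'" for Q e
    using that sub2 unfolding clique_def by blast
  have "max_sys r t V' E' \<F>'"
    unfolding max_sys_def
  proof (intro conjI ballI impI)
    fix S v assume "S \<in> \<F>'" "v \<in> V' - S"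
    then show "has_clique (r - 1) E' (insert v S)"
      using lift D(10)[of S v] assms(2,3) sub[of S] by blast
  next
    fix S T assume "S \<in> \<F>'" "T \<in> \<F>'" "S \<noteq> T"
    then show "has_clique (r - 2) E' (S \<inter> T)"
      using lift D(11)[of S T] assms(3) sub by (meson inf.coboundedI1 subsetD)
  next
    fix e assume e: "e \<in> [V']\<^bsup>2\<^esup> - E'"
    then have "insert e E' \<notin> U" using E'(2)[of "insert e E'"] by blast
    then show "has_clique r (insert e E') V' \<or> (\<exists>S\<in>\<F>'. has_clique (r - 1) (insert e E') S)"
      using e E'2 sub2 unfolding U_def by blast
  qed (use fV' E'2 noK noKS sub D(6) assms(3) in auto)
  moreover have "(\<exists>S\<in>\<F> - \<F>'. e \<subseteq> S) \<or>
       (\<exists>Q\<subseteq>V. \<not> Q \<subseteq> V' \<and> finite Q \<and> card Q = r \<and> e \<subseteq> Q \<and> clique Q (insert e E))"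
    if e: "e \<in> E'" "e \<notin> E" for e
  proof -
    have "e \<in> [V]\<^bsup>2\<^esup>" using e(1) E'2 nsets_mono[OF assms(2)] by blast
    from D(12)[OF this e(2)] show ?thesis
    proof
      assume "has_clique r (insert e E) V"
      then obtain Q where Q: "Q \<subseteq> V" "finite Q" "card Q = r" "clique Q (insert e E)"
        unfolding has_clique_def by blast
      then have "e \<subseteq> Q" using clique_insert_edge_contains D(8) unfolding has_clique_def by metis
      moreover have "\<not> Q \<subseteq> V'" using Q liftc[OF Q(4) _ e(1)] noK unfolding has_clique_def by blast
      ultimately show ?thesis using Q by blast
    next
      assume "\<exists>S\<in>\<F>. has_clique (r - 1) (insert e E) S"
      then obtain S Q where S: "S \<in> \<F>" and Q: "Q \<subseteq> S" "finite Q" "card Q = r - 1" "clique Q (insert e E)"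
        unfolding has_clique_def by blast
      then have "e \<subseteq> Q" using clique_insert_edge_contains D(9) unfolding has_clique_def by metis
      moreover have "S \<notin> \<F>'" using Q liftc[OF Q(4) _ e(1)] noKS sub unfolding has_clique_def by blast
      ultimately show ?thesis using S Q by blast
    qed
  qed
  ultimately show thesis using that sub2 by blast
qed

lemma card_pairs_inside_le:
  assumes "finite \<G>" "\<And>S. S \<in> \<G> \<Longrightarrow> finite S \<and> card S \<le> k"
  shows "finite {e. \<exists>S\<in>\<G>. e \<in> [S]\<^bsup>2\<^esup>}" "card {e. \<exists>S\<in>\<G>. e \<in> [S]\<^bsup>2\<^esup>} \<le> card \<G> * k\<^sup>2"
proof -
  have eq: "{e. \<exists>S\<in>\<G>. e \<in> [S]\<^bsup>2\<^esup>} = (\<Union>S\<in>\<G>. [S]\<^bsup>2\<^esup>)" by blast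
  show "finite {e. \<exists>S\<in>\<G>. e \<in> [S]\<^bsup>2\<^esup>}"
    unfolding eq using assms finite_imp_finite_nsets by blast
  have *: "card ([S]\<^bsup>2\<^esup>) \<le> k\<^sup>2" if "S \<in> \<G>" for S
  proof -
    have "[S]\<^bsup>2\<^esup> \<subseteq> (\<lambda>(u, v). {u, v}) ` (S \<times> S)" by (auto elim!: nsets2_E)
    then have "card ([S]\<^bsup>2\<^esup>) \<le> card (S \<times> S)"
      by (rule surj_card_le[rotated]) (use assms that in auto)
    also have "\<dots> \<le> k\<^sup>2"
      using assms(2)[OF that] by (simp add: card_cartesian_product power2_eq_square mult_mono)
    finally show ?thesis .
  qed
  have "card (\<Union>S\<in>\<G>. [S]\<^bsup>2\<^esup>) \<le> (\<Sum>S\<in>\<G>. card ([S]\<^bsup>2\<^esup>))"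
    by (rule card_UN_le[OF assms(1)])
  also have "\<dots> \<le> card \<G> * k\<^sup>2" using sum_bounded_above[of \<G>, OF *] by simp
  finally show "card {e. \<exists>S\<in>\<G>. e \<in> [S]\<^bsup>2\<^esup>} \<le> card \<G> * k\<^sup>2" unfolding eq .
qed

text \<open>The vertex set stays the same, so no blocking clique can leave it: every new edge lies
  inside a discarded member, which has at most \<open>t^2\<close> pairs.\<close>

lemma max_sys_subfamily:
  assumes m: "max_sys r t V E \<F>" and "\<F>' \<subseteq> \<F>"
  obtains E' where "max_sys r t V E' \<F>'" "E \<subseteq> E'" "\<And>e. e \<in> E' \<Longrightarrow> e \<notin> E \<Longrightarrow> \<exists>S\<in>\<F> - \<F>'. e \<subseteq> S"
    "card E' \<le> card E + card (\<F> - \<F>') * t\<^sup>2"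
proof -
  note D = max_sysD[OF m]
  obtain E' where E': "max_sys r t V E' \<F>'" "{e \<in> E. e \<subseteq> V} \<subseteq> E'"
    "\<And>e. e \<in> E' \<Longrightarrow> e \<notin> E \<Longrightarrow> (\<exists>S\<in>\<F> - \<F>'. e \<subseteq> S)"
    using max_sys_restrict[OF m order_refl assms(2)] D(5) assms(2) by (metis (no_types, lifting) subsetD)
  have sub: "E \<subseteq> E'" using E'(2) D(2) by (auto simp: nsets_def)
  let ?P = "{e. \<exists>S\<in>\<F> - \<F>'. e \<in> [S]\<^bsup>2\<^esup>}"
  have P: "finite ?P" "card ?P \<le> card (\<F> - \<F>') * t\<^sup>2"
    using card_pairs_inside_le[of "\<F> - \<F>'" t] D(4,6,7) by auto
  have "E' \<subseteq> E \<union> ?P"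
    using E'(3) max_sysD(2)[OF E'(1)] by (auto simp: nsets_def)
  then have "card E' \<le> card (E \<union> ?P)" using P(1) D(3) by (intro card_mono) auto
  also have "\<dots> \<le> card E + card (\<F> - \<F>') * t\<^sup>2" using card_Un_le[of E ?P] P(2) by linarith
  finally show thesis using that[OF E'(1) sub E'(3)] by blast
qed

section \<open>The core of a saturated graph\<close>

text \<open>Induction on \<open>b\<close>. For a fixed \<open>x\<close>, all but \<open>d\<close> of
  the sets \<open>B x'\<close> meet \<open>A x\<close>, hence contain one of its at most
  \<open>a\<close> elements. Among the \<open>x'\<close> with \<open>e \<in> B x'\<close>, the
  element \<open>e\<close> lies in no \<open>A x'\<close>, so removing it from each
  \<open>B x'\<close> changes no disjointness relation and lowers \<open>b\<close> by one. This
  gives \<open>f (b + 1) \<le> d + a * f b\<close>.\<close>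

lemma set_pair_bound:
  fixes A B :: "'x \<Rightarrow> 'c set"
  assumes "finite U" "\<And>x. x \<in> U \<Longrightarrow> finite (A x) \<and> card (A x) \<le> a"
    "\<And>x. x \<in> U \<Longrightarrow> finite (B x) \<and> card (B x) \<le> b"
    "\<And>x. x \<in> U \<Longrightarrow> A x \<inter> B x = {}"
    "\<And>x. x \<in> U \<Longrightarrow> card {x' \<in> U. A x \<inter> B x' = {}} \<le> d"
  shows "card U \<le> d * (a + 1) ^ b"
  using assms
proof (induction b arbitrary: U B)
  case 0
  show ?case
  proof (cases "U = {}")
    case False
    then obtain x where "x \<in> U" by blast
    moreover have "B x' = {}" if "x' \<in> U" for x' using 0(3)[OF that] by auto
    ultimately have "{x' \<in> U. A x \<inter> B x' = {}} = U" by auto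
    then show ?thesis using 0(5)[OF \<open>x \<in> U\<close>] by simp
  qed simp
next
  case (Suc b)
  show ?case
  proof (cases "U = {}")
    case False
    then obtain x where x: "x \<in> U" by blast
    define Y where "Y e = {x' \<in> U. e \<in> B x'}" for e
    let ?D = "{x' \<in> U. A x \<inter> B x' = {}}"
    have bound: "card (Y e) \<le> d * (a + 1) ^ b" for e
    proof (rule Suc.IH[where B = "\<lambda>x. B x - {e}"])
      show "finite (Y e)" using Suc.prems(1) unfolding Y_def by simp
      show "finite (A x) \<and> card (A x) \<le> a" if "x \<in> Y e" for x
        using Suc.prems(2) that unfolding Y_def by blast
      show "finite (B x - {e}) \<and> card (B x - {e}) \<le> b" if "x \<in> Y e" for x
        using Suc.prems(3)[of x] that unfolding Y_def by (auto simp: card_Diff_singleton)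
      show "A x \<inter> (B x - {e}) = {}" if "x \<in> Y e" for x
        using Suc.prems(4)[of x] that unfolding Y_def by blast
      show "card {x' \<in> Y e. A x \<inter> (B x' - {e}) = {}} \<le> d" if "x \<in> Y e" for x
      proof -
        have "e \<notin> A x" "x \<in> U" using Suc.prems(4)[of x] that unfolding Y_def by blast+
        then have "{x' \<in> Y e. A x \<inter> (B x' - {e}) = {}} \<subseteq> {x' \<in> U. A x \<inter> B x' = {}}"
          unfolding Y_def by blast
        then have "card {x' \<in> Y e. A x \<inter> (B x' - {e}) = {}} \<le> card {x' \<in> U. A x \<inter> B x' = {}}"
          using Suc.prems(1) by (intro card_mono) auto
        then show ?thesis using Suc.prems(5)[OF \<open>x \<in> U\<close>] by linarith
      qed
    qed
    have fin: "finite (A x)" "card (A x) \<le> a" using Suc.prems(2)[OF x] by auto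
    have finU: "finite (\<Union>e\<in>A x. Y e)" using fin Suc.prems(1) unfolding Y_def by simp
    have "U \<subseteq> ?D \<union> (\<Union>e\<in>A x. Y e)" unfolding Y_def by blast
    then have "card U \<le> card (?D \<union> (\<Union>e\<in>A x. Y e))"
      using finU Suc.prems(1) by (intro card_mono) auto
    also have "\<dots> \<le> card ?D + card (\<Union>e\<in>A x. Y e)" by (rule card_Un_le)
    also have "card (\<Union>e\<in>A x. Y e) \<le> (\<Sum>e\<in>A x. card (Y e))" by (rule card_UN_le[OF fin(1)])
    also have "(\<Sum>e\<in>A x. card (Y e)) \<le> card (A x) * (d * (a + 1) ^ b)"
      using sum_bounded_above[of "A x" "\<lambda>e. card (Y e)"] bound by simp
    also have "\<dots> \<le> a * (d * (a + 1) ^ b)" using fin(2) by (rule mult_right_mono) simp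
    also have "card ?D \<le> d" using Suc.prems(5)[OF x] .
    also have "d + a * (d * (a + 1) ^ b) \<le> d * (a + 1) ^ b + a * (d * (a + 1) ^ b)" by simp
    also have "\<dots> = d * (a + 1) ^ Suc b" by (simp add: algebra_simps)
    finally show ?thesis by simp
  qed simp
qed

section \<open>Neighbourhoods, saturation and the clique form of the set-pair bound\<close>

definition nbr :: "'a set set \<Rightarrow> 'a \<Rightarrow> 'a set" where
  "nbr E v = {u. {u, v} \<in> E}"

lemma nbr_sym: "u \<in> nbr E v \<longleftrightarrow> v \<in> nbr E u"
  unfolding nbr_def by (simp add: insert_commute)

lemma nbr_subset: "E \<subseteq> [V]\<^bsup>2\<^esup> \<Longrightarrow> nbr E v \<subseteq> V"
  unfolding nbr_def by auto

lemma not_in_nbr_self: "E \<subseteq> [V]\<^bsup>2\<^esup> \<Longrightarrow> v \<notin> nbr E v"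
  unfolding nbr_def by (auto simp: nsets_def)

definition is_saturated :: "nat \<Rightarrow> 'a set \<Rightarrow> 'a set set \<Rightarrow> bool" where
  "is_saturated r V E \<longleftrightarrow> finite V \<and> E \<subseteq> [V]\<^bsup>2\<^esup> \<and> \<not> has_clique r E V \<and> (\<forall>e\<in>[V]\<^bsup>2\<^esup> - E. has_clique r (insert e E) V)"

lemma is_saturated_nonadjacent:
  assumes "is_saturated r V E" "u \<in> V" "v \<in> V" "u \<noteq> v" "u \<notin> nbr E v"
  obtains Q where "Q \<subseteq> nbr E u \<inter> nbr E v" "finite Q" "card Q = r - 2" "clique Q E"
proof -
  have "has_clique r (insert {u, v} E) V" "\<not> has_clique r E V"
    using assms unfolding is_saturated_def nbr_def by auto
  then obtain Q where "Q \<subseteq> V" "u \<notin> Q" "v \<notin> Q" "u \<in> V" "v \<in> V"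
    and Q: "finite Q" "card Q = r - 2" "clique Q E"
    "\<forall>q\<in>Q. {q, u} \<in> E" "\<forall>q\<in>Q. {q, v} \<in> E"
    using assms(4) by (rule has_clique_insert_edgeE)
  show thesis by (rule that[OF _ Q(1-3)]) (use Q in \<open>auto simp: nbr_def\<close>)
qed

lemma clique_insert_nbr:
  assumes "clique Q E" "Q \<subseteq> nbr E v"
  shows "clique (insert v Q) E"
  using assms unfolding clique_def nbr_def by (auto simp: insert_commute)

lemma no_clique_common_nbr:
  assumes "E \<subseteq> [V]\<^bsup>2\<^esup>" "\<not> has_clique r E V" "2 \<le> r" "u \<in> nbr E v" "Q \<subseteq> nbr E u \<inter> nbr E v" "finite Q" "card Q = r - 2"
  shows "\<not> clique Q E"
proof
  assume Q: "clique Q E"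
  have u: "u \<notin> Q" "v \<notin> Q" "u \<noteq> v" "u \<in> V" "v \<in> V"
    using assms not_in_nbr_self[OF assms(1)] nbr_subset[OF assms(1)] nbr_sym by (metis Int_iff subsetD)+
  have "clique (insert u (insert v Q)) E"
    using assms(4,5) by (intro clique_insert_nbr Q) (auto simp: nbr_sym)
  moreover have "card (insert u (insert v Q)) = r" using u assms(3,6,7) by simp
  moreover have "insert u (insert v Q) \<subseteq> V" using u assms(5) nbr_subset[OF assms(1)] by blast
  ultimately show False using assms(2,6) unfolding has_clique_def by blast
qed

text \<open>This is \<open>d * (a + 1) ^ b\<close> with \<open>a = b = 2 ^ D\<close>, since a set of
  at most \<open>D\<close> vertices has at most \<open>2 ^ D\<close> cliques of a given size, and
  \<open>d = D + 1\<close>, counting a vertex together with its neighbours.\<close>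

definition clique_pair_bound :: "nat \<Rightarrow> nat" where
  "clique_pair_bound D = (D + 1) * (2 ^ D + 1) ^ (2 ^ D)"

text \<open>The set pairs are the \<open>(r-2)\<close>-cliques in \<open>nbr E (y x)\<close> and in \<open>nbr E x \<inter> W\<close>: adjacency
  makes them disjoint, non-adjacency makes them meet.\<close>

lemma card_le_clique_pair_bound:
  assumes sat: "is_saturated r V E" and "2 \<le> r" "U \<subseteq> V"
    and y: "\<And>x. x \<in> U \<Longrightarrow> y x \<in> nbr E x \<and> nbr E (y x) \<subseteq> W \<and> card (nbr E (y x)) \<le> D \<and> card (nbr E x \<inter> W) \<le> D"
  shows "card U \<le> clique_pair_bound D"
proof -
  have V: "finite V" "E \<subseteq> [V]\<^bsup>2\<^esup>" "\<not> has_clique r E V" using sat unfolding is_saturated_def by auto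
  have finN: "finite (nbr E v)" for v using nbr_subset[OF V(2)] V(1) finite_subset by blast
  define cl where "cl S = {Q. Q \<subseteq> S \<and> card Q = r - 2 \<and> clique Q E}" for S :: "'a set"
  have cl: "finite (cl S) \<and> card (cl S) \<le> 2 ^ D" if "finite S" "card S \<le> D" for S
  proof -
    have "cl S \<subseteq> Pow S" unfolding cl_def by blast
    then have "finite (cl S)" "card (cl S) \<le> card (Pow S)"
      using that(1) by (auto intro: card_mono finite_subset)
    moreover have "card (Pow S) \<le> 2 ^ D" using that by (simp add: card_Pow power_increasing)
    ultimately show ?thesis by linarith
  qed
  show ?thesis
    unfolding clique_pair_bound_def
  proof (rule set_pair_bound[where A = "\<lambda>x. cl (nbr E (y x))" and B = "\<lambda>x. cl (nbr E x \<inter> W)"])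
    show "finite U" using V(1) assms(3) finite_subset by blast
    show "finite (cl (nbr E (y x))) \<and> card (cl (nbr E (y x))) \<le> 2 ^ D" if "x \<in> U" for x
      using cl[OF finN] y[OF that] by blast
    show "finite (cl (nbr E x \<inter> W)) \<and> card (cl (nbr E x \<inter> W)) \<le> 2 ^ D" if "x \<in> U" for x
      by (rule cl) (use finN y[OF that] in auto)
    show "cl (nbr E (y x)) \<inter> cl (nbr E x \<inter> W) = {}" if "x \<in> U" for x
    proof -
      have "\<not> clique Q E" if "Q \<subseteq> nbr E (y x)" "Q \<subseteq> nbr E x" "card Q = r - 2" for Q
        by (rule no_clique_common_nbr[OF V(2,3) assms(2), of "y x" x])
          (use that y[OF \<open>x \<in> U\<close>] finite_subset[OF that(1) finN] in auto)
      then show ?thesis unfolding cl_def by blast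
    qed
    show "card {x' \<in> U. cl (nbr E (y x)) \<inter> cl (nbr E x' \<inter> W) = {}} \<le> D + 1" if "x \<in> U" for x
    proof -
      \<comment> \<open>If \<open>x'\<close> is neither equal nor adjacent to \<open>y x\<close>,
        saturation puts an \<open>(r-2)\<close>-clique into both neighbourhoods; since
        \<open>nbr E (y x)\<close> lies in \<open>W\<close>, this clique belongs to both
        families.\<close>
      have "{x' \<in> U. cl (nbr E (y x)) \<inter> cl (nbr E x' \<inter> W) = {}} \<subseteq> insert (y x) (nbr E (y x))"
      proof (rule ccontr)
        assume "\<not> ?thesis"
        then obtain x' where x': "x' \<in> U" "cl (nbr E (y x)) \<inter> cl (nbr E x' \<inter> W) = {}" "x' \<noteq> y x" "x' \<notin> nbr E (y x)"
          by blast
        have "y x \<in> V" using y[OF \<open>x \<in> U\<close>] nbr_subset[OF V(2)] by blast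
        then obtain Q where "Q \<subseteq> nbr E x' \<inter> nbr E (y x)" "finite Q" "card Q = r - 2" "clique Q E"
          using is_saturated_nonadjacent[OF sat _ _ x'(3,4)] x'(1) assms(3) by blast
        then have "Q \<in> cl (nbr E (y x)) \<inter> cl (nbr E x' \<inter> W)"
          using y[OF \<open>x \<in> U\<close>] unfolding cl_def by blast
        then show False using x'(2) by blast
      qed
      then have "card {x' \<in> U. cl (nbr E (y x)) \<inter> cl (nbr E x' \<inter> W) = {}} \<le> card (insert (y x) (nbr E (y x)))"
        using finN by (intro card_mono) auto
      also have "\<dots> \<le> D + 1" using y[OF that] by (intro card_insert_le_m1) auto
      finally show ?thesis .
    qed
  qed
qed

text \<open>Since \<open>J\<close> is independent, the stars at its vertices are disjoint and
  contain exactly the edges that meet \<open>J\<close>.\<close>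

lemma edges_avoiding_independent:
  assumes "finite V" "E \<subseteq> [V]\<^bsup>2\<^esup>" "J \<subseteq> V" "\<And>x. x \<in> J \<Longrightarrow> nbr E x \<inter> J = {}"
  shows "card E = card {e \<in> E. e \<subseteq> V - J} + (\<Sum>x\<in>J. card (nbr E x))"
proof -
  have fE: "finite E" using assms(1,2) finite_imp_finite_nsets finite_subset by metis
  have fJ: "finite J" using assms(1,3) finite_subset by blast
  have fN: "finite (nbr E x)" for x using nbr_subset[OF assms(2)] assms(1) finite_subset by blast
  define ed where "ed x = (\<lambda>u. {u, x}) ` nbr E x" for x
  have ced: "card (ed x) = card (nbr E x)" for x
    unfolding ed_def by (rule card_image) (auto simp: inj_on_def doubleton_eq_iff)
  have inter: "ed x \<inter> ed y = {}" if "x \<in> J" "y \<in> J" "x \<noteq> y" for x y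
    using that(2,3) assms(4)[OF that(1)] unfolding ed_def by (auto simp: doubleton_eq_iff)
  have U: "E = {e \<in> E. e \<subseteq> V - J} \<union> (\<Union>x\<in>J. ed x)"
  proof
    show "E \<subseteq> {e \<in> E. e \<subseteq> V - J} \<union> (\<Union>x\<in>J. ed x)"
    proof
      fix e assume e: "e \<in> E"
      then obtain u v where uv: "e = {u, v}" "u \<in> V" "v \<in> V" using assms(2) by (meson nsets2_E subsetD)
      show "e \<in> {e \<in> E. e \<subseteq> V - J} \<union> (\<Union>x\<in>J. ed x)"
      proof (cases "e \<subseteq> V - J")
        case False
        then obtain x w where "x \<in> J" "e = {w, x}" using uv by auto
        then have "e \<in> ed x" using e unfolding ed_def nbr_def by blast
        then show ?thesis using \<open>x \<in> J\<close> by blast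
      qed (use e in simp)
    qed
    show "{e \<in> E. e \<subseteq> V - J} \<union> (\<Union>x\<in>J. ed x) \<subseteq> E"
      unfolding ed_def nbr_def by auto
  qed
  have "card E = card {e \<in> E. e \<subseteq> V - J} + card (\<Union>x\<in>J. ed x)"
  proof (subst U, rule card_Un_disjoint)
    show "{e \<in> E. e \<subseteq> V - J} \<inter> (\<Union>x\<in>J. ed x) = {}" unfolding ed_def by auto
  qed (use fE fJ fN in \<open>auto simp: ed_def\<close>)
  also have "card (\<Union>x\<in>J. ed x) = (\<Sum>x\<in>J. card (ed x))"
    by (rule card_UN_disjoint) (use fJ fN inter in \<open>auto simp: ed_def\<close>)
  finally show ?thesis by (simp add: ced)
qed

lemma handshake:
  assumes "finite V" "E \<subseteq> [V]\<^bsup>2\<^esup>" "C \<subseteq> V"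
  shows "(\<Sum>v\<in>C. card (nbr E v \<inter> C)) = 2 * card {e \<in> E. e \<subseteq> C}"
proof -
  have fE: "finite E" using assms(1,2) finite_imp_finite_nsets finite_subset by metis
  have fC: "finite C" using assms(1,3) finite_subset by blast
  have *: "card (nbr E v \<inter> C) = card {e \<in> {e \<in> E. e \<subseteq> C}. v \<in> e}" if "v \<in> C" for v
  proof (rule bij_betw_same_card[of "\<lambda>u. {u, v}"], rule bij_betwI')
    show "\<exists>u\<in>nbr E v \<inter> C. e = {u, v}" if e: "e \<in> {e \<in> {e \<in> E. e \<subseteq> C}. v \<in> e}" for e
    proof -
      have "e \<in> [V]\<^bsup>2\<^esup>" using e assms(2) by auto
      then obtain a b where "e = {a, b}" "a \<noteq> b" by (rule nsets2_E)
      then obtain u where "e = {u, v}" using e by blast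
      then show ?thesis using e unfolding nbr_def by blast
    qed
  next
    show "({u, v} = {u', v}) = (u = u')" for u u' by (auto simp: doubleton_eq_iff)
    show "{u, v} \<in> {e \<in> {e \<in> E. e \<subseteq> C}. v \<in> e}" if "u \<in> nbr E v \<inter> C" for u
      using that \<open>v \<in> C\<close> by (simp add: nbr_def)
  qed
  have "(\<Sum>v\<in>C. card (nbr E v \<inter> C)) = (\<Sum>v\<in>C. card {e \<in> {e \<in> E. e \<subseteq> C}. v \<in> e})"
    by (rule sum.cong[OF refl *])
  also have "\<dots> = 2 * card {e \<in> E. e \<subseteq> C}"
  proof (rule sum_multicount)
    show "\<forall>e\<in>{e \<in> E. e \<subseteq> C}. card {v \<in> C. v \<in> e} = 2"
    proof
      fix e assume e: "e \<in> {e \<in> E. e \<subseteq> C}"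
      then have "{v \<in> C. v \<in> e} = e" by blast
      then show "card {v \<in> C. v \<in> e} = 2" using e assms(2) by (auto simp: nsets_def)
    qed
  qed (use fE fC in auto)
  finally show ?thesis .
qed

text \<open>\<open>L'\<close> collects the low-degree vertices with a low-degree neighbour, so the
  neighbours of a vertex of \<open>I\<close> all lie in \<open>M\<close>. The graph is cut at
  \<open>C' = V - J\<close>, with \<open>J\<close> the vertices of degree exactly \<open>t\<close>
  in \<open>I\<close>; this \<open>C'\<close> is the \<open>C\<close> of the conclusion. Every
  vertex of \<open>I - J\<close> sends at least \<open>t + 1\<close> edges into
  \<open>V - I\<close>, nearly every vertex of \<open>M\<close> accounts for \<open>2t\<close> edges
  inside \<open>V - I\<close>, and \<open>L'\<close> is bounded.\<close>

lemma saturated_core: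
  fixes V :: "'a set"
  assumes sat: "is_saturated r V E" and r: "3 \<le> r" and t: "1 \<le> t"
    and deg: "\<And>v. v \<in> V \<Longrightarrow> t \<le> card (nbr E v)"
    and twin: "\<And>u v. u \<in> V \<Longrightarrow> v \<in> V \<Longrightarrow> u \<noteq> v \<Longrightarrow> nbr E u = nbr E v \<Longrightarrow> \<exists>w\<in>nbr E u. card (nbr E w) = t"
  obtains C \<F> where "C \<subseteq> V" "max_sys r t C {e \<in> E. e \<subseteq> C} \<F>" "card \<F> = card V - card C"
    "card E = t * (card V - card C) + card {e \<in> E. e \<subseteq> C}"
    "(t + 1) * card C \<le> card {e \<in> E. e \<subseteq> C} + 4 * t * clique_pair_bound (4 * t + 1)"
proof -
  \<comment> \<open>Degrees in \<open>M\<close> exceed \<open>4t\<close>, so a vertex with fewer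
    than \<open>4t\<close> neighbours in \<open>C\<close> has one outside; they also exceed
    \<open>t\<close>, so no vertex of degree \<open>t\<close> lies in \<open>M\<close>.\<close>
  define D where "D = 4 * t + 1"
  have V: "finite V" "E \<subseteq> [V]\<^bsup>2\<^esup>" "\<not> has_clique r E V" using sat unfolding is_saturated_def by auto
  have NV: "nbr E v \<subseteq> V" for v using nbr_subset[OF V(2)] .
  have fN: "finite (nbr E v)" for v using NV V(1) finite_subset by blast
  define M where "M = {v \<in> V. D \<le> card (nbr E v)}"
  define L' where "L' = {x \<in> V - M. \<exists>y\<in>V - M. y \<in> nbr E x}"
  define I where "I = V - M - L'"
  define C where "C = V - I"
  define Z where "Z = {z \<in> M. card (nbr E z \<inter> C) < 4 * t}"
  define J where "J = {x \<in> I. card (nbr E x) = t}"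
  define C' where "C' = V - J"
  have low: "card (nbr E x) \<le> D" if "x \<in> V - M" for x using that unfolding M_def by auto
  have IM: "nbr E x \<subseteq> M" if "x \<in> I" for x
    using that NV[of x] unfolding I_def L'_def by auto
  have IC: "nbr E x \<subseteq> C" if "x \<in> I" for x
    using IM[OF that] unfolding C_def I_def M_def by auto
  have sub: "M \<subseteq> V" "L' \<subseteq> V" "I \<subseteq> V" "C \<subseteq> V" "Z \<subseteq> M" "J \<subseteq> I"
    unfolding M_def L'_def I_def C_def Z_def J_def by auto
  have fin: "finite M" "finite L'" "finite I" "finite C" "finite Z" "finite J"
    using sub V(1) by (meson finite_subset)+
  have cL': "card L' \<le> clique_pair_bound D"
  proof -
    define y where "y x = (SOME y. y \<in> V - M \<and> y \<in> nbr E x)" for x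
    have y: "y x \<in> V - M \<and> y x \<in> nbr E x" if "x \<in> L'" for x
      unfolding y_def by (rule someI_ex) (use that in \<open>auto simp: L'_def\<close>)
    show ?thesis
    proof (rule card_le_clique_pair_bound[OF sat _ sub(2), of y V])
      show "y x \<in> nbr E x \<and> nbr E (y x) \<subseteq> V \<and> card (nbr E (y x)) \<le> D \<and> card (nbr E x \<inter> V) \<le> D" if "x \<in> L'" for x
      proof -
        have "nbr E x \<inter> V = nbr E x" "x \<in> V - M" using NV[of x] that unfolding L'_def by auto
        then show ?thesis using y[OF that] NV[of "y x"] low by auto
      qed
    qed (use r in simp)
  qed
  \<comment> \<open>A vertex of \<open>Z\<close> has a neighbour in \<open>I\<close>, whose whole
    neighbourhood lies in \<open>C\<close>. With \<open>W = C\<close> only cliques inside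
    \<open>C\<close> count, and the possibly huge degree of the vertex does no harm.\<close>
  have cZ: "card Z \<le> clique_pair_bound D"
  proof -
    define y where "y x = (SOME y. y \<in> I \<and> y \<in> nbr E x)" for x
    have y: "y x \<in> I \<and> y x \<in> nbr E x" if "x \<in> Z" for x
      unfolding y_def
    proof (rule someI_ex, rule ccontr)
      assume "\<nexists>y. y \<in> I \<and> y \<in> nbr E x"
      then have "nbr E x \<inter> C = nbr E x" using NV[of x] unfolding C_def by blast
      then show False using that unfolding Z_def M_def D_def by auto
    qed
    show ?thesis
    proof (rule card_le_clique_pair_bound[OF sat, of Z y C])
      show "y x \<in> nbr E x \<and> nbr E (y x) \<subseteq> C \<and> card (nbr E (y x)) \<le> D \<and> card (nbr E x \<inter> C) \<le> D" if "x \<in> Z" for x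
        using y[OF that] IC low[of "y x"] that unfolding Z_def D_def I_def by auto
    qed (use r sub in auto)
  qed
  have indI: "nbr E x \<inter> I = {}" if "x \<in> I" for x
    using IM[OF that] unfolding I_def by blast
  have indJ: "nbr E x \<inter> J = {}" if "x \<in> J" for x
    using indI[of x] that sub(6) by blast
  have NJ: "nbr E x \<subseteq> C'" if "x \<in> J" for x using NV[of x] indJ[OF that] unfolding C'_def by blast
  have cC': "card V - card C' = card J"
    using V(1) sub unfolding C'_def by (metis card_Diff_subset card_mono diff_diff_cancel finite_subset order_trans)
  have E1: "card E = t * card J + card {e \<in> E. e \<subseteq> C'}"
  proof -
    have "(\<Sum>x\<in>J. card (nbr E x)) = (\<Sum>x\<in>J. t)" by (rule sum.cong) (auto simp: J_def)
    then show ?thesis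
      using edges_avoiding_independent[OF V(1,2), of J] sub indJ unfolding C'_def by simp
  qed
  have E2: "card E = (\<Sum>x\<in>I. card (nbr E x)) + card {e \<in> E. e \<subseteq> C}"
    using edges_avoiding_independent[OF V(1,2) sub(3) indI] unfolding C_def by simp
  have "(\<Sum>x\<in>I. card (nbr E x)) \<ge> (t + 1) * card (I - J) + t * card J"
  proof -
    have "(\<Sum>x\<in>I. card (nbr E x)) = (\<Sum>x\<in>I - J. card (nbr E x)) + (\<Sum>x\<in>J. card (nbr E x))"
      by (rule sum.subset_diff[OF sub(6) fin(3)])
    moreover have "(\<Sum>x\<in>J. card (nbr E x)) = (\<Sum>x\<in>J. t)" by (rule sum.cong) (auto simp: J_def)
    moreover have "(\<Sum>x\<in>I - J. t + 1) \<le> (\<Sum>x\<in>I - J. card (nbr E x))"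
    proof (rule sum_mono)
      fix x assume "x \<in> I - J"
      then show "t + 1 \<le> card (nbr E x)" using deg[of x] sub unfolding J_def by force
    qed
    ultimately show ?thesis by (simp add: algebra_simps)
  qed
  then have E3: "card {e \<in> E. e \<subseteq> C'} \<ge> (t + 1) * card (I - J) + card {e \<in> E. e \<subseteq> C}"
    using E1 E2 by linarith
  have MC: "M \<subseteq> C" unfolding C_def I_def M_def by blast
  have "2 * card {e \<in> E. e \<subseteq> C} \<ge> 4 * t * (card M - card Z)"
  proof -
    have "4 * t * (card M - card Z) = (\<Sum>v\<in>M - Z. 4 * t)"
      using fin sub by (simp add: card_Diff_subset)
    also have "\<dots> \<le> (\<Sum>v\<in>M - Z. card (nbr E v \<inter> C))"
      by (rule sum_mono) (auto simp: Z_def)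
    also have "\<dots> \<le> (\<Sum>v\<in>C. card (nbr E v \<inter> C))"
      by (rule sum_mono2) (use fin MC in auto)
    also have "\<dots> = 2 * card {e \<in> E. e \<subseteq> C}" by (rule handshake[OF V(1,2) sub(4)])
    finally show ?thesis .
  qed
  moreover have "4 * t * card M \<le> 4 * t * (card M - card Z) + 4 * t * clique_pair_bound D"
  proof -
    have "card M \<le> (card M - card Z) + clique_pair_bound D" using cZ by linarith
    then have "4 * t * card M \<le> 4 * t * ((card M - card Z) + clique_pair_bound D)" by (rule mult_left_mono) simp
    then show ?thesis by (simp only: distrib_left)
  qed
  ultimately have E4: "2 * t * card M \<le> card {e \<in> E. e \<subseteq> C} + 2 * t * clique_pair_bound D" by linarith
  have "C' = M \<union> L' \<union> (I - J)" using sub unfolding C'_def I_def by blast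
  then have "card C' \<le> card M + card L' + card (I - J)"
    by (metis card_Un_le add_right_mono order_trans)
  then have "card C' \<le> card M + clique_pair_bound D + card (I - J)" using cL' by linarith
  then have "(t + 1) * card C' \<le> (t + 1) * (card M + clique_pair_bound D + card (I - J))" by (rule mult_left_mono) simp
  also have "\<dots> = (t + 1) * (card M + clique_pair_bound D) + (t + 1) * card (I - J)" by (simp add: algebra_simps)
  also have "(t + 1) * (card M + clique_pair_bound D) \<le> (2 * t) * (card M + clique_pair_bound D)"
    using t by (intro mult_right_mono) auto
  \<comment> \<open>The factor \<open>4t\<close> is \<open>2t\<close> for the vertices of
    \<open>Z\<close>, which were credited with edges they may lack, plus \<open>2t\<close> for those
    of \<open>L'\<close>.\<close>
  finally have fin_ineq: "(t + 1) * card C' \<le> card {e \<in> E. e \<subseteq> C'} + 4 * t * clique_pair_bound (4 * t + 1)"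
    using E3 E4 unfolding D_def by (simp add: algebra_simps)
  let ?E = "{e \<in> E. e \<subseteq> C'}"
  define \<F> where "\<F> = nbr E ` J"
  have JV: "J \<subseteq> V" using sub by blast
  \<comment> \<open>The twin condition is used here: twins in \<open>J\<close> would have a common
    neighbour of degree \<open>t\<close>, but the neighbours of \<open>J\<close> lie in
    \<open>M\<close>. Injectivity makes the number of members equal to
    \<open>card J\<close>.\<close>
  have inj: "inj_on (nbr E) J"
  proof (rule inj_onI, rule ccontr)
    fix x y assume xy: "x \<in> J" "y \<in> J" "nbr E x = nbr E y" "x \<noteq> y"
    then obtain w where "w \<in> nbr E x" "card (nbr E w) = t" using twin JV by blast
    moreover from this have "w \<in> M" using IM[of x] xy(1) sub(6) by blast
    ultimately show False unfolding M_def D_def by simp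
  qed
  have cF: "card \<F> = card V - card C'" unfolding \<F>_def cC' by (rule card_image[OF inj])
  have ms: "max_sys r t C' ?E \<F>"
    unfolding max_sys_def
  proof (intro conjI ballI impI)
    show "finite C'" using V(1) unfolding C'_def by simp
    show "?E \<subseteq> [C']\<^bsup>2\<^esup>" using V(2) by (auto simp: nsets_def)
    show "\<not> has_clique r ?E C'" using V(3) has_clique_mono[of r ?E C' E V] unfolding C'_def by blast
  next
    fix S assume "S \<in> \<F>"
    then obtain x where x: "x \<in> J" "S = nbr E x" unfolding \<F>_def by blast
    show "S \<subseteq> C'" "card S = t" using x NJ by (auto simp: J_def)
    show "\<not> has_clique (r - 1) ?E S"
    proof
      assume "has_clique (r - 1) ?E S"
      then obtain Q where Q: "Q \<subseteq> S" "finite Q" "card Q = r - 1" "clique Q ?E"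
        unfolding has_clique_def by blast
      then have "clique (insert x Q) E"
        using clique_insert_nbr[of Q E x] x(2) unfolding clique_def by blast
      moreover have "x \<notin> Q" using Q(1) x not_in_nbr_self[OF V(2)] by blast
      moreover have "insert x Q \<subseteq> V" using x(1) JV Q(1) NV x(2) by blast
      ultimately show False using V(3) Q r unfolding has_clique_def
        by (metis card_insert_disjoint finite_insert One_nat_def Suc_diff_1 numeral_3_eq_3 zero_less_Suc less_le_trans)
    qed
    show "has_clique (r - 1) ?E (insert v S)" if v: "v \<in> C' - S" for v
    proof -
      have "v \<noteq> x" "v \<in> V" "x \<in> V" using v x(1) JV unfolding C'_def by auto
      moreover have "v \<notin> nbr E x" using v x by blast
      ultimately obtain Q where Q: "Q \<subseteq> nbr E v \<inter> nbr E x" "finite Q" "card Q = r - 2" "clique Q E"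
        using is_saturated_nonadjacent[OF sat] by metis
      have "clique (insert v Q) E" using Q by (intro clique_insert_nbr) auto
      moreover have "insert v Q \<subseteq> C'" using v Q(1) NJ[OF x(1)] by auto
      ultimately have "clique (insert v Q) ?E" using clique_restrict by blast
      moreover have "v \<notin> Q" using Q(1) not_in_nbr_self[OF V(2)] by blast
      then have "card (insert v Q) = r - 1" using Q(2,3) r by simp
      moreover have "insert v Q \<subseteq> insert v S" using Q(1) x(2) by blast
      ultimately show ?thesis unfolding has_clique_def using Q(2) by (meson finite_insert)
    qed
  next
    fix S T assume "S \<in> \<F>" "T \<in> \<F>" and ST: "S \<noteq> T"
    then obtain x y where xy: "x \<in> J" "S = nbr E x" "y \<in> J" "T = nbr E y" unfolding \<F>_def by blast
    have "x \<noteq> y" "x \<in> V" "y \<in> V" using xy ST JV by auto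
    moreover have "x \<notin> nbr E y" using indJ[OF xy(3)] xy(1) by blast
    ultimately obtain Q where Q: "Q \<subseteq> nbr E x \<inter> nbr E y" "finite Q" "card Q = r - 2" "clique Q E"
      using is_saturated_nonadjacent[OF sat] by metis
    moreover have "Q \<subseteq> C'" using Q(1) NJ[OF xy(1)] by blast
    then have "clique Q ?E" using clique_restrict Q(4) by blast
    ultimately show "has_clique (r - 2) ?E (S \<inter> T)" unfolding has_clique_def xy by blast
  next
    fix e assume e: "e \<in> [C']\<^bsup>2\<^esup> - ?E"
    have eC: "e \<subseteq> C'" using e by (auto simp: nsets_def)
    then have "e \<in> [V]\<^bsup>2\<^esup> - E" using e unfolding C'_def by (auto simp: nsets_def)
    then obtain Q where Q: "Q \<subseteq> V" "finite Q" "card Q = r" "clique Q (insert e E)"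
      using sat unfolding is_saturated_def has_clique_def by blast
    have restr: "clique P (insert e ?E)" if "P \<subseteq> Q" "P \<subseteq> C'" for P
      using Q(4) that unfolding clique_def by blast
    show "has_clique r (insert e ?E) C' \<or> (\<exists>S\<in>\<F>. has_clique (r - 1) (insert e ?E) S)"
    proof (cases "Q \<subseteq> C'")
      case True
      then show ?thesis using restr[of Q] Q unfolding has_clique_def by blast
    next
      case False
      \<comment> \<open>A blocking clique that leaves \<open>C'\<close> passes through some
        \<open>x \<in> J\<close>. The new pair avoids \<open>x\<close>, so the other
        \<open>r - 1\<close> vertices are neighbours of \<open>x\<close> and the block sits inside
        the member \<open>nbr E x\<close>.\<close>
      then obtain x where x: "x \<in> Q" "x \<in> J" using Q(1) unfolding C'_def by blast
      have "q \<in> nbr E x" if "q \<in> Q - {x}" for q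
      proof -
        have "{q, x} \<in> insert e E" using that x(1) Q(4) unfolding clique_def by blast
        moreover have "x \<notin> e" using eC x(2) unfolding C'_def by blast
        ultimately show ?thesis unfolding nbr_def by blast
      qed
      then have s: "Q - {x} \<subseteq> nbr E x" by blast
      then have "clique (Q - {x}) (insert e ?E)" using restr[of "Q - {x}"] NJ[OF x(2)] by blast
      moreover have "card (Q - {x}) = r - 1" using Q x by simp
      ultimately have "has_clique (r - 1) (insert e ?E) (nbr E x)"
        unfolding has_clique_def using s Q(2) by blast
      then show ?thesis using x(2) unfolding \<F>_def by blast
    qed
  qed
  show thesis
    by (rule that[OF _ ms cF _ fin_ineq]) (use E1 cC' in \<open>auto simp: C'_def\<close>)
qed

section \<open>Saturated graphs from systems\<close>

lemma has_cliqueI: "Q \<subseteq> U \<Longrightarrow> finite Q \<Longrightarrow> card Q = k \<Longrightarrow> clique Q E \<Longrightarrow> has_clique k E U"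
  unfolding has_clique_def by blast

text \<open>With \<open>0 < n\<close> the \<open>Min\<close> in \<open>min_degree\<close> ranges
  over a nonempty set.\<close>

lemma tsat_graph_iff:
  assumes "0 < n"
  shows "tsat_graph n r t (V, E) \<longleftrightarrow> is_saturated r V E \<and> card V = n \<and> (\<forall>v\<in>V. t \<le> card (nbr E v)) \<and>
     (\<forall>u\<in>V. \<forall>v\<in>V. u \<noteq> v \<longrightarrow> nbr E u = nbr E v \<longrightarrow> (\<exists>w\<in>nbr E u. card (nbr E w) = t))"
proof (cases "finite V \<and> E \<subseteq> [V]\<^bsup>2\<^esup> \<and> card V = n")
  case True
  then have N: "neighbourhood (V, E) v = nbr E v" for v
    using nbr_subset[of E V v] unfolding neighbourhood_def nbr_def by auto
  have sat: "K_saturated r (V, E) \<longleftrightarrow> is_saturated r V E"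
    using True unfolding K_saturated_def is_saturated_def by (auto simp: contains_K_iff_has_clique add_edge_def non_edges_def)
  have "V \<noteq> {}" using True assms by auto
  then have "t \<le> min_degree (V, E) \<longleftrightarrow> (\<forall>v\<in>V. t \<le> card (nbr E v))"
    using True unfolding min_degree_def by (simp add: Defs.degree_def N)
  then show ?thesis
    using True sat unfolding tsat_graph_def simple_graph_def twins_def
    by (auto simp: N Defs.degree_def)
next
  case False
  then show ?thesis unfolding tsat_graph_def simple_graph_def is_saturated_def by auto
qed

section \<open>Size estimates for maximal systems\<close>

lemma max_sys_vertexE:
  assumes m: "max_sys r t V E \<F>" and "S \<in> \<F>" "v \<in> V - S"
  obtains Q where "Q \<subseteq> S" "v \<notin> Q" "finite Q" "card Q = r - 2" "clique Q E" "\<forall>q\<in>Q. {q, v} \<in> E"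
  using has_clique_insert_vertexE[OF max_sysD(10)[OF m, of S v] max_sysD(9)[OF m, of S]] assms(2,3)
  by (metis DiffE diff_diff_left nat_1_add_1)

lemma max_sys_verts_subset:
  assumes m: "max_sys r t V E \<F>" and "3 \<le> r" "S \<in> \<F>"
  shows "V \<subseteq> S \<union> \<Union> E"
proof
  fix v assume "v \<in> V"
  show "v \<in> S \<union> \<Union> E"
  proof (cases "v \<in> S")
    case False
    then obtain Q where Q: "card Q = r - 2" "\<forall>q\<in>Q. {q, v} \<in> E"
      using max_sys_vertexE[OF m assms(3)] \<open>v \<in> V\<close> by (metis DiffI)
    then have "Q \<noteq> {}" using assms(2) by auto
    then show ?thesis using Q(2) by blast
  qed simp
qed

text \<open>Each vertex outside a fixed member has a neighbour in it, because
  \<open>r - 2 \<ge> 1\<close>; so edges cover all but at most \<open>t\<close> vertices. Costs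
  proportional to \<open>card V\<close> can thereby be charged to the number of edges.\<close>

lemma max_sys_card_verts_le:
  assumes m: "max_sys r t V E \<F>" and "3 \<le> r" "\<F> \<noteq> {}"
  shows "card V \<le> t + 2 * card E"
proof -
  note D = max_sysD[OF m]
  obtain S where S: "S \<in> \<F>" using assms(3) by blast
  have e2: "finite e \<and> card e = 2" if "e \<in> E" for e using D(2) that by (auto simp: nsets_def)
  have "card (\<Union> E) \<le> (\<Sum>e\<in>E. card e)" using D(3) e2 by (intro card_Union_le_sum_card)
  also have "\<dots> = 2 * card E" using e2 by simp
  finally have "card (\<Union> E) \<le> 2 * card E" .
  moreover have "card V \<le> card (S \<union> \<Union> E)"
    using max_sys_verts_subset[OF m assms(2) S] D(3,7) S e2 by (intro card_mono) auto
  ultimately show ?thesis using card_Un_le[of S "\<Union> E"] D(6)[OF S] by linarith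
qed

text \<open>Without edges, \<open>V\<close> would be contained in any one member \<open>S\<close>,
  leaving only the \<open>2 ^ t\<close> subsets of \<open>S\<close> as possible members.\<close>

lemma max_sys_edges_nonempty:
  assumes m: "max_sys r t V E \<F>" and "3 \<le> r" "2 ^ t < card \<F>"
  shows "0 < card E"
proof (rule ccontr)
  note D = max_sysD[OF m]
  assume "\<not> 0 < card E"
  then have "E = {}" using D(3) by simp
  have "\<F> \<noteq> {}" using assms(3) by auto
  then obtain S where S: "S \<in> \<F>" by blast
  then have "\<F> \<subseteq> Pow S" using max_sys_verts_subset[OF m assms(2) S] D(5) \<open>E = {}\<close> by blast
  then have "card \<F> \<le> card (Pow S)" using D(7)[OF S] by (intro card_mono) auto
  then show False using assms(3) D(6,7)[OF S] by (simp add: card_Pow)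
qed

section \<open>Repairing degrees and twins at bounded cost\<close>

lemma clique_insert_edge_nbr:
  assumes "clique Q (insert e E)" "x \<in> Q" "x \<notin> e"
  shows "Q - {x} \<subseteq> nbr E x"
proof
  fix q assume "q \<in> Q - {x}"
  then have "{q, x} \<in> insert e E" using assms(1,2) unfolding clique_def by blast
  then show "q \<in> nbr E x" using assms(3) unfolding nbr_def by auto
qed

text \<open>The sum in the hypothesis is the degree of \<open>x\<close> after a vertex has been
  attached to every member. A new edge was blocked either by a deleted member or by a
  \<open>K_r\<close> through \<open>x\<close>, and then lies inside that member or inside
  \<open>nbr E x\<close>: at most \<open>t\<close> sets with at most \<open>t\<close> elements
  each.\<close>

lemma max_sys_delete_low_degree:
  assumes m: "max_sys r t V E \<F>" and x: "x \<in> V" and low: "card (nbr E x) + card {S \<in> \<F>. x \<in> S} < t"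
  obtains E' where "max_sys r t (V - {x}) E' {S \<in> \<F>. x \<notin> S}" "card E' \<le> card E + t ^ 3"
proof -
  note D = max_sysD[OF m]
  let ?F' = "{S \<in> \<F>. x \<notin> S}"
  let ?G = "insert (nbr E x) {S \<in> \<F>. x \<in> S}"
  have fN: "finite (nbr E x)" using nbr_subset[OF D(2)] D(1) finite_subset by blast
  obtain E' where E': "max_sys r t (V - {x}) E' ?F'"
    "\<And>e. e \<in> E' \<Longrightarrow> e \<notin> E \<Longrightarrow> (\<exists>S\<in>\<F> - ?F'. e \<subseteq> S) \<or>
       (\<exists>Q\<subseteq>V. \<not> Q \<subseteq> V - {x} \<and> finite Q \<and> card Q = r \<and> e \<subseteq> Q \<and> clique Q (insert e E))"
    using max_sys_restrict[OF m, of "V - {x}" ?F'] D(5)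
    by (metis (no_types, lifting) Diff_subset mem_Collect_eq subsetI subset_Diff_insert Diff_empty)
  have "E' \<subseteq> E \<union> {e. \<exists>S\<in>?G. e \<in> [S]\<^bsup>2\<^esup>}"
  proof
    fix e assume e: "e \<in> E'"
    have e2: "e \<in> [V - {x}]\<^bsup>2\<^esup>" using max_sysD(2)[OF E'(1)] e by blast
    show "e \<in> E \<union> {e. \<exists>S\<in>?G. e \<in> [S]\<^bsup>2\<^esup>}"
    proof (cases "e \<in> E")
      case False
      have "\<exists>S\<in>?G. e \<subseteq> S"
        using E'(2)[OF e False]
      proof
        assume "\<exists>Q\<subseteq>V. \<not> Q \<subseteq> V - {x} \<and> finite Q \<and> card Q = r \<and> e \<subseteq> Q \<and> clique Q (insert e E)"
        then obtain Q where Q: "x \<in> Q" "e \<subseteq> Q" "clique Q (insert e E)" by blast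
        have "x \<notin> e" using e2 by (auto simp: nsets_def)
        then have "e \<subseteq> nbr E x" using clique_insert_edge_nbr[OF Q(3,1)] Q(2) by blast
        then show ?thesis by blast
      qed blast
      then show ?thesis using e2 by (auto simp: nsets_def)
    qed simp
  qed
  moreover have cG: "card ?G \<le> t" using low by (intro card_insert_le_m1) auto
  moreover have GS: "finite S \<and> card S \<le> t" if "S \<in> ?G" for S using that D(6,7) fN low by auto
  have fG: "finite ?G" using D(4) by simp
  note P = card_pairs_inside_le[OF fG GS]
  ultimately have "card E' \<le> card (E \<union> {e. \<exists>S\<in>?G. e \<in> [S]\<^bsup>2\<^esup>})"
    using D(3) P(1) by (intro card_mono finite_UnI)
  moreover have "card ?G * t\<^sup>2 \<le> t * t\<^sup>2" using cG by (rule mult_right_mono) simp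
  ultimately have "card E' \<le> card (E \<union> {e. \<exists>S\<in>?G. e \<in> [S]\<^bsup>2\<^esup>})" "card {e. \<exists>S\<in>?G. e \<in> [S]\<^bsup>2\<^esup>} \<le> t * t\<^sup>2"
    using P(2) by linarith+
  then have "card E' \<le> card E + t ^ 3"
    using card_Un_le[of E "{e. \<exists>S\<in>?G. e \<in> [S]\<^bsup>2\<^esup>}"] by (simp add: power3_eq_cube power2_eq_square)
  then show thesis using that E'(1) by blast
qed

text \<open>No new edge appears, because every block through \<open>x\<close> has a substitute: if
  \<open>nbr E x\<close> is a member, the rest of the clique already blocks inside it; if
  \<open>y\<close> is a twin, \<open>y\<close> takes the place of \<open>x\<close>.\<close>

lemma max_sys_delete_twin:
  assumes m: "max_sys r t V E \<F>" and x: "x \<in> V" "x \<notin> \<Union> \<F>"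
    and tw: "nbr E x \<in> \<F> \<or> (\<exists>y\<in>V. y \<noteq> x \<and> nbr E x = nbr E y)"
  obtains E' where "max_sys r t (V - {x}) E' \<F>" "card E' \<le> card E"
proof -
  note D = max_sysD[OF m]
  have subs: "S \<subseteq> V - {x}" if "S \<in> \<F>" for S using D(5)[OF that] x(2) that by blast
  obtain E' where E': "max_sys r t (V - {x}) E' \<F>" "{e \<in> E. e \<subseteq> V - {x}} \<subseteq> E'"
    "\<And>e. e \<in> E' \<Longrightarrow> e \<notin> E \<Longrightarrow> (\<exists>S\<in>\<F> - \<F>. e \<subseteq> S) \<or>
       (\<exists>Q\<subseteq>V. \<not> Q \<subseteq> V - {x} \<and> finite Q \<and> card Q = r \<and> e \<subseteq> Q \<and> clique Q (insert e E))"
    using max_sys_restrict[OF m Diff_subset order_refl subs] by blast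
  have "E' \<subseteq> E"
  proof (rule ccontr)
    assume "\<not> E' \<subseteq> E"
    then obtain e where e: "e \<in> E'" "e \<notin> E" by blast
    have e2: "e \<in> [V - {x}]\<^bsup>2\<^esup>" using max_sysD(2)[OF E'(1)] e by blast
    obtain Q where Q: "Q \<subseteq> V" "x \<in> Q" "finite Q" "card Q = r" "e \<subseteq> Q" "clique Q (insert e E)"
      using E'(3)[OF e] by blast
    have "x \<notin> e" using e2 by (auto simp: nsets_def)
    then have QN: "Q - {x} \<subseteq> nbr E x" by (rule clique_insert_edge_nbr[OF Q(6,2)])
    have "clique (Q - {x}) (insert e {e \<in> E. e \<subseteq> V - {x}})" using Q(1,6) unfolding clique_def by blast
    then have cl: "clique (Q - {x}) E'" using E'(2) e(1) unfolding clique_def by blast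
    show False
      using tw
    proof
      assume S: "nbr E x \<in> \<F>"
      have "card (Q - {x}) = r - 1" using Q by simp
      then have "has_clique (r - 1) E' (nbr E x)" unfolding has_clique_def using cl QN Q(3) by blast
      then show False using max_sysD(9)[OF E'(1) S] by simp
    next
      assume "\<exists>y\<in>V. y \<noteq> x \<and> nbr E x = nbr E y"
      then obtain y where y: "y \<in> V" "y \<noteq> x" "nbr E x = nbr E y" by blast
      have yQ: "y \<notin> Q" using QN y not_in_nbr_self[OF D(2), of y] by blast
      have "Q - {x} \<subseteq> nbr E' y"
      proof
        fix q assume q: "q \<in> Q - {x}"
        then have "{q, y} \<in> E" using QN y(3) unfolding nbr_def by blast
        then show "q \<in> nbr E' y" using q Q(1) y E'(2) unfolding nbr_def by blast
      qed
      then have "clique (insert y (Q - {x})) E'" by (intro clique_insert_nbr cl)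
      moreover have "card (insert y (Q - {x})) = r" using Q(2-4) yQ card_Suc_Diff1[of Q x] by simp
      moreover have "insert y (Q - {x}) \<subseteq> V - {x}" using Q(1) y by blast
      ultimately have "has_clique r E' (V - {x})" using Q(3) by (intro has_cliqueI) auto
      then show False using max_sysD(8)[OF E'(1)] by simp
    qed
  qed
  then have "card E' \<le> card E" using D(3) card_mono by blast
  then show thesis using that E'(1) by blast
qed

text \<open>Exactly what the attached graph needs. The first clause is the minimum degree. The
  second forbids twins of vertices in no member, a new vertex having a member as its neighbourhood;
  a vertex in some member shares with each of its twins an attached vertex of degree
  \<open>t\<close>.\<close>

definition good_sys :: "nat \<Rightarrow> 'a set \<Rightarrow> 'a set set \<Rightarrow> 'a set set \<Rightarrow> bool" where
  "good_sys t V E \<F> \<longleftrightarrow> (\<forall>x\<in>V. t \<le> card (nbr E x) + card {S \<in> \<F>. x \<in> S}) \<and>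
     (\<forall>x\<in>V - \<Union> \<F>. nbr E x \<notin> \<F> \<and> (\<forall>y\<in>V - \<Union> \<F>. y \<noteq> x \<longrightarrow> nbr E x \<noteq> nbr E y))"

text \<open>A deletion may spoil other vertices, so it is repeated. Each round removes a vertex,
  loses fewer than \<open>t\<close> members or none, and adds at most \<open>t ^ 3\<close> edges,
  and there are at most \<open>card V\<close> rounds.\<close>

lemma max_sys_make_good:
  fixes V :: "'a set"
  assumes "max_sys r t V E \<F>"
  obtains V' :: "'a set" and E' \<F>' where "max_sys r t V' E' \<F>'" "good_sys t V' E' \<F>'" "card V' \<le> card V"
    "card \<F>' \<le> card \<F>" "card \<F> \<le> card \<F>' + t * card V" "card E' \<le> card E + t ^ 3 * card V"
proof -
  have "\<exists>V' E' \<F>'. max_sys r t V' E' \<F>' \<and> good_sys t V' E' \<F>' \<and> V' \<subseteq> V \<and> card \<F>' \<le> card \<F> \<and>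
    card \<F> \<le> card \<F>' + t * card V \<and> card E' \<le> card E + t ^ 3 * card V"
    using assms
  proof (induction "card V" arbitrary: V E \<F>)
    case 0
    then have "V = {}" using max_sysD(1)[OF 0(2)] by simp
    then have "good_sys t V E \<F>" unfolding good_sys_def by simp
    then show ?case using 0(2) by fastforce
  next
    case (Suc n)
    note m = Suc.prems
    note D = max_sysD[OF m]
    show ?case
    proof (cases "good_sys t V E \<F>")
      case True
      then show ?thesis using m by fastforce
    next
      case False
      have "\<exists>x E' \<F>'. x \<in> V \<and> max_sys r t (V - {x}) E' \<F>' \<and> card \<F>' \<le> card \<F> \<and> card \<F> \<le> card \<F>' + t \<and> card E' \<le> card E + t ^ 3"
      proof (cases "\<forall>x\<in>V. t \<le> card (nbr E x) + card {S \<in> \<F>. x \<in> S}")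
        case True
        then obtain x where x: "x \<in> V" "x \<notin> \<Union> \<F>" "nbr E x \<in> \<F> \<or> (\<exists>y\<in>V. y \<noteq> x \<and> nbr E x = nbr E y)"
          using False unfolding good_sys_def by blast
        obtain E' where "max_sys r t (V - {x}) E' \<F>" "card E' \<le> card E"
          using max_sys_delete_twin[OF m x] by blast
        then show ?thesis using x(1) by (meson le_add1 le_trans order_refl)
      next
        case False
        then obtain x where x: "x \<in> V" "card (nbr E x) + card {S \<in> \<F>. x \<in> S} < t" by (meson not_le)
        obtain E' where E': "max_sys r t (V - {x}) E' {S \<in> \<F>. x \<notin> S}" "card E' \<le> card E + t ^ 3"
          using max_sys_delete_low_degree[OF m x] by blast
        have "\<F> = {S \<in> \<F>. x \<notin> S} \<union> {S \<in> \<F>. x \<in> S}" by blast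
        then have "card \<F> \<le> card {S \<in> \<F>. x \<notin> S} + card {S \<in> \<F>. x \<in> S}" by (metis card_Un_le)
        then have "card \<F> \<le> card {S \<in> \<F>. x \<notin> S} + t" using x(2) by linarith
        moreover have "card {S \<in> \<F>. x \<notin> S} \<le> card \<F>" using D(4) by (intro card_mono) auto
        ultimately show ?thesis using E' x(1) by blast
      qed
      then obtain x E1 \<F>1 where x: "x \<in> V" "max_sys r t (V - {x}) E1 \<F>1" "card \<F>1 \<le> card \<F>"
        "card \<F> \<le> card \<F>1 + t" "card E1 \<le> card E + t ^ 3" by blast
      have n: "n = card (V - {x})" using x(1) Suc.hyps(2) by simp
      obtain V' E' \<F>' where IH: "max_sys r t V' E' \<F>'" "good_sys t V' E' \<F>'" "V' \<subseteq> V - {x}" "card \<F>' \<le> card \<F>1"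
        "card \<F>1 \<le> card \<F>' + t * card (V - {x})" "card E' \<le> card E1 + t ^ 3 * card (V - {x})"
        using Suc.hyps(1)[OF n x(2)] by blast
      have "card V = Suc (card (V - {x}))" using n Suc.hyps(2) by simp
      then have "card \<F> \<le> card \<F>' + t * card V" "card E' \<le> card E + t ^ 3 * card V"
        using IH(5,6) x(4,5) by auto
      then show ?thesis using IH x(3) by (meson Diff_subset le_trans subset_trans)
    qed
  qed
  then obtain V' E' \<F>' where S: "max_sys r t V' E' \<F>'" "good_sys t V' E' \<F>'" "V' \<subseteq> V" "card \<F>' \<le> card \<F>"
    "card \<F> \<le> card \<F>' + t * card V" "card E' \<le> card E + t ^ 3 * card V"
    by (elim exE conjE)
  show thesis using that[OF S(1,2) card_mono[OF max_sysD(1)[OF assms] S(3)] S(4-6)] .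
qed

text \<open>Keeping \<open>t\<close> sets through every vertex preserves the degrees; new edges lie inside members of
  \<open>\<F>\<close>, so they do not change the neighbourhoods of the vertices outside \<open>\<Union> \<F>\<close>.\<close>

lemma good_sys_shrink:
  assumes m: "max_sys r t V E \<F>" and good: "good_sys t V E \<F>" and "1 \<le> t" "t * card V \<le> k" "k \<le> card \<F>"
  obtains E' \<F>' where "max_sys r t V E' \<F>'" "good_sys t V E' \<F>'" "card \<F>' = k" "card E' \<le> card E + (card \<F> - k) * t\<^sup>2"
proof -
  note D = max_sysD[OF m]
  let ?F = "\<lambda>x. {S \<in> \<F>. x \<in> S}"
  have "\<exists>P. P \<subseteq> ?F x \<and> card P = min t (card (?F x))" for x
    using obtain_subset_with_card_n[of "min t (card (?F x))" "?F x"] by auto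
  then obtain P where P: "\<And>x. P x \<subseteq> ?F x" "\<And>x. card (P x) = min t (card (?F x))" by metis
  have "card (\<Union>x\<in>V. P x) \<le> (\<Sum>x\<in>V. card (P x))" by (rule card_UN_le[OF D(1)])
  also have "\<dots> \<le> (\<Sum>x\<in>V. t)" by (rule sum_mono) (simp add: P(2))
  also have "\<dots> \<le> k" using assms(4) by (simp add: mult.commute)
  finally have "card (\<Union>x\<in>V. P x) \<le> k" .
  moreover have "(\<Union>x\<in>V. P x) \<subseteq> \<F>" using P(1) by blast
  ultimately obtain \<F>' where F': "(\<Union>x\<in>V. P x) \<subseteq> \<F>'" "\<F>' \<subseteq> \<F>" "card \<F>' = k"
    using exists_subset_between[of "\<Union>x\<in>V. P x" k \<F>] assms(5) D(4) by blast
  obtain E' where E': "max_sys r t V E' \<F>'" "E \<subseteq> E'" "\<And>e. e \<in> E' \<Longrightarrow> e \<notin> E \<Longrightarrow> \<exists>S\<in>\<F> - \<F>'. e \<subseteq> S"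
    "card E' \<le> card E + card (\<F> - \<F>') * t\<^sup>2"
    using max_sys_subfamily[OF m F'(2)] by blast
  have fF': "finite \<F>'" using F'(2) D(4) finite_subset by blast
  have fN: "finite (nbr E' x)" for x using nbr_subset[OF max_sysD(2)[OF E'(1)]] D(1) finite_subset by blast
  \<comment> \<open>As \<open>1 \<le> t\<close>, some member through every covered vertex is kept;
    the uncovered vertices, for which twins are excluded, are the same before and after.\<close>
  have U: "\<Union> \<F>' = \<Union> \<F>"
  proof
    show "\<Union> \<F> \<subseteq> \<Union> \<F>'"
    proof
      fix x assume x: "x \<in> \<Union> \<F>"
      then have "0 < card (?F x)" using D(4) by (auto simp: card_gt_0_iff)
      then have "P x \<noteq> {}" using P(2)[of x] assms(3) by auto
      then show "x \<in> \<Union> \<F>'" using x D(5) P(1)[of x] F'(1) by blast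
    qed
  qed (use F'(2) in blast)
  have same: "nbr E' x = nbr E x" if "x \<notin> \<Union> \<F>" for x
    using E'(2,3) that unfolding nbr_def by blast
  have "t \<le> card (nbr E' x) + card {S \<in> \<F>'. x \<in> S}" if x: "x \<in> V" for x
  proof -
    have "P x \<subseteq> {S \<in> \<F>'. x \<in> S}" using P(1)[of x] F'(1) x by blast
    then have "card (P x) \<le> card {S \<in> \<F>'. x \<in> S}" using fF' by (intro card_mono) auto
    then have "min t (card (?F x)) \<le> card {S \<in> \<F>'. x \<in> S}" using P(2)[of x] by simp
    moreover have "card (nbr E x) \<le> card (nbr E' x)"
      using fN E'(2) by (intro card_mono) (auto simp: nbr_def)
    moreover have "t \<le> card (nbr E x) + card (?F x)" using good x unfolding good_sys_def by blast
    ultimately show ?thesis by linarith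
  qed
  moreover have "nbr E' x \<notin> \<F>' \<and> (\<forall>y\<in>V - \<Union> \<F>'. y \<noteq> x \<longrightarrow> nbr E' x \<noteq> nbr E' y)" if "x \<in> V - \<Union> \<F>'" for x
  proof -
    have x: "x \<in> V - \<Union> \<F>" using that U by simp
    then have gx: "nbr E x \<notin> \<F>" "\<forall>y\<in>V - \<Union> \<F>. y \<noteq> x \<longrightarrow> nbr E x \<noteq> nbr E y"
      using good unfolding good_sys_def by blast+
    then show ?thesis using same x F'(2) U by auto
  qed
  ultimately have "good_sys t V E' \<F>'" unfolding good_sys_def by blast
  moreover have "card (\<F> - \<F>') = card \<F> - k" using F' fF' by (simp add: card_Diff_subset)
  ultimately show thesis using that E' F'(3) by simp
qed

text \<open>Each kind of missing edge uses one clause of the definition of a system: pairs in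
  \<open>V\<close> the maximality, a pair of \<open>w\<close> and the vertex attached to
  \<open>S\<close> the maximal \<open>K_{r-1}\<close>-freeness of \<open>S\<close>, and two attached
  vertices the clique in \<open>S \<inter> T\<close>.\<close>

lemma tsat_graph_of_good_sys:
  fixes V :: "nat set"
  assumes m: "max_sys r t V E \<F>" and good: "good_sys t V E \<F>" and r: "3 \<le> r" and t: "1 \<le> t" and ne: "0 < card V + card \<F>"
  obtains G :: "nat graph" where "tsat_graph (card V + card \<F>) r t G" "card (edges G) = t * card \<F> + card E"
proof -
  note D = max_sysD[OF m]
  obtain f :: "nat set \<Rightarrow> nat" and k where f: "inj_on f \<F>" using finite_imp_inj_to_nat_seg[OF D(4)] by blast
  \<comment> \<open>The new vertices lie above \<open>Max V\<close>; inserting \<open>0\<close>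
    keeps the argument of \<open>Max\<close> nonempty.\<close>
  define g where "g S = Suc (Max (insert 0 V)) + f S" for S
  have gi: "inj_on g \<F>" using f unfolding g_def inj_on_def by simp
  have gV: "g S \<notin> V" for S
  proof
    assume "g S \<in> V"
    then have "g S \<le> Max (insert 0 V)" using D(1) by simp
    then show False unfolding g_def by simp
  qed
  define A where "A = (\<Union>S\<in>\<F>. (\<lambda>x. {g S, x}) ` S)"
  define EG where "EG = E \<union> A"
  define VG where "VG = V \<union> g ` \<F>"
  have EV: "e \<subseteq> V" if "e \<in> E" for e using that D(2) by (auto simp: nsets_def)
  have AE: "{u, v} \<in> A \<longleftrightarrow> (\<exists>S\<in>\<F>. u = g S \<and> v \<in> S \<or> v = g S \<and> u \<in> S)" for u v
    unfolding A_def by (auto simp: doubleton_eq_iff)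
  have N1: "nbr EG (g S) = S" if S: "S \<in> \<F>" for S
  proof -
    have "{u, g S} \<in> EG \<longleftrightarrow> u \<in> S" for u
    proof -
      have "{u, g S} \<notin> E" using EV gV by blast
      moreover have "g S \<notin> T" if "T \<in> \<F>" for T using D(5)[OF that] gV by blast
      moreover have "g S = g T \<longleftrightarrow> S = T" if "T \<in> \<F>" for T using S that gi by (auto simp: inj_on_def)
      ultimately show ?thesis
        unfolding EG_def using AE[of u "g S"] S by auto
    qed
    then show ?thesis unfolding nbr_def by blast
  qed
  have N2: "nbr EG x = nbr E x \<union> g ` {S \<in> \<F>. x \<in> S}" if x: "x \<in> V" for x
  proof -
    have "{u, x} \<in> A \<longleftrightarrow> (\<exists>S\<in>\<F>. u = g S \<and> x \<in> S)" for u
      using AE[of u x] gV x by auto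
    then show ?thesis unfolding nbr_def EG_def by auto
  qed
  have EGV: "EG \<subseteq> [VG]\<^bsup>2\<^esup>"
  proof
    fix e assume "e \<in> EG"
    then consider "e \<in> E" | S x where "S \<in> \<F>" "x \<in> S" "e = {g S, x}" unfolding EG_def A_def by blast
    then show "e \<in> [VG]\<^bsup>2\<^esup>"
    proof cases
      case 1
      then show ?thesis using D(2) nsets_mono[of V VG 2] unfolding VG_def by blast
    next
      case 2
      then show ?thesis using D(5) gV[of S] unfolding VG_def by auto
    qed
  qed
  have fVG: "finite VG" using D(1,4) unfolding VG_def by simp
  have EinV: "e \<in> E" if "e \<in> EG" "e \<subseteq> V" for e
    using that gV unfolding EG_def A_def by auto
  have cliqV: "clique Q E" if "clique Q EG" "Q \<subseteq> V" for Q
    using that EinV unfolding clique_def by (metis empty_subsetI insert_subset subsetD)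
  have noK: "\<not> has_clique r EG VG"
  proof
    assume "has_clique r EG VG"
    then obtain Q where Q: "Q \<subseteq> VG" "finite Q" "card Q = r" "clique Q EG" unfolding has_clique_def by blast
    show False
    proof (cases "Q \<subseteq> V")
      case True
      then show ?thesis using cliqV[OF Q(4)] Q D(8) unfolding has_clique_def by blast
    next
      case False
      then obtain S where S: "S \<in> \<F>" "g S \<in> Q" using Q(1) unfolding VG_def by blast
      have "Q - {g S} \<subseteq> nbr EG (g S)" using Q(4) S(2) unfolding clique_def nbr_def by blast
      then have "Q - {g S} \<subseteq> S" using N1[OF S(1)] by simp
      moreover from this have "clique (Q - {g S}) E"
        using D(5)[OF S(1)] by (intro cliqV clique_subset[OF Q(4)]) auto
      moreover have "card (Q - {g S}) = r - 1" using Q S by simp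
      ultimately show False using D(9)[OF S(1)] Q(2) unfolding has_clique_def by blast
    qed
  qed
  have up: "clique Q EG" if "clique Q E" for Q using that unfolding clique_def EG_def by blast
  have "has_clique r (insert e EG) VG" if e: "e \<in> [VG]\<^bsup>2\<^esup> - EG" for e
  proof -
    obtain u v where uv: "e = {u, v}" "u \<noteq> v" "u \<in> VG" "v \<in> VG" using e by (auto elim!: nsets2_E)
    have common: ?thesis if Q: "Q \<subseteq> nbr EG u \<inter> nbr EG v" "finite Q" "card Q = r - 2" "clique Q E" for Q
    proof -
      have "u \<notin> Q" "v \<notin> Q" using Q(1) not_in_nbr_self[OF EGV] by blast+
      then have "card (insert u (insert v Q)) = r" using Q(2,3) uv(2) r by simp
      moreover have "clique (insert u (insert v Q)) (insert e EG)"
        using up[OF Q(4)] Q(1) uv(1) unfolding clique_def nbr_def by (auto simp: insert_commute)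
      moreover have "insert u (insert v Q) \<subseteq> VG" using uv Q(1) nbr_subset[OF EGV] by blast
      ultimately show ?thesis using Q(2) by (intro has_cliqueI[of "insert u (insert v Q)"]) auto
    qed
    have mixed: "\<exists>Q. Q \<subseteq> nbr EG (g S) \<inter> nbr EG w \<and> finite Q \<and> card Q = r - 2 \<and> clique Q E"
      if S: "S \<in> \<F>" and w: "w \<in> V" "{w, g S} \<notin> EG" for S w
    proof -
      have "w \<notin> S" using w N1[OF S] unfolding nbr_def by blast
      then obtain Q where Q: "Q \<subseteq> S" "finite Q" "card Q = r - 2" "clique Q E" "\<forall>q\<in>Q. {q, w} \<in> E"
        using max_sys_vertexE[OF m S] w(1) by (metis DiffI)
      then show ?thesis using N1[OF S] unfolding nbr_def EG_def by blast
    qed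
    consider "u \<in> V" "v \<in> V" | S where "S \<in> \<F>" "u = g S" "v \<in> V" | S where "S \<in> \<F>" "v = g S" "u \<in> V"
      | S T where "S \<in> \<F>" "u = g S" "T \<in> \<F>" "v = g T" using uv(3,4) unfolding VG_def by blast
    then show ?thesis
    proof cases
      case 1
      then have "e \<in> [V]\<^bsup>2\<^esup>" "e \<notin> E" using uv e unfolding EG_def by auto
      from D(12)[OF this] show ?thesis
      proof
        assume "has_clique r (insert e E) V"
        then show ?thesis by (rule has_clique_mono) (auto simp: EG_def VG_def)
      next
        assume "\<exists>S\<in>\<F>. has_clique (r - 1) (insert e E) S"
        then obtain S Q where S: "S \<in> \<F>" and Q: "Q \<subseteq> S" "finite Q" "card Q = r - 1" "clique Q (insert e E)"
          unfolding has_clique_def by blast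
        have "g S \<notin> Q" using Q(1) D(5)[OF S] gV by blast
        then have "card (insert (g S) Q) = r" using Q r by simp
        moreover have "Q \<subseteq> nbr (insert e EG) (g S)" using Q(1) N1[OF S] unfolding nbr_def by blast
        moreover have "clique Q (insert e EG)" using Q(4) unfolding clique_def EG_def by blast
        ultimately show ?thesis
          unfolding has_clique_def using clique_insert_nbr[of Q "insert e EG" "g S"] Q(1,2) S D(5)[OF S]
          by (intro exI[of _ "insert (g S) Q"]) (auto simp: VG_def)
      qed
    next
      case 2
      then show ?thesis using mixed[of S v] common e uv(1) by (metis DiffE insert_commute)
    next
      case 3
      then show ?thesis using mixed[of S u] common e uv(1) by (metis DiffE inf_commute)
    next
      case 4
      then have "S \<noteq> T" using uv by blast
      then have "has_clique (r - 2) E (S \<inter> T)" using D(11) 4 by blast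
      then obtain Q where "Q \<subseteq> S \<inter> T" "finite Q" "card Q = r - 2" "clique Q E" unfolding has_clique_def by blast
      then show ?thesis using common[of Q] N1 4 by simp
    qed
  qed
  then have sat: "is_saturated r VG EG" unfolding is_saturated_def using fVG EGV noK by blast
  have cV: "card VG = card V + card \<F>"
    unfolding VG_def using D(1,4) gV card_image[OF gi] by (subst card_Un_disjoint) auto
  have degV: "card (nbr EG x) = card (nbr E x) + card {S \<in> \<F>. x \<in> S}" if x: "x \<in> V" for x
  proof -
    have "nbr E x \<subseteq> V" using nbr_subset[OF D(2)] .
    then have "card (nbr E x \<union> g ` {S \<in> \<F>. x \<in> S}) = card (nbr E x) + card (g ` {S \<in> \<F>. x \<in> S})"
      using D(1,4) gV by (intro card_Un_disjoint) (auto intro: finite_subset)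
    also have "card (g ` {S \<in> \<F>. x \<in> S}) = card {S \<in> \<F>. x \<in> S}"
      by (rule card_image) (use gi in \<open>auto simp: inj_on_def\<close>)
    finally show ?thesis using N2[OF x] by simp
  qed
  have deg: "t \<le> card (nbr EG v)" if "v \<in> VG" for v
    using that N1 D(6) degV good unfolding VG_def good_sys_def by auto
  have outside: False if x: "x \<in> V" "x \<notin> \<Union> \<F>" and y: "y \<in> VG" "x \<noteq> y" "nbr EG x = nbr EG y" for x y
  proof -
    have Nx: "nbr EG x = nbr E x" using N2[OF x(1)] x(2) by auto
    show False
    proof (cases "y \<in> V")
      case True
      have "{S \<in> \<F>. y \<in> S} = {}"
      proof (rule ccontr)
        assume "{S \<in> \<F>. y \<in> S} \<noteq> {}"
        then obtain S where "S \<in> \<F>" "g S \<in> nbr EG y" using N2[OF True] by blast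
        then show False using y(3) Nx nbr_subset[OF D(2), of x] gV by blast
      qed
      then have "y \<notin> \<Union> \<F>" "nbr EG y = nbr E y" using N2[OF True] by auto
      then show False using good x True y Nx unfolding good_sys_def by (metis DiffI)
    next
      case False
      then obtain S where "S \<in> \<F>" "y = g S" using y(1) unfolding VG_def by blast
      then have "nbr E x \<in> \<F>" using N1 y(3) Nx by simp
      then show False using good x unfolding good_sys_def by blast
    qed
  qed
  have inside: "\<exists>w\<in>nbr EG x. card (nbr EG w) = t" if x: "x \<in> V" "x \<in> \<Union> \<F>" for x
  proof -
    obtain S where S: "S \<in> \<F>" "x \<in> S" using x(2) by blast
    then have "g S \<in> nbr EG x" using N2[OF x(1)] by blast
    moreover have "card (nbr EG (g S)) = t" using N1 D(6) S(1) by simp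
    ultimately show ?thesis by blast
  qed
  have twin: "\<exists>w\<in>nbr EG u. card (nbr EG w) = t" if uv: "u \<in> VG" "v \<in> VG" "u \<noteq> v" "nbr EG u = nbr EG v" for u v
  proof (cases "u \<in> V \<or> v \<in> V")
    case True
    then show ?thesis using inside outside uv by metis
  next
    case False
    then obtain S T where "S \<in> \<F>" "u = g S" "T \<in> \<F>" "v = g T" using uv(1,2) unfolding VG_def by blast
    then show ?thesis using N1 uv by metis
  qed
  have "card EG = card E + card A"
  proof -
    have "E \<inter> A = {}" using EV gV unfolding A_def by blast
    moreover have "finite A" unfolding A_def using D(4,7) by blast
    ultimately show ?thesis unfolding EG_def using D(3) by (simp add: card_Un_disjoint)
  qed
  moreover have "card A = (\<Sum>S\<in>\<F>. card ((\<lambda>x. {g S, x}) ` S))"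
    unfolding A_def
  proof (rule card_UN_disjoint)
    show "\<forall>S\<in>\<F>. \<forall>T\<in>\<F>. S \<noteq> T \<longrightarrow> (\<lambda>x. {g S, x}) ` S \<inter> (\<lambda>x. {g T, x}) ` T = {}"
    proof (intro ballI impI)
      fix S T assume ST: "S \<in> \<F>" "T \<in> \<F>" "S \<noteq> T"
      then have "g S \<noteq> g T" using gi by (auto simp: inj_on_def)
      moreover have "g S \<notin> T" "g T \<notin> S" using D(5) ST gV by blast+
      ultimately show "(\<lambda>x. {g S, x}) ` S \<inter> (\<lambda>x. {g T, x}) ` T = {}"
        by (auto simp: doubleton_eq_iff)
    qed
  qed (use D(4,7) in auto)
  moreover have "(\<Sum>S\<in>\<F>. card ((\<lambda>x. {g S, x}) ` S)) = (\<Sum>S\<in>\<F>. t)"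
  proof (rule sum.cong[OF refl])
    fix S assume S: "S \<in> \<F>"
    have "card ((\<lambda>x. {g S, x}) ` S) = card S"
      by (rule card_image) (auto simp: inj_on_def doubleton_eq_iff)
    then show "card ((\<lambda>x. {g S, x}) ` S) = t" using D(6)[OF S] by simp
  qed
  ultimately have "card EG = t * card \<F> + card E" by simp
  moreover have "tsat_graph (card V + card \<F>) r t (VG, EG)"
    using tsat_graph_iff[OF ne] sat cV deg twin by blast
  ultimately show thesis using that[of "(VG, EG)"] by simp
qed

section \<open>Systems with few edges\<close>

lemma CHAR_bit: "CHAR(bit) = 2"
proof (rule CHAR_eq_posI)
  show "of_nat n \<noteq> (0 :: bit)" if "0 < n" "n < 2" for n
  proof -
    have "n = 1" using that by linarith
    then show ?thesis by simp
  qed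
qed auto

text \<open>Over an algebraically closed field \<open>p\<close> splits into linear factors, and a
  repeated factor would give a common root of \<open>p\<close> and its derivative.\<close>

lemma card_roots_separable:
  fixes p :: "'a :: alg_closed_field poly"
  assumes p0: "p \<noteq> 0" and sep: "\<And>a. poly p a = 0 \<Longrightarrow> poly (pderiv p) a \<noteq> 0"
  shows "card {x. poly p x = 0} = Polynomial.degree p"
proof -
  obtain A where A: "size A = Polynomial.degree p" "p = smult (lead_coeff p) (\<Prod>x\<in>#A. [:-x, 1:])"
    using alg_closed_imp_factorization[OF p0] by blast
  have "proots (\<Prod>x\<in>#B. [:-x, 1:]) = B" for B :: "'a multiset"
  proof (induction B)
    case (add x B)
    have nz: "(\<Prod>x\<in>#B. [:-x, 1:]) \<noteq> 0" by (auto simp: prod_mset_zero_iff)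
    have "proots (\<Prod>x\<in>#add_mset x B. [:-x, 1:]) = proots ([:-x, 1:] * (\<Prod>x\<in>#B. [:-x, 1:]))"
      by (simp only: image_mset_add_mset prod_mset.add_mset)
    also have "\<dots> = proots [:-x, 1:] + proots (\<Prod>x\<in>#B. [:-x, 1:])"
      by (rule proots_mult) (use nz in auto)
    finally show ?case using add by simp
  qed simp
  then have prA: "proots p = A" using A(2) p0 by (metis leading_coeff_0_iff proots_smult)
  have "order a p \<le> 1" for a
  proof (rule ccontr)
    assume "\<not> order a p \<le> 1"
    then have "[:-a, 1:] ^ 2 dvd p" using order_divides[of a 2 p] by simp
    then obtain q where "p = [:-a, 1:] * ([:-a, 1:] * q)" by (metis dvdE mult.assoc power2_eq_square)
    then have "poly p a = 0" "poly (pderiv p) a = 0"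
      by (simp_all only: pderiv_mult poly_add poly_mult) simp_all
    then show False using sep by blast
  qed
  then have "count A x \<le> 1" for x using count_proots[OF p0, of x] unfolding prA by simp
  then have "A = mset_set (set_mset A)"
    by (intro multiset_eqI) (metis (no_types, opaque_lifting) count_mset_set' finite_set_mset count_eq_zero_iff count_greater_eq_one_iff order_antisym)
  then have "size A = card (set_mset A)" by (metis size_mset_set)
  then show ?thesis using A(1) prA p0 set_count_proots[OF p0] by simp
qed

text \<open>The fixed points of \<open>x -> x ^ q\<close> in an algebraic closure of the two-element
  field form the field with \<open>q\<close> elements. Closure under addition is the Frobenius
  identity; the count comes from the roots of \<open>x ^ q - x\<close>, whose derivative
  \<open>-1\<close> has no zero.\<close>

lemma ex_finite_subring:
  assumes j: "0 < j"
  obtains K :: "bit alg_closure set" where "finite K" "card K = 2 ^ j" "0 \<in> K"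
    "\<And>x y. x \<in> K \<Longrightarrow> y \<in> K \<Longrightarrow> x + y \<in> K" "\<And>x y. x \<in> K \<Longrightarrow> y \<in> K \<Longrightarrow> x * y \<in> K"
    "\<And>x. x \<in> K \<Longrightarrow> - x \<in> K"
proof -
  let ?q = "2 ^ j :: nat"
  define K :: "bit alg_closure set" where "K = {x. x ^ ?q = x}"
  have ch: "CHAR(bit alg_closure) = 2" by (simp add: CHAR_bit)
  have two: "(2 :: bit alg_closure) = 0"
    using of_nat_CHAR[where 'a = "bit alg_closure"] ch by simp
  have neg: "- x = x" for x :: "bit alg_closure"
  proof -
    have "x + x = 2 * x" by simp
    then show ?thesis using two by (metis add_eq_0_iff mult_zero_left)
  qed
  have pr: "prime CHAR(bit alg_closure)" by (simp add: CHAR_bit)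
  have add: "(x + y) ^ ?q = x ^ ?q + y ^ ?q" for x y :: "bit alg_closure"
    by (rule freshmans_dream'[OF pr, of _ j]) (simp add: CHAR_bit)
  have K: "finite K \<and> card K = ?q"
  proof -
    define p :: "bit alg_closure poly" where "p = Polynomial.monom 1 ?q - Polynomial.monom 1 1"
    have q1: "1 < ?q" using j by (rule one_less_power[rotated]) simp
    have degp: "Polynomial.degree p = ?q"
    proof -
      have "Polynomial.degree (Polynomial.monom (1 :: bit alg_closure) 1) < Polynomial.degree (Polynomial.monom (1 :: bit alg_closure) ?q)"
        using q1 by (simp add: degree_monom_eq)
      then show ?thesis
        unfolding p_def
        using degree_add_eq_left[of "- Polynomial.monom (1 :: bit alg_closure) 1" "Polynomial.monom 1 ?q"]
        by (simp add: degree_monom_eq)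
    qed
    have q0: "of_nat ?q = (0 :: bit alg_closure)" using j two by simp
    have pd0: "pderiv (Polynomial.monom (1 :: bit alg_closure) ?q) = 0" unfolding pderiv_monom q0 by simp
    have "pderiv p = - 1" unfolding p_def pderiv_diff pd0 by (simp add: pderiv_diff pderiv_monom monom_0 one_pCons)
    moreover have p0: "p \<noteq> 0" using degp q1 by auto
    ultimately have "card {x. poly p x = 0} = ?q" using card_roots_separable[OF p0] degp by simp
    moreover have "{x. poly p x = 0} = K" unfolding K_def p_def by (simp add: poly_monom)
    ultimately show ?thesis using poly_roots_finite[OF p0] by simp
  qed
  show thesis
  proof (rule that)
    show "finite K" "card K = 2 ^ j" using K by auto
    show "x + y \<in> K" if "x \<in> K" "y \<in> K" for x y using that add unfolding K_def by simp
    show "x * y \<in> K" if "x \<in> K" "y \<in> K" for x y using that unfolding K_def by (simp add: power_mult_distrib)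
    show "- x \<in> K" if "x \<in> K" for x using that by (simp only: neg)
  qed (auto simp: K_def power_0_left)
qed

section \<open>Triangle-free systems from bipartite graphs\<close>

lemma has_clique_1: "has_clique 1 E U \<longleftrightarrow> U \<noteq> {}"
proof
  assume "U \<noteq> {}"
  then obtain x where "x \<in> U" by blast
  then show "has_clique 1 E U" unfolding has_clique_def by (intro exI[of _ "{x}"]) (auto simp: clique_def)
next
  assume "has_clique 1 E U"
  then show "U \<noteq> {}" unfolding has_clique_def by fastforce
qed

lemma has_clique_2: "has_clique 2 E U \<longleftrightarrow> (\<exists>u\<in>U. \<exists>v\<in>U. u \<noteq> v \<and> {u, v} \<in> E)"
proof
  assume "has_clique 2 E U"
  then obtain Q where Q: "Q \<subseteq> U" "card Q = 2" "clique Q E" unfolding has_clique_def by blast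
  then obtain u v where "Q = {u, v}" "u \<noteq> v" by (auto simp: card_2_iff)
  then show "\<exists>u\<in>U. \<exists>v\<in>U. u \<noteq> v \<and> {u, v} \<in> E" using Q unfolding clique_def by blast
next
  assume "\<exists>u\<in>U. \<exists>v\<in>U. u \<noteq> v \<and> {u, v} \<in> E"
  then obtain u v where "u \<in> U" "v \<in> U" "u \<noteq> v" "{u, v} \<in> E" by blast
  then show "has_clique 2 E U"
    unfolding has_clique_def by (intro exI[of _ "{u, v}"]) (auto simp: clique_def insert_commute)
qed

lemma has_clique_3: "has_clique 3 E U \<longleftrightarrow> (\<exists>u\<in>U. \<exists>v\<in>U. \<exists>w\<in>U. u \<noteq> v \<and> v \<noteq> w \<and> u \<noteq> w \<and> {u, v} \<in> E \<and> {v, w} \<in> E \<and> {u, w} \<in> E)"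
proof
  assume "has_clique 3 E U"
  then obtain Q where Q: "Q \<subseteq> U" "card Q = 3" "clique Q E" unfolding has_clique_def by blast
  then obtain u v w where uvw: "Q = {u, v, w}" "u \<noteq> v" "v \<noteq> w" "u \<noteq> w" by (auto simp: card_3_iff)
  then have "{u, v} \<in> E" "{v, w} \<in> E" "{u, w} \<in> E" "u \<in> U" "v \<in> U" "w \<in> U"
    using Q(1,3) unfolding clique_def by auto
  then show "\<exists>u\<in>U. \<exists>v\<in>U. \<exists>w\<in>U. u \<noteq> v \<and> v \<noteq> w \<and> u \<noteq> w \<and> {u, v} \<in> E \<and> {v, w} \<in> E \<and> {u, w} \<in> E"
    using uvw(2-4) by (intro bexI[of _ u] bexI[of _ v] bexI[of _ w] conjI)
next
  assume "\<exists>u\<in>U. \<exists>v\<in>U. \<exists>w\<in>U. u \<noteq> v \<and> v \<noteq> w \<and> u \<noteq> w \<and> {u, v} \<in> E \<and> {v, w} \<in> E \<and> {u, w} \<in> E"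
  then obtain u v w where "u \<in> U" "v \<in> U" "w \<in> U" "u \<noteq> v" "v \<noteq> w" "u \<noteq> w" "{u, v} \<in> E" "{v, w} \<in> E" "{u, w} \<in> E"
    by blast
  then show "has_clique 3 E U"
    unfolding has_clique_def by (intro exI[of _ "{u, v, w}"]) (auto simp: clique_def insert_commute)
qed

lemma has_clique_3_insert_edge:
  assumes "u \<in> U" "v \<in> U" "z \<in> U" "u \<noteq> v" "z \<noteq> u" "z \<noteq> v" "{u, z} \<in> E" "{v, z} \<in> E"
  shows "has_clique 3 (insert {u, v} E) U"
  unfolding has_clique_3
  by (rule bexI[of _ u], rule bexI[of _ v], rule bexI[of _ z]) (use assms in auto)

text \<open>For \<open>r = 3\<close> the members must be maximal independent sets that pairwise
  meet. \<open>N a\<close> is the set of non-neighbours of \<open>a\<close> in \<open>B\<close>, and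
  \<open>W\<close> consists of isolated vertices placed in every member, which makes members meet.
  By \<open>Puniq\<close> no further vertex of \<open>A\<close> can join a member. Non-edges inside
  \<open>A\<close> or inside \<open>B\<close> are blocked by triangles (\<open>comA\<close>,
  \<open>comB\<close>), those between \<open>A\<close> and \<open>B\<close> by members
  (\<open>cover\<close>), and those at \<open>W\<close> by any member through the other end.\<close>

lemma bipartite_system:
  fixes A B W :: "'v set" and N :: "'v \<Rightarrow> 'v set" and P :: "('v \<times> 'v) set"
  defines "sel \<equiv> \<lambda>(a, a'). W \<union> {a, a'} \<union> (N a \<inter> N a')"
  assumes fin: "finite A" "finite B" "finite W" "W \<noteq> {}"
    and disj: "A \<inter> B = {}" "A \<inter> W = {}" "B \<inter> W = {}"
    and NB: "\<And>a. a \<in> A \<Longrightarrow> N a \<subseteq> B" and PA: "P \<subseteq> A \<times> A" and Pne: "\<And>a a'. (a, a') \<in> P \<Longrightarrow> a \<noteq> a'"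
    and asym: "\<And>a a'. (a, a') \<in> P \<Longrightarrow> (a', a) \<notin> P"
    and P3: "\<And>a a'. (a, a') \<in> P \<Longrightarrow> card (N a \<inter> N a') = 3"
    and Puniq: "\<And>a a' c. (a, a') \<in> P \<Longrightarrow> c \<in> A \<Longrightarrow> N a \<inter> N a' \<subseteq> N c \<Longrightarrow> c = a \<or> c = a'"
    and cover: "\<And>a b. a \<in> A \<Longrightarrow> b \<in> N a \<Longrightarrow> \<exists>p\<in>P. a \<in> sel p \<and> b \<in> sel p"
    and Nne: "\<And>a. a \<in> A \<Longrightarrow> N a \<noteq> {}" and Bc: "\<And>b. b \<in> B \<Longrightarrow> \<exists>a\<in>A. b \<in> N a" and Bne: "B \<noteq> {}"
    and comA: "\<And>a a'. a \<in> A \<Longrightarrow> a' \<in> A \<Longrightarrow> \<exists>b\<in>B. b \<notin> N a \<and> b \<notin> N a'"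
    and comB: "\<And>b b'. b \<in> B \<Longrightarrow> b' \<in> B \<Longrightarrow> \<exists>a\<in>A. b \<notin> N a \<and> b' \<notin> N a"
  shows "max_sys 3 (card W + 5) (W \<union> A \<union> B) {{a, b} | a b. a \<in> A \<and> b \<in> B - N a} (sel ` P) \<and> inj_on sel P"
proof -
  let ?V = "W \<union> A \<union> B" and ?E = "{{a, b} | a b. a \<in> A \<and> b \<in> B - N a}"
  have Ediff: "{u, v} \<in> ?E \<longleftrightarrow> u \<in> A \<and> v \<in> B - N u \<or> v \<in> A \<and> u \<in> B - N v" for u v
    by (auto simp: doubleton_eq_iff)
  have EV: "?E \<subseteq> [?V]\<^bsup>2\<^esup>" using disj by auto
  have sel: "sel (a, a') = W \<union> {a, a'} \<union> (N a \<inter> N a')" for a a' unfolding sel_def by simp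
  have selA: "sel (a, a') \<inter> A = {a, a'}" if "(a, a') \<in> P" for a a'
  proof -
    have "a \<in> A" "a' \<in> A" using PA that by auto
    then show ?thesis using disj NB[of a] unfolding sel by auto
  qed
  have inj: "inj_on sel P"
  proof (rule inj_onI)
    fix p p' assume p: "p \<in> P" "p' \<in> P" "sel p = sel p'"
    obtain a a' c c' where e: "p = (a, a')" "p' = (c, c')" by fastforce
    then have "{a, a'} = {c, c'}" using p selA by metis
    then show "p = p'" using asym[of a a'] p e by (auto simp: doubleton_eq_iff)
  qed
  have tri: "\<not> has_clique 3 ?E ?V" unfolding has_clique_3 Ediff using disj by blast
  have cardS: "card (sel (a, a')) = card W + 5" if p: "(a, a') \<in> P" for a a'
  proof -
    have a: "a \<in> A" "a' \<in> A" "a \<noteq> a'" using PA p Pne by auto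
    have f: "finite (N a \<inter> N a')" using P3[OF p] by (metis card.infinite zero_neq_numeral)
    have "card (W \<union> {a, a'}) = card W + 2"
      using a disj fin by (subst card_Un_disjoint) auto
    moreover have "card (W \<union> {a, a'} \<union> (N a \<inter> N a')) = card (W \<union> {a, a'}) + card (N a \<inter> N a')"
      using a disj fin f NB[of a] by (intro card_Un_disjoint) auto
    ultimately show ?thesis unfolding sel using P3[OF p] by simp
  qed
  have free: "\<not> has_clique 2 ?E (sel (a, a'))" if p: "(a, a') \<in> P" for a a'
  proof -
    have a: "a \<in> A" "a' \<in> A" using PA p by auto
    show ?thesis unfolding has_clique_2 Ediff sel using a disj NB[OF a(1)] NB[OF a(2)] by auto
  qed
  have dom: "has_clique 2 ?E (insert v (sel (a, a')))" if p: "(a, a') \<in> P" and v: "v \<in> ?V" "v \<notin> sel (a, a')" for a a' v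
  proof -
    have a: "a \<in> A" "a' \<in> A" using PA p by auto
    have "\<exists>u\<in>sel (a, a'). u \<noteq> v \<and> {u, v} \<in> ?E"
    proof (cases "v \<in> A")
      case True
      then have "\<not> N a \<inter> N a' \<subseteq> N v" using Puniq[OF p True] v(2) unfolding sel by auto
      then obtain b where "b \<in> N a" "b \<in> N a'" "b \<notin> N v" by blast
      moreover from this have "b \<in> B" using NB a by blast
      ultimately show ?thesis unfolding Ediff sel using True disj by (intro bexI[of _ b]) auto
    next
      case False
      then have vB: "v \<in> B" using v unfolding sel by blast
      then have "v \<notin> N a \<or> v \<notin> N a'" using v(2) unfolding sel by blast
      then obtain c where "c \<in> {a, a'}" "v \<notin> N c" by blast
      then show ?thesis unfolding Ediff sel using vB a False by (intro bexI[of _ c]) auto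
    qed
    then show ?thesis unfolding has_clique_2 by blast
  qed
  have someP: "\<exists>p\<in>P. v \<in> sel p" if "v \<in> A \<union> B" for v
    using that cover Nne Bc by (metis UnE equals0I)
  have "P \<noteq> {}" using someP Bne by blast
  have block: "\<exists>S\<in>sel ` P. has_clique 2 (insert {u, v} ?E) S" if "u \<noteq> v" "\<exists>p\<in>P. u \<in> sel p \<and> v \<in> sel p" for u v
    using that unfolding has_clique_2 by blast
  have WS: "W \<subseteq> sel p" for p unfolding sel_def by (cases p) auto
  have maxim: "has_clique 3 (insert e ?E) ?V \<or> (\<exists>S\<in>sel ` P. has_clique 2 (insert e ?E) S)" if e: "e \<in> [?V]\<^bsup>2\<^esup> - ?E" for e
  proof -
    obtain u v where uv: "e = {u, v}" "u \<noteq> v" "u \<in> ?V" "v \<in> ?V" using e by (auto elim!: nsets2_E)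
    have ne: "{u, v} \<notin> ?E" using e uv(1) by blast
    have Wcase: "\<exists>p\<in>P. x \<in> sel p \<and> y \<in> sel p" if "x \<in> W" "y \<in> ?V" for x y
      using that someP[of y] WS \<open>P \<noteq> {}\<close> by blast
    consider "u \<in> W" | "v \<in> W" | "u \<in> A" "v \<in> A" | "u \<in> B" "v \<in> B" | "u \<in> A" "v \<in> B" | "v \<in> A" "u \<in> B"
      using uv by blast
    then show ?thesis
    proof cases
      case 1
      then show ?thesis using block[OF uv(2) Wcase[OF 1 uv(4)]] uv(1) by simp
    next
      case 2
      then have "\<exists>p\<in>P. u \<in> sel p \<and> v \<in> sel p" using Wcase[of v u] uv(3) by blast
      then show ?thesis using block[OF uv(2)] uv(1) by simp
    next
      case 3
      then obtain z where "z \<in> B" "z \<notin> N u" "z \<notin> N v" using comA by blast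
      then have "{u, z} \<in> ?E" "{v, z} \<in> ?E" "z \<noteq> u" "z \<noteq> v" "z \<in> ?V" using 3 disj unfolding Ediff by auto
      then have "has_clique 3 (insert e ?E) ?V" 
        unfolding uv(1) using uv(2-4) by (intro has_clique_3_insert_edge[of u _ v z])
      then show ?thesis by blast
    next
      case 4
      then obtain z where "z \<in> A" "u \<notin> N z" "v \<notin> N z" using comB by blast
      then have "{u, z} \<in> ?E" "{v, z} \<in> ?E" "z \<noteq> u" "z \<noteq> v" "z \<in> ?V" using 4 disj unfolding Ediff by auto
      then have "has_clique 3 (insert e ?E) ?V" 
        unfolding uv(1) using uv(2-4) by (intro has_clique_3_insert_edge[of u _ v z])
      then show ?thesis by blast
    next
      case 5
      then have "v \<in> N u" using ne unfolding Ediff by blast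
      then show ?thesis using block[OF uv(2)] cover[of u v] 5 uv(1) by blast
    next
      case 6
      then have "u \<in> N v" using ne unfolding Ediff by blast
      then show ?thesis using block[OF uv(2)] cover[of v u] 6 uv(1) by blast
    qed
  qed
  have "max_sys 3 (card W + 5) ?V ?E (sel ` P)"
    unfolding max_sys_def
  proof (intro conjI ballI impI)
    fix S assume "S \<in> sel ` P"
    then obtain a a' where p: "(a, a') \<in> P" "S = sel (a, a')" by auto
    have a: "a \<in> A" "a' \<in> A" using PA p by auto
    show "S \<subseteq> ?V" using a NB[of a] unfolding p(2) sel by auto
    show "card S = card W + 5" using cardS p by simp
    show "\<not> has_clique (3 - 1) ?E S" using free[OF p(1)] p(2) by simp
    show "has_clique (3 - 1) ?E (insert v S)" if "v \<in> ?V - S" for v using dom[OF p(1), of v] that p(2) by simp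
  next
    fix S T assume "S \<in> sel ` P" "T \<in> sel ` P"
    then have "W \<subseteq> S \<inter> T" using WS by blast
    then show "has_clique (3 - 2) ?E (S \<inter> T)" using fin(4) has_clique_1[of ?E "S \<inter> T"] by auto
  next
    fix e assume "e \<in> [?V]\<^bsup>2\<^esup> - ?E"
    then show "has_clique 3 (insert e ?E) ?V \<or> (\<exists>S\<in>sel ` P. has_clique (3 - 1) (insert e ?E) S)"
      using maxim by simp
  qed (use fin EV tri in auto)
  then show ?thesis using inj by blast
qed

text \<open>A vertex joined to everything raises clique sizes by one, so the conditions for
  \<open>r\<close>, \<open>r - 1\<close> and \<open>r - 2\<close> shift together, and
  \<open>t\<close> with them because \<open>u\<close> joins every member. This carries the
  triangle-free construction to all \<open>r\<close>.\<close>

lemma max_sys_add_universal: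
  assumes m: "max_sys r t V E \<F>" and r: "2 \<le> r" and u: "u \<notin> V"
  shows "max_sys (Suc r) (Suc t) (insert u V) (E \<union> (\<lambda>v. {u, v}) ` V) (insert u ` \<F>)"
    "card (insert u ` \<F>) = card \<F>" "card (E \<union> (\<lambda>v. {u, v}) ` V) \<le> card E + card V"
proof -
  note D = max_sysD[OF m]
  let ?st = "(\<lambda>v. {u, v}) ` V"
  have univ: "has_clique (Suc k) (E0 \<union> ?st) (insert u U) \<longleftrightarrow> has_clique k E0 U" if "U \<subseteq> V" "\<And>e. e \<in> E0 \<Longrightarrow> u \<notin> e" for k E0 U
  proof
    assume "has_clique (Suc k) (E0 \<union> ?st) (insert u U)"
    then obtain Q where Q: "Q \<subseteq> insert u U" "finite Q" "card Q = Suc k" "clique Q (E0 \<union> ?st)" unfolding has_clique_def by blast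
    \<comment> \<open>\<open>q\<close> is \<open>u\<close> if \<open>u\<close> lies in the clique
      and an arbitrary vertex of it otherwise.\<close>
    then obtain q where q: "q \<in> Q" "u \<in> Q \<longrightarrow> q = u" by (metis card.empty equals0I nat.distinct(1))
    have "u \<notin> Q - {q}" using q by blast
    then have "{v, w} \<notin> ?st" if "v \<in> Q - {q}" "w \<in> Q - {q}" for v w
      using that by (auto simp: doubleton_eq_iff)
    moreover have "{v, w} \<in> E0 \<union> ?st" if "v \<in> Q - {q}" "w \<in> Q - {q}" "v \<noteq> w" for v w
      using Q(4) that unfolding clique_def by simp
    ultimately have "clique (Q - {q}) E0" unfolding clique_def by simp
    moreover have "card (Q - {q}) = k" using Q q by simp
    moreover have "Q - {q} \<subseteq> U" using Q(1) q by blast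
    ultimately show "has_clique k E0 U" unfolding has_clique_def using Q(2) by blast
  next
    assume "has_clique k E0 U"
    then obtain Q where Q: "Q \<subseteq> U" "finite Q" "card Q = k" "clique Q E0" unfolding has_clique_def by blast
    have "u \<notin> Q" using Q(1) that u by blast
    then have "card (insert u Q) = Suc k" using Q by simp
    moreover have "clique (insert u Q) (E0 \<union> ?st)"
      using Q that(1) unfolding clique_def by (auto simp: insert_commute)
    ultimately show "has_clique (Suc k) (E0 \<union> ?st) (insert u U)"
      unfolding has_clique_def using Q(1,2) by (intro exI[of _ "insert u Q"]) auto
  qed
  have uE: "u \<notin> e" if "e \<in> E" for e using that D(2) u by (auto simp: nsets_def)
  have S1: "Suc (r - 1) = r" "Suc (r - 2) = r - 1" using r by auto
  show "max_sys (Suc r) (Suc t) (insert u V) (E \<union> ?st) (insert u ` \<F>)"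
    unfolding max_sys_def
  proof (intro conjI ballI impI)
    show "finite (insert u V)" using D(1) by simp
    show "E \<union> ?st \<subseteq> [insert u V]\<^bsup>2\<^esup>"
      using D(2) nsets_mono[of V "insert u V" 2] u by auto
    show "\<not> has_clique (Suc r) (E \<union> ?st) (insert u V)" using univ[of V E r] uE D(8) by blast
  next
    fix S' assume "S' \<in> insert u ` \<F>"
    then obtain S where S: "S \<in> \<F>" "S' = insert u S" by blast
    have SV: "S \<subseteq> V" using D(5)[OF S(1)] .
    show "S' \<subseteq> insert u V" using S SV by blast
    have "u \<notin> S" using SV u by blast
    then show "card S' = Suc t" using S(2) D(6,7)[OF S(1)] by simp
    show "\<not> has_clique (Suc r - 1) (E \<union> ?st) S'" using univ[where k = "r - 1", OF SV uE] D(9)[OF S(1)] S1 S(2) by simp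
    show "has_clique (Suc r - 1) (E \<union> ?st) (insert v S')" if v: "v \<in> insert u V - S'" for v
    proof -
      have "v \<in> V" "v \<notin> S" using v S(2) by auto
      moreover from this have "has_clique (r - 1) E (insert v S)" using D(10)[OF S(1)] by blast
      ultimately show ?thesis using univ[of "insert v S" E "r - 1"] uE SV S1 S(2) by (simp add: insert_commute)
    qed
  next
    fix S' T' assume "S' \<in> insert u ` \<F>" "T' \<in> insert u ` \<F>" and ne: "S' \<noteq> T'"
    then obtain S T where S: "S \<in> \<F>" "S' = insert u S" "T \<in> \<F>" "T' = insert u T" by blast
    have "has_clique (r - 2) E (S \<inter> T)" using D(11)[OF S(1,3)] ne S by blast
    moreover have "S \<inter> T \<subseteq> V" using D(5)[OF S(1)] by blast
    moreover have "S' \<inter> T' = insert u (S \<inter> T)" using S by blast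
    ultimately show "has_clique (Suc r - 2) (E \<union> ?st) (S' \<inter> T')"
      using univ[of "S \<inter> T" E "r - 2"] uE S1 by simp
  next
    fix e assume e: "e \<in> [insert u V]\<^bsup>2\<^esup> - (E \<union> ?st)"
    then obtain a b where ab: "e = {a, b}" "a \<noteq> b" "a \<in> insert u V" "b \<in> insert u V" by (auto elim!: nsets2_E)
    then have "a \<noteq> u" "b \<noteq> u" using e by (auto simp: insert_commute)
    then have "e \<in> [V]\<^bsup>2\<^esup>" "e \<notin> E" "u \<notin> e" using ab e by auto
    have eq: "insert e (E \<union> ?st) = insert e E \<union> ?st" by blast
    have uE': "u \<notin> f" if "f \<in> insert e E" for f using that uE \<open>u \<notin> e\<close> by blast
    from D(12)[OF \<open>e \<in> [V]\<^bsup>2\<^esup>\<close> \<open>e \<notin> E\<close>]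
    show "has_clique (Suc r) (insert e (E \<union> ?st)) (insert u V) \<or> (\<exists>S\<in>insert u ` \<F>. has_clique (Suc r - 1) (insert e (E \<union> ?st)) S)"
    proof
      assume "has_clique r (insert e E) V"
      then show ?thesis unfolding eq using univ[of V "insert e E" r] uE' by blast
    next
      assume "\<exists>S\<in>\<F>. has_clique (r - 1) (insert e E) S"
      then obtain S where S: "S \<in> \<F>" "has_clique (r - 1) (insert e E) S" by blast
      then have "has_clique (Suc (r - 1)) (insert e E \<union> ?st) (insert u S)"
        using univ[where k = "r - 1", OF D(5)[OF S(1)] uE'] by blast
      then have "has_clique (Suc r - 1) (insert e E \<union> ?st) (insert u S)" by (simp only: S1 diff_Suc_1)
      then show ?thesis unfolding eq using S(1) by blast
    qed
  qed
  show "card (insert u ` \<F>) = card \<F>"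
  proof (rule card_image, rule inj_onI)
    fix S T assume ST: "S \<in> \<F>" "T \<in> \<F>" "insert u S = insert u T"
    then have "u \<notin> S" "u \<notin> T" using D(5) u by blast+
    then show "S = T" using ST(3) by (simp add: insert_ident)
  qed
  show "card (E \<union> ?st) \<le> card E + card V"
    using card_Un_le[of E ?st] card_image_le[OF D(1), of "\<lambda>v. {u, v}"] by linarith
qed

text \<open>Transports the curve construction, whose vertices live in a sum type over a field, to
  \<open>nat\<close>, the vertex type in the definition of \<open>e'\<close>.\<close>

lemma max_sys_image:
  assumes m: "max_sys r t V E \<F>" and inj: "inj_on \<phi> V"
  shows "max_sys r t (\<phi> ` V) ((`) \<phi> ` E) ((`) \<phi> ` \<F>)" "card ((`) \<phi> ` \<F>) = card \<F>"
proof -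
  note D = max_sysD[OF m]
  have injP: "inj_on ((`) \<phi>) (Pow V)" using inj by (rule inj_on_image_Pow)
  have cl: "clique (\<phi> ` Q) ((`) \<phi> ` E0) \<longleftrightarrow> clique Q E0" if Q: "Q \<subseteq> V" and E0: "E0 \<subseteq> Pow V" for Q E0
  proof -
    have m1: "{\<phi> a, \<phi> b} \<in> (`) \<phi> ` E0 \<longleftrightarrow> {a, b} \<in> E0" if "a \<in> V" "b \<in> V" for a b
      using inj_on_image_mem_iff[OF injP, of "{a, b}" E0] that E0 by auto
    have m2: "\<phi> a = \<phi> b \<longleftrightarrow> a = b" if "a \<in> V" "b \<in> V" for a b
      using inj that by (auto simp: inj_on_def)
    show ?thesis
    proof
      assume c: "clique (\<phi> ` Q) ((`) \<phi> ` E0)"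
      show "clique Q E0"
        unfolding clique_def
      proof (intro ballI impI)
        fix a b assume ab: "a \<in> Q" "b \<in> Q" "a \<noteq> b"
        then have "a \<in> V" "b \<in> V" using Q by auto
        then show "{a, b} \<in> E0" using m1[of a b] m2[of a b] ab c unfolding clique_def by blast
      qed
    next
      assume c: "clique Q E0"
      show "clique (\<phi> ` Q) ((`) \<phi> ` E0)"
        unfolding clique_def
      proof (intro ballI impI)
        fix a' b' assume "a' \<in> \<phi> ` Q" "b' \<in> \<phi> ` Q" "a' \<noteq> b'"
        then obtain a b where ab: "a \<in> Q" "b \<in> Q" "a' = \<phi> a" "b' = \<phi> b" "a \<noteq> b" by blast
        then have "a \<in> V" "b \<in> V" using Q by auto
        then show "{a', b'} \<in> (`) \<phi> ` E0" using m1[of a b] ab c unfolding clique_def by blast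
      qed
    qed
  qed
  have hK: "has_clique k ((`) \<phi> ` E0) (\<phi> ` U) \<longleftrightarrow> has_clique k E0 U" if U: "U \<subseteq> V" and E0: "E0 \<subseteq> Pow V" for k U E0
  proof
    assume "has_clique k ((`) \<phi> ` E0) (\<phi> ` U)"
    then obtain Q where Q: "Q \<subseteq> \<phi> ` U" "finite Q" "card Q = k" "clique Q ((`) \<phi> ` E0)" unfolding has_clique_def by blast
    obtain Q' where Q': "Q' \<subseteq> U" "Q = \<phi> ` Q'" using Q(1) by (meson subset_imageE)
    have i: "inj_on \<phi> Q'" using inj Q'(1) U by (meson inj_on_subset subset_trans)
    then have "finite Q'" "card Q' = k" using Q Q' by (auto simp: finite_image_iff card_image)
    moreover have "clique Q' E0" using cl[OF _ E0, of Q'] Q' Q(4) U by blast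
    ultimately show "has_clique k E0 U" unfolding has_clique_def using Q'(1) by blast
  next
    assume "has_clique k E0 U"
    then obtain Q where Q: "Q \<subseteq> U" "finite Q" "card Q = k" "clique Q E0" unfolding has_clique_def by blast
    have "inj_on \<phi> Q" using inj Q(1) U by (meson inj_on_subset subset_trans)
    then have "card (\<phi> ` Q) = k" using Q by (simp add: card_image)
    moreover have "clique (\<phi> ` Q) ((`) \<phi> ` E0)" using cl[OF _ E0, of Q] Q U by blast
    ultimately show "has_clique k ((`) \<phi> ` E0) (\<phi> ` U)" unfolding has_clique_def using Q(1,2) by blast
  qed
  have EP: "E \<subseteq> Pow V" using D(2) by (auto simp: nsets_def)
  show "max_sys r t (\<phi> ` V) ((`) \<phi> ` E) ((`) \<phi> ` \<F>)"
    unfolding max_sys_def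
  proof (intro conjI ballI impI)
    show "finite (\<phi> ` V)" using D(1) by simp
    show "(`) \<phi> ` E \<subseteq> [\<phi> ` V]\<^bsup>2\<^esup>"
    proof
      fix e assume "e \<in> (`) \<phi> ` E"
      then obtain f where f: "f \<in> E" "e = \<phi> ` f" by blast
      then have "f \<in> [V]\<^bsup>2\<^esup>" using D(2) by blast
      then obtain a b where "f = {a, b}" "a \<in> V" "b \<in> V" "a \<noteq> b" by (rule nsets2_E)
      then show "e \<in> [\<phi> ` V]\<^bsup>2\<^esup>" using f(2) inj by (auto simp: inj_on_def)
    qed
    show "\<not> has_clique r ((`) \<phi> ` E) (\<phi> ` V)" using hK[OF order_refl EP] D(8) by simp
  next
    fix S' assume "S' \<in> (`) \<phi> ` \<F>"
    then obtain S where S: "S \<in> \<F>" "S' = \<phi> ` S" by blast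
    have SV: "S \<subseteq> V" using D(5)[OF S(1)] .
    show "S' \<subseteq> \<phi> ` V" using S SV by blast
    show "card S' = t" using S D(6)[OF S(1)] inj_on_subset[OF inj SV] by (simp add: card_image)
    show "\<not> has_clique (r - 1) ((`) \<phi> ` E) S'" using hK[OF SV EP] D(9)[OF S(1)] S(2) by simp
    show "has_clique (r - 1) ((`) \<phi> ` E) (insert v' S')" if v': "v' \<in> \<phi> ` V - S'" for v'
    proof -
      obtain v where v: "v \<in> V" "v \<notin> S" "v' = \<phi> v" using v' S(2) by blast
      then have "has_clique (r - 1) E (insert v S)" using D(10)[OF S(1)] by blast
      then show ?thesis using hK[of "insert v S" E "r - 1"] EP SV v S(2) by simp
    qed
  next
    fix S' T' assume "S' \<in> (`) \<phi> ` \<F>" "T' \<in> (`) \<phi> ` \<F>" and ne: "S' \<noteq> T'"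
    then obtain S T where S: "S \<in> \<F>" "S' = \<phi> ` S" "T \<in> \<F>" "T' = \<phi> ` T" by blast
    have "has_clique (r - 2) E (S \<inter> T)" using D(11)[OF S(1,3)] ne S by blast
    moreover have "S \<inter> T \<subseteq> V" using D(5)[OF S(1)] by blast
    moreover have "S' \<inter> T' = \<phi> ` (S \<inter> T)"
      using inj_on_image_Int[OF inj D(5)[OF S(1)] D(5)[OF S(3)]] S by simp
    ultimately show "has_clique (r - 2) ((`) \<phi> ` E) (S' \<inter> T')" using hK[of "S \<inter> T" E] EP by simp
  next
    fix e assume e: "e \<in> [\<phi> ` V]\<^bsup>2\<^esup> - (`) \<phi> ` E"
    then obtain a b where ab: "e = {\<phi> a, \<phi> b}" "a \<in> V" "b \<in> V" "\<phi> a \<noteq> \<phi> b"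
      by (auto elim!: nsets2_E)
    let ?f = "{a, b}"
    have f: "?f \<in> [V]\<^bsup>2\<^esup>" "e = \<phi> ` ?f" using ab by auto
    then have "?f \<notin> E" using e by blast
    have IP: "insert ?f E \<subseteq> Pow V" using EP ab by blast
    have eq: "insert e ((`) \<phi> ` E) = (`) \<phi> ` insert ?f E" using f(2) by simp
    from D(12)[OF f(1) \<open>?f \<notin> E\<close>]
    show "has_clique r (insert e ((`) \<phi> ` E)) (\<phi> ` V) \<or> (\<exists>S\<in>(`) \<phi> ` \<F>. has_clique (r - 1) (insert e ((`) \<phi> ` E)) S)"
      unfolding eq using hK[OF order_refl IP] hK[OF D(5) IP] by blast
  qed
  have "\<F> \<subseteq> Pow V" using D(5) by blast
  then show "card ((`) \<phi> ` \<F>) = card \<F>" by (intro card_image inj_on_subset[OF injP])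
qed

section \<open>Quadratic and cubic curves over a finite field\<close>

lemma quadratic_unique:
  fixes a b c a' b' c' :: "'k :: field"
  assumes d: "x \<noteq> y" "y \<noteq> z" "x \<noteq> z"
    and e: "\<And>s. s \<in> {x, y, z} \<Longrightarrow> a + b * s + c * s\<^sup>2 = a' + b' * s + c' * s\<^sup>2"
  shows "a = a' \<and> b = b' \<and> c = c'"
proof -
  define A B C where "A = a - a'" "B = b - b'" "C = c - c'"
  have z: "A + B * s + C * s\<^sup>2 = 0" if "s \<in> {x, y, z}" for s
    using e[OF that] unfolding A_B_C_def by (simp add: algebra_simps)
  \<comment> \<open>Divided differences: subtracting the values at two points and dividing by
    \<open>s - u\<close> removes \<open>A\<close>; a second difference isolates
    \<open>C\<close>.\<close>
  have *: "B + C * (s + u) = 0" if "s \<in> {x, y, z}" "u \<in> {x, y, z}" "s \<noteq> u" for s u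
  proof -
    have "(s - u) * (B + C * (s + u)) = (A + B * s + C * s\<^sup>2) - (A + B * u + C * u\<^sup>2)"
      by (simp add: algebra_simps power2_eq_square)
    then have "(s - u) * (B + C * (s + u)) = 0" using z[OF that(1)] z[OF that(2)] by simp
    then show ?thesis using that(3) by simp
  qed
  have "C * (y - z) = (B + C * (x + y)) - (B + C * (x + z))" by (simp add: algebra_simps)
  then have "C * (y - z) = 0" using *[of x y] *[of x z] d by simp
  then have "C = 0" using d by simp
  moreover from this have "B = 0" using *[of x y] d by simp
  ultimately have "A = 0" using z[of x] by simp
  then show ?thesis using \<open>B = 0\<close> \<open>C = 0\<close> unfolding A_B_C_def by simp
qed

text \<open>The flag switches on a monic cubic term. Curves with equal flags that agree at three
  points coincide, while curves with different flags differ by a monic cubic up to sign, whose three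
  roots can be prescribed.\<close>

fun cval :: "'k \<times> 'k \<times> 'k \<times> bool \<Rightarrow> 'k \<Rightarrow> 'k :: comm_ring_1" where
  "cval (a, b, c, i) x = a + b * x + c * x\<^sup>2 + (if i then x ^ 3 else 0)"

abbreviation is_cubic :: "'k \<times> 'k \<times> 'k \<times> bool \<Rightarrow> bool" where
  "is_cubic f \<equiv> snd (snd (snd f))"

lemma cval_unique:
  fixes f g :: "'k :: field \<times> 'k \<times> 'k \<times> bool"
  assumes "is_cubic f = is_cubic g" "card T = 3" "\<And>s. s \<in> T \<Longrightarrow> cval f s = cval g s"
  shows "f = g"
proof -
  obtain a b c i a' b' c' i' where "f = (a, b, c, i)" "g = (a', b', c', i')"
    by (cases f, cases g) blast
  then have fg: "f = (a, b, c, i)" "g = (a', b', c', i)" using assms(1) by auto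
  obtain x y z where T: "T = {x, y, z}" "x \<noteq> y" "y \<noteq> z" "x \<noteq> z" using assms(2) by (auto simp: card_3_iff)
  have "a = a' \<and> b = b' \<and> c = c'"
    by (rule quadratic_unique[OF T(2-4)]) (use assms(3) fg T(1) in auto)
  then show ?thesis using fg by simp
qed

text \<open>The sets of the system consist of \<open>W\<close>, a quadratic curve, a cubic curve and their three
  common points. There are about \<open>q\<^sup>6 / 6\<close> of them against \<open>2 q\<^sup>5\<close> edges, and \<open>2 q\<^sup>4\<close> of them
  already make the system maximal.\<close>

lemma curve_system:
  fixes K :: "'k :: field set"
  assumes K: "finite K" "0 \<in> K" "\<And>x y. x \<in> K \<Longrightarrow> y \<in> K \<Longrightarrow> x + y \<in> K"
    "\<And>x y. x \<in> K \<Longrightarrow> y \<in> K \<Longrightarrow> x * y \<in> K" "\<And>x. x \<in> K \<Longrightarrow> - x \<in> K"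
    and q: "card K = q" "3 \<le> q" and k: "1 \<le> k" and m: "2 * q ^ 4 \<le> m" "m \<le> q ^ 3 * (q choose 3)"
  obtains V :: "(('k \<times> 'k \<times> 'k \<times> bool) + ('k \<times> 'k) + nat) set" and E \<F>
  where "max_sys 3 (k + 5) V E \<F>" "card \<F> = m" "card V \<le> k + 2 * q ^ 3 + q\<^sup>2" "card E \<le> 2 * q ^ 5"
proof -
  have Kd: "x - y \<in> K" if "x \<in> K" "y \<in> K" for x y using K(3)[OF that(1) K(5)[OF that(2)]] by simp
  define C where "C = K \<times> K \<times> K \<times> (UNIV :: bool set)"
  define pt where "pt x y = (Inr (Inl (x, y)) :: ('k \<times> 'k \<times> 'k \<times> bool) + ('k \<times> 'k) + nat)" for x y
  define A where "A = (Inl ` C :: (('k \<times> 'k \<times> 'k \<times> bool) + ('k \<times> 'k) + nat) set)"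
  define B where "B = (\<lambda>(x, y). pt x y) ` (K \<times> K)"
  define W where "W = ((\<lambda>i. Inr (Inr i)) ` {..<k} :: (('k \<times> 'k \<times> 'k \<times> bool) + ('k \<times> 'k) + nat) set)"
  define N :: "('k \<times> 'k \<times> 'k \<times> bool) + ('k \<times> 'k) + nat \<Rightarrow> (('k \<times> 'k \<times> 'k \<times> bool) + ('k \<times> 'k) + nat) set"
    where "N v = (case v of Inl f \<Rightarrow> (\<lambda>x. pt x (cval f x)) ` K | Inr _ \<Rightarrow> {})" for v
  define ag where "ag f g = {x \<in> K. cval f x = cval g x}" for f g
  have finC: "finite C" unfolding C_def using K(1) by simp
  have cC: "card C = 2 * q ^ 3"
    unfolding C_def using q(1) by (simp add: card_cartesian_product power3_eq_cube)
  have NI: "N (Inl f) = (\<lambda>x. pt x (cval f x)) ` K" for f unfolding N_def by simp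
  have ptN: "pt x y \<in> N (Inl f) \<longleftrightarrow> x \<in> K \<and> y = cval f x" for x y f
    unfolding NI pt_def by auto
  have Nint: "N (Inl f) \<inter> N (Inl g) = (\<lambda>x. pt x (cval f x)) ` ag f g" for f g
    unfolding NI ag_def pt_def by auto
  have cNint: "card (N (Inl f) \<inter> N (Inl g)) = card (ag f g)" for f g
    unfolding Nint by (rule card_image) (auto simp: inj_on_def pt_def)
  have valK: "cval f x \<in> K" if "f \<in> C" "x \<in> K" for f x
  proof -
    obtain a b c i where f: "f = (a, b, c, i)" "a \<in> K" "b \<in> K" "c \<in> K" using \<open>f \<in> C\<close> unfolding C_def by auto
    have "x ^ 2 \<in> K" "x ^ 3 \<in> K" using that K(4) by (simp_all add: power2_eq_square power3_eq_cube)
    then show ?thesis using f that K(2-4) by auto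
  qed
  have partner1: "\<exists>g\<in>C. is_cubic g \<and> ag f g = T" if f: "f \<in> C" "\<not> is_cubic f" and T: "T \<subseteq> K" "card T = 3" for f T
  proof -
    obtain a b c where f': "f = (a, b, c, False)" "a \<in> K" "b \<in> K" "c \<in> K" using f unfolding C_def by auto
    obtain x y z where xyz: "T = {x, y, z}" using T(2) by (auto simp: card_3_iff)
    then have xK: "x \<in> K" "y \<in> K" "z \<in> K" using T(1) by auto
    \<comment> \<open>The coefficients of \<open>f + (s - x)(s - y)(s - z)\<close>, which agrees
      with \<open>f\<close> exactly at \<open>x\<close>, \<open>y\<close>, \<open>z\<close>. The
      companion step subtracts the same product from a cubic.\<close>
    define g where "g = (a - x * y * z, b + (x * y + y * z + z * x), c - (x + y + z), True)"
    have "g \<in> C" unfolding g_def C_def using f' xK K(3,4) Kd by simp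
    moreover have "cval g s - cval f s = (s - x) * (s - y) * (s - z)" for s
      unfolding g_def f' by (simp add: algebra_simps power2_eq_square power3_eq_cube)
    then have "cval f s = cval g s \<longleftrightarrow> s = x \<or> s = y \<or> s = z" for s
      by (metis (no_types, lifting) eq_iff_diff_eq_0 mult_eq_0_iff)
    then have "ag f g = T" unfolding ag_def using xyz xK by auto
    ultimately show ?thesis unfolding g_def by force
  qed
  have partner2: "\<exists>f\<in>C. \<not> is_cubic f \<and> ag f g = T" if g: "g \<in> C" "is_cubic g" and T: "T \<subseteq> K" "card T = 3" for g T
  proof -
    obtain a b c where g': "g = (a, b, c, True)" "a \<in> K" "b \<in> K" "c \<in> K" using g unfolding C_def by auto
    obtain x y z where xyz: "T = {x, y, z}" using T(2) by (auto simp: card_3_iff)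
    then have xK: "x \<in> K" "y \<in> K" "z \<in> K" using T(1) by auto
    define f where "f = (a + x * y * z, b - (x * y + y * z + z * x), c + (x + y + z), False)"
    have "f \<in> C" unfolding f_def C_def using g' xK K(3,4) Kd by simp
    moreover have "cval g s - cval f s = (s - x) * (s - y) * (s - z)" for s
      unfolding f_def g' by (simp add: algebra_simps power2_eq_square power3_eq_cube)
    then have "cval f s = cval g s \<longleftrightarrow> s = x \<or> s = y \<or> s = z" for s
      by (metis (no_types, lifting) eq_iff_diff_eq_0 mult_eq_0_iff)
    then have "ag f g = T" unfolding ag_def using xyz xK by auto
    ultimately show ?thesis unfolding f_def by force
  qed
  define PP where "PP = {(f, g). f \<in> C \<and> g \<in> C \<and> \<not> is_cubic f \<and> is_cubic g \<and> card (ag f g) = 3}"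
  have finPP: "finite PP" by (rule finite_subset[of _ "C \<times> C"]) (use finC in \<open>auto simp: PP_def\<close>)
  \<comment> \<open>One pair for each of the \<open>q ^ 3\<close> quadratics and each triple of
    abscissae; the triple is recovered as the agreement set of the pair.\<close>
  have "q ^ 3 * (q choose 3) \<le> card PP"
  proof -
    define C0 where "C0 = K \<times> K \<times> K \<times> {False}"
    define TT where "TT = {T. T \<subseteq> K \<and> card T = 3}"
    define pa where "pa f T = (SOME g. g \<in> C \<and> is_cubic g \<and> ag f g = T)" for f T
    have pa: "pa f T \<in> C \<and> is_cubic (pa f T) \<and> ag f (pa f T) = T" if "f \<in> C0" "T \<in> TT" for f T
      unfolding pa_def
    proof (rule someI_ex)
      have "f \<in> C" "\<not> is_cubic f" "T \<subseteq> K" "card T = 3" using that unfolding C0_def C_def TT_def by auto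
      then show "\<exists>g. g \<in> C \<and> is_cubic g \<and> ag f g = T" using partner1 by blast
    qed
    have inj: "inj_on (\<lambda>(f, T). (f, pa f T)) (C0 \<times> TT)"
    proof (rule inj_onI)
      fix p p' assume p: "p \<in> C0 \<times> TT" "p' \<in> C0 \<times> TT" "(\<lambda>(f, T). (f, pa f T)) p = (\<lambda>(f, T). (f, pa f T)) p'"
      obtain f T f' T' where e: "p = (f, T)" "p' = (f', T')" by (cases p, cases p') blast
      then have eq: "f = f'" "pa f T = pa f' T'" and mem: "f \<in> C0" "T \<in> TT" "f' \<in> C0" "T' \<in> TT"
        using p by auto
      have "T = ag f (pa f T)" using pa[OF mem(1,2)] by simp
      also have "\<dots> = T'" using pa[OF mem(3,4)] eq by simp
      finally show "p = p'" using eq e by simp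
    qed
    have "(\<lambda>(f, T). (f, pa f T)) ` (C0 \<times> TT) \<subseteq> PP"
    proof (rule image_subsetI)
      fix p assume p: "p \<in> C0 \<times> TT"
      obtain f T where e: "p = (f, T)" by (cases p) blast
      then have fT: "f \<in> C0" "T \<in> TT" using p by auto
      then have "f \<in> C" "\<not> is_cubic f" "card T = 3" unfolding C0_def C_def TT_def by auto
      then show "(\<lambda>(f, T). (f, pa f T)) p \<in> PP" using pa[OF fT] e unfolding PP_def by simp
    qed
    then have "card (C0 \<times> TT) \<le> card PP" using card_inj_on_le[OF inj _ finPP] by blast
    moreover have "card C0 = q ^ 3" unfolding C0_def using q(1) by (simp add: card_cartesian_product power3_eq_cube)
    moreover have "card TT = q choose 3" unfolding TT_def using n_subsets[OF K(1)] q(1) by simp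
    ultimately show ?thesis by (simp add: card_cartesian_product)
  qed
  \<comment> \<open>One pair for each curve \<open>f\<close> and abscissa \<open>x\<close>,
    containing \<open>f\<close> and agreeing at \<open>x\<close>. These at most
    \<open>2 q ^ 4\<close> pairs already block all incident curve-point pairs, so any family between
    \<open>PP0\<close> and \<open>PP\<close> will do; hence every \<open>m\<close> in the range is
    reached.\<close>
  define pr where "pr f x = (SOME p. p \<in> PP \<and> (f = fst p \<or> f = snd p) \<and> x \<in> ag (fst p) (snd p))" for f x
  have pr: "pr f x \<in> PP \<and> (f = fst (pr f x) \<or> f = snd (pr f x)) \<and> x \<in> ag (fst (pr f x)) (snd (pr f x))"
    if fx: "f \<in> C" "x \<in> K" for f x
    unfolding pr_def
  proof (rule someI_ex)
    \<comment> \<open>\<open>3 \<le> q\<close> is used: \<open>x\<close> has to be completed to a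
      triple.\<close>
    have "card (K - {x}) \<ge> 2" using q fx K(1) by simp
    then obtain T' where T': "T' \<subseteq> K - {x}" "card T' = 2" by (meson obtain_subset_with_card_n)
    then have "finite T'" by (metis card.infinite zero_neq_numeral)
    then have T: "insert x T' \<subseteq> K" "card (insert x T') = 3" using T' fx(2) by (auto simp: card_insert_if)
    show "\<exists>p. p \<in> PP \<and> (f = fst p \<or> f = snd p) \<and> x \<in> ag (fst p) (snd p)"
    proof (cases "is_cubic f")
      case True
      obtain g where "g \<in> C" "\<not> is_cubic g" "ag g f = insert x T'" using partner2[OF fx(1) True T] by blast
      then show ?thesis using fx(1) True T(2) unfolding PP_def by (intro exI[of _ "(g, f)"]) auto
    next
      case False
      obtain g where "g \<in> C" "is_cubic g" "ag f g = insert x T'" using partner1[OF fx(1) False T] by blast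
      then show ?thesis using fx(1) False T(2) unfolding PP_def by (intro exI[of _ "(f, g)"]) auto
    qed
  qed
  define PP0 where "PP0 = (\<lambda>(f, x). pr f x) ` (C \<times> K)"
  have "card PP0 \<le> card (C \<times> K)" unfolding PP0_def using finC K(1) by (intro card_image_le) simp
  also have "\<dots> = 2 * q ^ 4" using cC q(1) by (simp add: card_cartesian_product power_numeral_reduce)
  finally have "card PP0 \<le> m" using m by simp
  moreover have "PP0 \<subseteq> PP" unfolding PP0_def using pr by auto
  moreover have "m \<le> card PP" using m(2) \<open>q ^ 3 * (q choose 3) \<le> card PP\<close> by linarith
  ultimately obtain P1 where P1: "PP0 \<subseteq> P1" "P1 \<subseteq> PP" "card P1 = m"
    using exists_subset_between[of PP0 m PP] finPP by blast
  define P :: "((('k \<times> 'k \<times> 'k \<times> bool) + ('k \<times> 'k) + nat) \<times> (('k \<times> 'k \<times> 'k \<times> bool) + ('k \<times> 'k) + nat)) set"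
    where "P = map_prod Inl Inl ` P1"
  have cP: "card P = m" unfolding P_def using P1(3) by (subst card_image) (auto simp: inj_on_def)
  have Pp: "\<exists>f g. a = Inl f \<and> a' = Inl g \<and> (f, g) \<in> PP" if "(a, a') \<in> P" for a a'
    using that P1(2) unfolding P_def by auto
  let ?sel = "\<lambda>(a, a'). W \<union> {a, a'} \<union> (N a \<inter> N a')"
  let ?E = "{{a, b} | a b. a \<in> A \<and> b \<in> B - N a}"
  have ptB: "pt x y \<in> B \<longleftrightarrow> x \<in> K \<and> y \<in> K" for x y unfolding B_def pt_def by auto
  \<comment> \<open>A value different from two given ones yields common neighbours: for two curves a
    point at abscissa \<open>0\<close> on neither, for two points a constant curve through
    neither.\<close>
  have avoid: "\<exists>y\<in>K. y \<noteq> u \<and> y \<noteq> v" for u v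
  proof (rule ccontr)
    assume "\<not> ?thesis"
    then have "K \<subseteq> {u, v}" by blast
    then have "card K \<le> card {u, v}" by (intro card_mono) auto
    then show False using q by (simp add: card_insert_if split: if_splits)
  qed
  have fs: "finite A" "finite B" "finite W"
    unfolding A_def B_def W_def using finC K(1) by auto
  have const: "(y, 0, 0, False) \<in> C" if "y \<in> K" for y unfolding C_def using that K(2) by simp
  have both: "max_sys 3 (card W + 5) (W \<union> A \<union> B) ?E (?sel ` P) \<and> inj_on ?sel P"
  proof (rule bipartite_system)
    show "finite A" "finite B" "finite W" by fact+
    show "W \<noteq> {}" unfolding W_def using k by (auto simp: lessThan_empty_iff)
    show "A \<inter> B = {}" "A \<inter> W = {}" "B \<inter> W = {}" unfolding A_def B_def W_def pt_def by auto
    show "B \<noteq> {}" unfolding B_def using K(2) by auto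
    show "N a \<subseteq> B" if aA: "a \<in> A" for a
    proof -
      obtain f where f: "a = Inl f" "f \<in> C" using aA unfolding A_def by blast
      show ?thesis unfolding f(1) NI by (rule image_subsetI) (use valK[OF f(2)] ptB in blast)
    qed
    show "P \<subseteq> A \<times> A" 
    proof
      fix p assume "p \<in> P"
      then obtain a a' where p: "p = (a, a')" "(a, a') \<in> P" by (cases p) blast
      then obtain f g where "a = Inl f" "a' = Inl g" "(f, g) \<in> PP" using Pp by blast
      then show "p \<in> A \<times> A" unfolding p(1) A_def PP_def by simp
    qed
    show "a \<noteq> a'" if "(a, a') \<in> P" for a a' using Pp[OF that] unfolding PP_def by auto
    show "(a', a) \<notin> P" if "(a, a') \<in> P" for a a'
      
    proof
      assume "(a', a) \<in> P"
      from Pp[OF this] Pp[OF that] show False unfolding PP_def by auto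
    qed
    show "card (N a \<inter> N a') = 3" if "(a, a') \<in> P" for a a'
      using Pp[OF that] cNint unfolding PP_def by auto
    show "c = a \<or> c = a'" if aa: "(a, a') \<in> P" and c: "c \<in> A" "N a \<inter> N a' \<subseteq> N c" for a a' c
    proof -
      obtain f g where fg: "a = Inl f" "a' = Inl g" "(f, g) \<in> PP" using Pp[OF aa] by blast
      obtain h where h: "c = Inl h" using c(1) unfolding A_def by blast
      have hs: "cval h s = cval f s \<and> cval h s = cval g s" if "s \<in> ag f g" for s
      proof -
        have "pt s (cval f s) \<in> N c" using c(2) that Nint unfolding fg by blast
        then show ?thesis using that unfolding h ptN ag_def by simp
      qed
      have c3: "card (ag f g) = 3" "\<not> is_cubic f" "is_cubic g" using fg(3) unfolding PP_def by auto
      have "h = f \<or> h = g"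
      proof (cases "is_cubic h")
        case True
        then have "h = g" using cval_unique[of h g, OF _ c3(1)] c3(3) hs by blast
        then show ?thesis by blast
      next
        case False
        then have "h = f" using cval_unique[of h f, OF _ c3(1)] c3(2) hs by blast
        then show ?thesis by blast
      qed
      then show ?thesis using fg h by blast
    qed
    show "\<exists>p\<in>P. a \<in> ?sel p \<and> b \<in> ?sel p" if ab: "a \<in> A" "b \<in> N a" for a b
    proof -
      obtain f where f: "a = Inl f" "f \<in> C" using ab(1) unfolding A_def by blast
      obtain x where x: "x \<in> K" "b = pt x (cval f x)" using ab(2) unfolding f NI by blast
      obtain g h where gh: "pr f x = (g, h)" by (cases "pr f x") blast
      then have p: "f = g \<or> f = h" "x \<in> ag g h" using pr[OF f(2) x(1)] by auto
      have "pr f x \<in> PP0" unfolding PP0_def using f(2) x(1) by blast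
      then have "(g, h) \<in> P1" using P1(1) gh by auto
      then have "map_prod Inl Inl (g, h) \<in> P" unfolding P_def by (rule imageI)
      then have "(Inl g, Inl h) \<in> P" by simp
      moreover have "b \<in> N (Inl g) \<inter> N (Inl h)" using p x ptN unfolding ag_def by auto
      ultimately show ?thesis using p(1) f(1) by (intro bexI[of _ "(Inl g, Inl h)"]) auto
    qed
    show "N a \<noteq> {}" if "a \<in> A" for a using that K(2) unfolding A_def by (auto simp: NI)
    show "\<exists>a\<in>A. b \<in> N a" if bB: "b \<in> B" for b
    proof -
      obtain x y where xy: "b = pt x y" "x \<in> K" "y \<in> K" using bB unfolding B_def by auto
      then show ?thesis using const[of y] unfolding A_def by (intro bexI[of _ "Inl (y, 0, 0, False)"]) (auto simp: ptN)
    qed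
    show "\<exists>b\<in>B. b \<notin> N a \<and> b \<notin> N a'" if aA: "a \<in> A" "a' \<in> A" for a a'
    proof -
      obtain f g where fg: "a = Inl f" "a' = Inl g" using aA unfolding A_def by blast
      obtain y where y: "y \<in> K" "y \<noteq> cval f 0" "y \<noteq> cval g 0" using avoid by blast
      have "pt 0 y \<in> B" using y(1) K(2) ptB by blast
      moreover have "pt 0 y \<notin> N a" "pt 0 y \<notin> N a'" unfolding fg ptN using y by blast+
      ultimately show ?thesis by blast
    qed
    show "\<exists>a\<in>A. b \<notin> N a \<and> b' \<notin> N a" if bB: "b \<in> B" "b' \<in> B" for b b'
    proof -
      obtain x y x' y' where xy: "b = pt x y" "b' = pt x' y'" using bB unfolding B_def by auto
      obtain c where c: "c \<in> K" "c \<noteq> y" "c \<noteq> y'" using avoid by blast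
      then show ?thesis unfolding xy A_def using const[OF c(1)]
        by (intro bexI[of _ "Inl (c, 0, 0, False)"]) (auto simp: ptN)
    qed
  qed
  have cW: "card W = k" unfolding W_def by (subst card_image) (auto simp: inj_on_def)
  have cA: "card A = 2 * q ^ 3" unfolding A_def using cC by (simp add: card_image)
  have cB: "card B = q\<^sup>2" unfolding B_def using q(1)
    by (subst card_image) (auto simp: inj_on_def pt_def card_cartesian_product power2_eq_square)
  have "card (W \<union> A \<union> B) \<le> k + 2 * q ^ 3 + q\<^sup>2"
    using card_Un_le[of "W \<union> A" B] card_Un_le[of W A] cW cA cB by linarith
  moreover have "card ?E \<le> 2 * q ^ 5"
  proof -
    have "?E \<subseteq> (\<lambda>(a, b). {a, b}) ` (A \<times> B)" by auto
    then have "card ?E \<le> card (A \<times> B)" using fs by (intro surj_card_le) auto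
    also have "\<dots> = 2 * q ^ 5" using cA cB by (simp add: card_cartesian_product power_numeral_reduce power2_eq_square)
    finally show ?thesis .
  qed
  moreover have "card (?sel ` P) = m" using card_image[of ?sel P] both cP by simp
  ultimately show thesis using that both[unfolded cW] by blast
qed

section \<open>Systems with \<open>s\<close> members and \<open>o(s)\<close> edges for all
  parameters\<close>

lemma max_sys_add_universals:
  assumes "max_sys r t (V :: nat set) E \<F>" "2 \<le> r"
  shows "\<exists>(V' :: nat set) E' \<F>'. max_sys (r + i) (t + i) V' E' \<F>' \<and> card \<F>' = card \<F> \<and> card V' \<le> card V + i \<and>
    card E' \<le> card E + i * (card V + i)"
proof (induction i)
  case 0
  then show ?case using assms by auto
next
  case (Suc i)
  then obtain V' :: "nat set" and E' \<F>' where IH: "max_sys (r + i) (t + i) V' E' \<F>'" "card \<F>' = card \<F>" "card V' \<le> card V + i"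
    "card E' \<le> card E + i * (card V + i)" by blast
  have fV: "finite V'" using max_sysD(1)[OF IH(1)] .
  obtain u where u: "u \<notin> V'" using ex_new_if_finite[OF infinite_UNIV_nat fV] by blast
  have "2 \<le> r + i" using assms(2) by simp
  note U = max_sys_add_universal[OF IH(1) this u]
  have "card (insert u V') \<le> card V + Suc i" using fV u IH(3) by simp
  moreover have "card (E' \<union> (\<lambda>v. {u, v}) ` V') \<le> card E + Suc i * (card V + Suc i)"
    using U(3) IH(3,4) by (simp add: algebra_simps)
  ultimately show ?case using U(1,2) IH(2) by (metis add_Suc_right)
qed

lemma max_sys_exists:
  assumes r: "3 \<le> r" "r + 3 \<le> t" and j: "2 \<le> j" and q: "q = 2 ^ j" and m: "2 * q ^ 4 \<le> m" "m \<le> q ^ 3 * (q choose 3)"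
  obtains V :: "nat set" and E \<F> where "max_sys r t V E \<F>" "card \<F> = m" "card E \<le> (2 + r * (2 * t + 4)) * q ^ 5"
proof -
  obtain K :: "bit alg_closure set" where K: "finite K" "card K = 2 ^ j" "0 \<in> K"
    "\<And>x y. x \<in> K \<Longrightarrow> y \<in> K \<Longrightarrow> x + y \<in> K" "\<And>x y. x \<in> K \<Longrightarrow> y \<in> K \<Longrightarrow> x * y \<in> K"
    "\<And>x. x \<in> K \<Longrightarrow> - x \<in> K"
    using ex_finite_subring[of j] j by (metis less_le_trans pos2)
  have "(2 :: nat) ^ 2 \<le> 2 ^ j" using j by (intro power_increasing) auto
  then have q4: "4 \<le> q" using q by simp
  \<comment> \<open>A member has \<open>k + 5\<close> vertices for \<open>r = 3\<close> and gains
    \<open>r - 3\<close> universal ones; equating the total with \<open>t\<close> gives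
    \<open>k\<close>, and \<open>k \<ge> 1\<close> is the condition
    \<open>t \<ge> r + 3\<close>.\<close>
  define k where "k = t - r - 2"
  have k: "1 \<le> k" "k \<le> t" unfolding k_def using r by auto
  obtain V0 :: "((bit alg_closure \<times> bit alg_closure \<times> bit alg_closure \<times> bool) + (bit alg_closure \<times> bit alg_closure) + nat) set"
    and E0 F0 where S0: "max_sys 3 (k + 5) V0 E0 F0" "card F0 = m" "card V0 \<le> k + 2 * q ^ 3 + q\<^sup>2" "card E0 \<le> 2 * q ^ 5"
    using curve_system[OF K(1,3,4,5,6), of q k m] K(2) q q4 k m by auto
  note D0 = max_sysD[OF S0(1)]
  obtain \<phi> :: "_ \<Rightarrow> nat" where "inj_on \<phi> V0" using finite_imp_inj_to_nat_seg[OF D0(1)] by blast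
  note S1 = max_sys_image[OF S0(1) this]
  have "2 \<le> (3 :: nat)" by simp
  from max_sys_add_universals[OF S1(1) this, of "r - 3"]
  obtain V :: "nat set" and E \<F> where S2: "max_sys (3 + (r - 3)) (k + 5 + (r - 3)) V E \<F>" "card \<F> = card ((`) \<phi> ` F0)"
    "card E \<le> card ((`) \<phi> ` E0) + (r - 3) * (card (\<phi> ` V0) + (r - 3))" by blast
  have "3 + (r - 3) = r" "k + 5 + (r - 3) = t" unfolding k_def using r by auto
  then have "max_sys r t V E \<F>" using S2(1) by simp
  moreover have "card \<F> = m" using S2(2) S1(2) S0(2) by simp
  moreover have "card E \<le> (2 + r * (2 * t + 4)) * q ^ 5"
  proof -
    have one: "1 \<le> q ^ 5" "q ^ 3 \<le> q ^ 5" "q\<^sup>2 \<le> q ^ 5" using q4 by (auto intro: power_increasing)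
    have "card (\<phi> ` V0) + (r - 3) \<le> k + 2 * q ^ 3 + q\<^sup>2 + t"
      using card_image_le[OF D0(1), of \<phi>] S0(3) r by linarith
    also have "\<dots> \<le> 2 * t * q ^ 5 + 2 * q ^ 5 + q ^ 5"
    proof -
      have "t * 1 \<le> t * q ^ 5" using one(1) by (intro mult_left_mono) auto
      then show ?thesis using one k by linarith
    qed
    also have "\<dots> \<le> (2 * t + 4) * q ^ 5" by (simp add: algebra_simps)
    finally have "(r - 3) * (card (\<phi> ` V0) + (r - 3)) \<le> r * ((2 * t + 4) * q ^ 5)" by (intro mult_mono) auto
    moreover have "card ((`) \<phi> ` E0) \<le> 2 * q ^ 5" using card_image_le[OF D0(3), of "(`) \<phi>"] S0(4) by linarith
    ultimately have "card E \<le> 2 * q ^ 5 + r * ((2 * t + 4) * q ^ 5)" using S2(3) by linarith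
    then show ?thesis by (simp add: algebra_simps)
  qed
  ultimately show thesis using that by blast
qed

text \<open>\<open>q\<close> is the least power of two with \<open>q ^ 6 \<ge> 27 s\<close>, so
  \<open>q ^ 6 < 64 * 27 s = 1728 s\<close>. The factor \<open>27\<close> comes from
  \<open>q choose 3 \<ge> (q / 3) ^ 3\<close> and provides enough pairs of curves. There are
  \<open>O(q ^ 5) = O(s / q)\<close> edges.\<close>

lemma max_sys_few_edges:
  fixes \<epsilon> :: real
  assumes r: "3 \<le> r" "r + 3 \<le> t" and "0 < \<epsilon>"
  shows "\<forall>\<^sub>F s in sequentially. \<exists>(V :: nat set) E \<F>. max_sys r t V E \<F> \<and> card \<F> = s \<and> real (card E) \<le> \<epsilon> * real s"
proof -
  define c where "c = 2 + r * (2 * t + 4)"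
  \<comment> \<open>A lower bound for \<open>q\<close>: the entry \<open>64\<close> gives
    \<open>2 q ^ 4 \<le> s\<close>, because \<open>64^2 \<ge> 2 * 1728\<close>; the other makes
    \<open>c q ^ 5\<close> at most \<open>\<epsilon> q ^ 6 / 1728\<close>.\<close>
  define M where "M = max 64 (nat \<lceil>1728 * real c / \<epsilon>\<rceil>)"
  have "\<exists>(V :: nat set) E \<F>. max_sys r t V E \<F> \<and> card \<F> = s \<and> real (card E) \<le> \<epsilon> * real s" if s: "M ^ 6 \<le> s" for s
  proof -
    define j where "j = (LEAST j. 27 * s \<le> (2 ^ j) ^ 6)"
    define q :: nat where "q = 2 ^ j"
    have "27 * s < 2 ^ (27 * s)" by (rule less_exp)
    also have "\<dots> \<le> (2 ^ (27 * s)) ^ 6" by (rule self_le_power) auto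
    finally have "\<exists>j. 27 * s \<le> (2 ^ j) ^ 6" by (meson less_imp_le)
    then have q1: "27 * s \<le> q ^ 6" unfolding q_def j_def by (rule LeastI_ex)
    have M: "64 \<le> M" unfolding M_def by simp
    have "M ^ 6 \<le> q ^ 6" using q1 s by linarith
    then have qM: "M \<le> q" by (simp add: power_mono_iff)
    then have q64: "64 \<le> q" using M by linarith
    have j0: "2 \<le> j"
    proof (rule ccontr)
      assume "\<not> 2 \<le> j"
      then have "q \<le> 2 ^ 1" unfolding q_def by (intro power_increasing) auto
      then show False using q64 by simp
    qed
    have "\<not> 27 * s \<le> (2 ^ (j - 1)) ^ 6" using not_less_Least[of "j - 1"] j0 unfolding j_def by (metis (no_types, lifting) diff_less j_def less_le_trans pos2 zero_less_one)
    then have "(2 ^ (j - 1)) ^ 6 < 27 * s" by simp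
    moreover have "q = 2 * 2 ^ (j - 1)" unfolding q_def using j0 by (metis One_nat_def Suc_diff_Suc diff_zero less_le_trans pos2 power_Suc)
    ultimately have q2: "q ^ 6 < 1728 * s" by (simp add: power_mult_distrib)
    have b1: "2 * q ^ 4 \<le> s"
    proof -
      have "1728 * (2 * q ^ 4) \<le> 64 * 64 * q ^ 4" by simp
      also have "\<dots> \<le> q * q * q ^ 4" using q64 by (intro mult_mono) auto
      also have "\<dots> = q ^ 6" by (simp add: power_numeral_reduce)
      finally show ?thesis using q2 by linarith
    qed
    have b2: "s \<le> q ^ 3 * (q choose 3)"
    proof -
      have "(real q / real 3) ^ 3 \<le> real (q choose 3)" using q64 by (intro binomial_ge_n_over_k_pow_k) simp
      then have "real q ^ 3 * (real q / 3) ^ 3 \<le> real q ^ 3 * real (q choose 3)" by (intro mult_left_mono) auto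
      moreover have "real q ^ 3 * (real q / 3) ^ 3 = real (q ^ 6) / 27" by (simp add: power_divide flip: power_add)
      moreover have "real (27 * s) \<le> real (q ^ 6)" using q1 by (simp only: of_nat_le_iff)
      ultimately have "real s \<le> real (q ^ 3 * (q choose 3))" by simp
      then show ?thesis by (simp only: of_nat_le_iff)
    qed
    obtain V :: "nat set" and E \<F> where S: "max_sys r t V E \<F>" "card \<F> = s" "card E \<le> c * q ^ 5"
      using max_sys_exists[OF r j0 q_def b1 b2] unfolding c_def by blast
    have "1728 * real c / \<epsilon> \<le> real q"
    proof -
      have "1728 * real c / \<epsilon> \<le> real (nat \<lceil>1728 * real c / \<epsilon>\<rceil>)" by (rule of_nat_ceiling)
      also have "\<dots> \<le> real q" using qM unfolding M_def by simp
      finally show ?thesis .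
    qed
    then have "1728 * real c \<le> \<epsilon> * real q" using assms(3) by (simp add: field_simps)
    then have "1728 * real c * real (q ^ 5) \<le> \<epsilon> * real q * real (q ^ 5)" by (rule mult_right_mono) simp
    also have "\<dots> = \<epsilon> * real (q ^ 6)" by (simp add: power_numeral_reduce)
    also have "\<dots> \<le> \<epsilon> * real (1728 * s)" using q2 assms(3) by (intro mult_left_mono) (auto simp only: of_nat_le_iff)
    finally have "real c * real (q ^ 5) \<le> \<epsilon> * real s" by simp
    moreover have "real (card E) \<le> real c * real (q ^ 5)" using S(3) by (metis of_nat_le_iff of_nat_mult)
    ultimately have "real (card E) \<le> \<epsilon> * real s" by linarith
    then show ?thesis using S(1,2) by blast
  qed
  then show ?thesis unfolding eventually_sequentially by blast
qed

section \<open>Asymptotics\<close>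

lemma tsat_le_card_edges: "tsat_graph n r t (G :: nat graph) \<Longrightarrow> tsat n r t \<le> card (edges G)"
  unfolding tsat_def by (rule cInf_lower) blast+

lemma tsat_attained:
  assumes "tsat_graph n r t (G0 :: nat graph)"
  obtains G :: "nat graph" where "tsat_graph n r t G" "card (edges G) = tsat n r t"
proof -
  let ?A = "{card (edges G) | G :: nat graph. tsat_graph n r t G}"
  have "card (edges G0) \<in> ?A" using assms by blast
  then have "Inf ?A \<in> ?A" by (rule wellorder_InfI)
  then show thesis using that unfolding tsat_def by auto
qed

text \<open>Positivity, which comes from \<open>s > 2 ^ t\<close>, lets additive constants be
  absorbed into multiples of \<open>e'\<close>.\<close>

lemma e'_small:
  fixes \<epsilon> :: real
  assumes r: "3 \<le> r" "r + 3 \<le> t" and "0 < \<epsilon>"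
  shows "\<forall>\<^sub>F s in sequentially. (\<exists>(V :: nat set) E \<F>. max_sys r t V E \<F> \<and> card \<F> = s \<and> card E = e' r t s) \<and>
    0 < e' r t s \<and> real (e' r t s) \<le> \<epsilon> * real s"
  using max_sys_few_edges[OF assms] eventually_gt_at_top[of "2 ^ t"]
proof eventually_elim
  case (elim s)
  then obtain V0 :: "nat set" and E0 F0 where S0: "max_sys r t V0 E0 F0" "card F0 = s" "real (card E0) \<le> \<epsilon> * real s"
    by blast
  have "e' r t s \<le> card E0" using e'_le_card_edges[OF S0(1)] S0(2) by simp
  then have "real (e' r t s) \<le> \<epsilon> * real s" using S0(3) by linarith
  moreover obtain V :: "nat set" and E \<F> where S: "max_sys r t V E \<F>" "card \<F> = s" "card E = e' r t s"
    using e'_attained[OF S0(1)] S0(2) by metis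
  moreover have "0 < e' r t s" using max_sys_edges_nonempty[OF S(1) r(1)] S(2,3) elim(2) by simp
  ultimately show ?case by blast
qed

text \<open>Discarding one member costs at most the \<open>t^2\<close> pairs inside it. This
  replaces monotonicity of \<open>e'\<close> when the minimality of \<open>b n\<close> is
  exploited.\<close>

lemma e'_pred_le:
  assumes "max_sys r t (V :: nat set) E \<F>" "card \<F> = Suc s" "card E = e' r t (Suc s)"
  shows "e' r t s \<le> e' r t (Suc s) + t\<^sup>2"
proof -
  obtain S where S: "S \<in> \<F>" using assms(2) by fastforce
  obtain E' where E': "max_sys r t V E' (\<F> - {S})" "card E' \<le> card E + card (\<F> - (\<F> - {S})) * t\<^sup>2"
    using max_sys_subfamily[OF assms(1) Diff_subset] by metis
  have "\<F> - (\<F> - {S}) = {S}" using S by blast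
  then have "card E' \<le> e' r t (Suc s) + t\<^sup>2" using E'(2) assms(3) by simp
  moreover have "card (\<F> - {S}) = s" using assms(2) S by simp
  ultimately show ?thesis using e'_le_card_edges[OF E'(1)] by simp
qed

text \<open>The choice of \<open>b n\<close> leaves room for the at most \<open>t * card V\<close> sets that are lost when the
  optimal system with \<open>b n\<close> sets is made good, while \<open>b n - n\<close> stays of the order of \<open>e'\<close>.\<close>

lemma tsat_graph_exists:
  assumes r: "3 \<le> r" "r + 3 \<le> t"
  obtains b :: "nat \<Rightarrow> nat" and C :: real where "0 < C" "\<forall>\<^sub>F n in sequentially. b n \<le> 2 * n"
    "\<forall>\<^sub>F n in sequentially. n \<le> b n"
    "\<forall>\<^sub>F n in sequentially. real (b n) - real n \<le> C * real (e' r t (b n))"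
    "\<forall>\<^sub>F n in sequentially. \<exists>G :: nat graph. tsat_graph n r t G \<and> real (card (edges G)) \<le> real t * real n + C * real (e' r t (b n))"
proof -
  define e where "e = e' r t"
  \<comment> \<open>Since \<open>card V \<le> (t + 2) e\<close> once \<open>e \<ge> 1\<close>,
    \<open>K e\<close> bounds the \<open>t * card V\<close> members lost in making a system good.
    Likewise \<open>L e\<close> bounds \<open>(t + 1) * card V'\<close>, which must not exceed
    \<open>n\<close> if \<open>t * card V'\<close> members are to be kept besides the
    vertices.\<close>
  define K where "K = t * (t + 2)"
  define L where "L = (t + 1) * (t + 2)"
  \<comment> \<open>The summands pay, in order, for the edges of the good system, for
    \<open>t^2\<close> edges per discarded member, and for the overshoot
    \<open>b n - n\<close>.\<close>
  define C where "C = 1 + t ^ 3 * (t + 2) + (K * (1 + t\<^sup>2) + t + 2) * t\<^sup>2 + K * (1 + t\<^sup>2)"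
  define b where "b n = (LEAST s. n + K * e s \<le> s)" for n
  have L: "0 < L" "K \<le> L" unfolding L_def K_def by simp_all
  have "0 < 1 / (2 * real L)" using L by simp
  from e'_small[OF r this] obtain N where N: "\<And>s. N \<le> s \<Longrightarrow> (\<exists>(V :: nat set) E \<F>. max_sys r t V E \<F> \<and> card \<F> = s \<and> card E = e s) \<and>
    0 < e s \<and> real (e s) \<le> 1 / (2 * real L) * real s"
    unfolding eventually_sequentially e_def by blast
  have eL: "2 * (L * e s) \<le> s" if "N \<le> s" for s
  proof -
    have "real (e s) \<le> 1 / (2 * real L) * real s" using N[OF that] by blast
    then have "real (2 * (L * e s)) \<le> real s" using L by (simp add: field_simps)
    then show ?thesis by (simp only: of_nat_le_iff)
  qed
  have main: "n \<le> b n \<and> b n \<le> 2 * n \<and> b n \<le> n + C * e (b n) \<and>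
     (\<exists>G :: nat graph. tsat_graph n r t G \<and> card (edges G) \<le> t * n + C * e (b n))" if n: "N + 1 \<le> n" for n
  proof -
    \<comment> \<open>\<open>2 * n\<close> satisfies the condition under \<open>LEAST\<close>, which
      gives both existence and \<open>b n \<le> 2 * n\<close>.\<close>
    have "K * e (2 * n) \<le> L * e (2 * n)" using L by (intro mult_right_mono) auto
    then have two: "n + K * e (2 * n) \<le> 2 * n" using eL[of "2 * n"] n by linarith
    then have b1: "n + K * e (b n) \<le> b n" unfolding b_def by (rule LeastI)
    have b2: "b n \<le> 2 * n" unfolding b_def using two by (rule Least_le)
    define s where "s = b n"
    have s: "n \<le> s" "s \<le> 2 * n" "n + K * e s \<le> s" "N \<le> s" using b1 b2 n unfolding s_def by auto
    obtain V :: "nat set" and E \<F> where S: "max_sys r t V E \<F>" "card \<F> = s" "card E = e s" and e0: "0 < e s"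
      using N[OF s(4)] by blast
    \<comment> \<open>The defining inequality fails at \<open>s - 1\<close>. As
      \<open>e (s - 1) \<le> e s + t^2\<close> and \<open>e s \<ge> 1\<close> absorbs
      \<open>t^2\<close>, the overshoot \<open>s - n\<close> is a bounded multiple of
      \<open>e s\<close>.\<close>
    obtain s' where s': "s = Suc s'" using s(1) n by (cases s) auto
    have "s' < b n" using s' s_def by simp
    then have "\<not> n + K * e s' \<le> s'" unfolding b_def by (rule not_less_Least)
    moreover have "e s' \<le> e s + t\<^sup>2" using e'_pred_le[of r t V E \<F> s'] S s' unfolding e_def by simp
    then have "K * e s' \<le> K * (e s + t\<^sup>2)" by (rule mult_left_mono) simp
    moreover have "t\<^sup>2 * 1 \<le> t\<^sup>2 * e s" using e0 by (intro mult_left_mono) auto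
    then have "K * (e s + t\<^sup>2) \<le> K * ((1 + t\<^sup>2) * e s)" by (intro mult_left_mono) (auto simp: algebra_simps)
    ultimately have "s \<le> n + K * ((1 + t\<^sup>2) * e s)" using s' by linarith
    then have sn: "s \<le> n + K * (1 + t\<^sup>2) * e s" by (simp only: mult.assoc)
    have h: "card V \<le> (t + 2) * e s"
    proof -
      have "\<F> \<noteq> {}" using S(2) s' by auto
      then have "card V \<le> t + 2 * e s" using max_sys_card_verts_le[OF S(1) r(1)] S(3) by simp
      moreover have "t * 1 \<le> t * e s" using e0 by (intro mult_left_mono) auto
      moreover have "(t + 2) * e s = t * e s + 2 * e s" by (rule distrib_right)
      ultimately show ?thesis by linarith
    qed
    obtain V' :: "nat set" and E' \<F>' where G: "max_sys r t V' E' \<F>'" "good_sys t V' E' \<F>'" "card V' \<le> card V"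
      "card \<F>' \<le> card \<F>" "card \<F> \<le> card \<F>' + t * card V" "card E' \<le> card E + t ^ 3 * card V"
      using max_sys_make_good[OF S(1)] by metis
    define k where "k = n - card V'"
    have "(t + 1) * card V' \<le> (t + 1) * ((t + 2) * e s)" using G(3) h by (intro mult_left_mono) auto
    also have "\<dots> = L * e s" unfolding L_def by (simp only: mult.assoc)
    also have "\<dots> \<le> n" using eL[OF s(4)] s(2) by linarith
    finally have tV: "(t + 1) * card V' \<le> n" .
    then have k1: "t * card V' \<le> k" "card V' + k = n" unfolding k_def by (simp_all add: algebra_simps)
    have "t * card V \<le> t * ((t + 2) * e s)" using h by (rule mult_left_mono) simp
    then have "t * card V \<le> K * e s" unfolding K_def by (simp only: mult.assoc)
    then have k2: "k \<le> card \<F>'" using s(3) G(5) S(2) unfolding k_def by linarith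
    have t1: "1 \<le> t" using r by simp
    obtain E'' \<F>'' where H: "max_sys r t V' E'' \<F>''" "good_sys t V' E'' \<F>''" "card \<F>'' = k"
      "card E'' \<le> card E' + (card \<F>' - k) * t\<^sup>2"
      using good_sys_shrink[OF G(1,2) t1 k1(1) k2] by blast
    have "0 < card V' + card \<F>''" using H(3) k1(2) n by simp
    from tsat_graph_of_good_sys[OF H(1,2) r(1) t1 this] obtain Gr :: "nat graph" where
      Gr: "tsat_graph (card V' + card \<F>'') r t Gr" "card (edges Gr) = t * card \<F>'' + card E''" by blast
    have "card (edges Gr) \<le> t * n + C * e s"
    proof -
      \<comment> \<open>\<open>card \<F>'\<close> exceeds \<open>n\<close> by at most the overshoot,
        and \<open>n - k = card V'\<close> contributes the term
        \<open>(t + 2) * e s\<close>.\<close>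
      have "card \<F>' - k \<le> K * (1 + t\<^sup>2) * e s + (t + 2) * e s"
        using G(3,4) S(2) sn h k1(2) by linarith
      then have "(card \<F>' - k) * t\<^sup>2 \<le> (K * (1 + t\<^sup>2) * e s + (t + 2) * e s) * t\<^sup>2" by (rule mult_right_mono) simp
      moreover have "t ^ 3 * card V \<le> t ^ 3 * ((t + 2) * e s)" using h by (rule mult_left_mono) simp
      ultimately have "card E'' \<le> e s + t ^ 3 * ((t + 2) * e s) + (K * (1 + t\<^sup>2) * e s + (t + 2) * e s) * t\<^sup>2"
        using H(4) G(6) S(3) by linarith
      also have "\<dots> \<le> C * e s" unfolding C_def by (simp add: algebra_simps)
      finally have "card E'' \<le> C * e s" .
      moreover have "t * k \<le> t * n" unfolding k_def by (intro mult_left_mono) auto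
      ultimately show ?thesis unfolding Gr(2) H(3) by linarith
    qed
    moreover have "K * (1 + t\<^sup>2) * e s \<le> C * e s" unfolding C_def by (intro mult_right_mono) auto
    then have "s \<le> n + C * e s" using sn by linarith
    moreover have "tsat_graph n r t Gr" using Gr(1) H(3) k1(2) by simp
    ultimately show ?thesis using s unfolding s_def by blast
  qed
  show thesis
  proof (rule that[of "real C" b])
    have "0 < C" unfolding C_def by simp
    then show "0 < real C" by simp
    show "\<forall>\<^sub>F n in sequentially. b n \<le> 2 * n" "\<forall>\<^sub>F n in sequentially. n \<le> b n"
      using main unfolding eventually_sequentially by blast+
    show "\<forall>\<^sub>F n in sequentially. real (b n) - real n \<le> real C * real (e' r t (b n))"
      using eventually_ge_at_top[of "N + 1"]
    proof eventually_elim
      case (elim n)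
      then have "real (b n) \<le> real (n + C * e (b n))" using main[OF elim] by (simp only: of_nat_le_iff)
      then show ?case unfolding e_def by simp
    qed
    show "\<forall>\<^sub>F n in sequentially. \<exists>G :: nat graph. tsat_graph n r t G \<and> real (card (edges G)) \<le> real t * real n + real C * real (e' r t (b n))"
      using eventually_ge_at_top[of "N + 1"]
    proof eventually_elim
      case (elim n)
      then obtain G :: "nat graph" where G: "tsat_graph n r t G" "card (edges G) \<le> t * n + C * e (b n)" using main by blast
      then have "real (card (edges G)) \<le> real (t * n + C * e (b n))" by (simp only: of_nat_le_iff)
      then have "real (card (edges G)) \<le> real t * real n + real C * real (e' r t (b n))" unfolding e_def by simp
      then show ?case using G(1) by blast
    qed
  qed
qed

text \<open>\<open>a\<close> is the number \<open>n - |C|\<close> of members. With \<open>ec\<close>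
  the number of edges in the core and surplus \<open>ec - t |C|\<close>, the inequality
  \<open>(t + 1) |C| \<le> ec + K\<close> gives both \<open>|C| \<le> K + surplus\<close> and
  \<open>(t + 1) surplus \<ge> ec - t K\<close>. Once \<open>|C| \<ge> 3 K\<close>, the term
  \<open>t K\<close> is at most \<open>ec / 2\<close>, whence the constant
  \<open>1 / (2 (t + 1))\<close>.\<close>

lemma tsat_lower:
  assumes r: "3 \<le> r" and t: "1 \<le> t"
    and n: "0 < n" "3 * (4 * t * clique_pair_bound (4 * t + 1)) + 2 ^ (3 * (4 * t * clique_pair_bound (4 * t + 1))) < n"
    and G0: "tsat_graph n r t (G0 :: nat graph)"
  obtains a where "a \<le> n" "real n - real a \<le> real (4 * t * clique_pair_bound (4 * t + 1)) + (real (tsat n r t) - real t * real n)"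
    "real t * real n + 1 / (2 * (real t + 1)) * real (e' r t a) \<le> real (tsat n r t)"
proof -
  define K where "K = 4 * t * clique_pair_bound (4 * t + 1)"
  obtain G :: "nat graph" where G: "tsat_graph n r t G" "card (edges G) = tsat n r t" using tsat_attained[OF G0] by blast
  obtain V E where VE: "G = (V, E)" by (cases G)
  have G': "tsat_graph n r t (V, E)" using G(1) VE by simp
  note iff = tsat_graph_iff[OF n(1), THEN iffD1, OF G']
  have S: "is_saturated r V E" "card V = n" "\<And>v. v \<in> V \<Longrightarrow> t \<le> card (nbr E v)"
    "\<And>u v. u \<in> V \<Longrightarrow> v \<in> V \<Longrightarrow> u \<noteq> v \<Longrightarrow> nbr E u = nbr E v \<Longrightarrow> \<exists>w\<in>nbr E u. card (nbr E w) = t"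
    using iff by simp_all
  obtain C \<F> where C: "C \<subseteq> V" "max_sys r t C {e \<in> E. e \<subseteq> C} \<F>" "card \<F> = card V - card C"
    "card E = t * (card V - card C) + card {e \<in> E. e \<subseteq> C}"
    "(t + 1) * card C \<le> card {e \<in> E. e \<subseteq> C} + K"
    unfolding K_def by (rule saturated_core[OF S(1) r t S(3,4)])
  have fV: "finite V" using S(1) unfolding is_saturated_def by blast
  have cCn: "card C \<le> n" using C(1) fV S(2) card_mono by blast
  define ec where "ec = card {e \<in> E. e \<subseteq> C}"
  \<comment> \<open>The members are subsets of \<open>C\<close>, so
    \<open>n \<le> |C| + 2 ^ |C|\<close>, and a large \<open>n\<close> forces a large core.\<close>
  have big: "3 * K \<le> card C"
  proof (rule ccontr)
    assume "\<not> 3 * K \<le> card C"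
    have fC: "finite C" using C(1) fV finite_subset by blast
    have "\<F> \<subseteq> Pow C" using max_sysD(5)[OF C(2)] by blast
    then have "card \<F> \<le> card (Pow C)" using fC by (intro card_mono) auto
    also have "\<dots> \<le> 2 ^ (3 * K)" using fC \<open>\<not> 3 * K \<le> card C\<close> by (simp add: card_Pow power_increasing)
    finally have "n \<le> card C + 2 ^ (3 * K)" using C(3) S(2) cCn by linarith
    then show False using n(2) \<open>\<not> 3 * K \<le> card C\<close> unfolding K_def by linarith
  qed
  have tE: "real (tsat n r t) - real t * real n = real ec - real t * real (card C)"
  proof -
    have "tsat n r t = t * (n - card C) + ec" using G(2) C(4) S(2) unfolding VE ec_def by simp
    then have "real (tsat n r t) = real t * (real n - real (card C)) + real ec"
      using cCn by (simp add: of_nat_diff)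
    then show ?thesis by (simp add: algebra_simps)
  qed
  have c1: "(real t + 1) * real (card C) \<le> real ec + real K"
  proof -
    have "real ((t + 1) * card C) \<le> real (ec + K)" using C(5) unfolding ec_def by (simp only: of_nat_le_iff)
    then show ?thesis by (simp add: algebra_simps)
  qed
  have "(real t + 1) * (3 * real K) \<le> (real t + 1) * real (card C)" using big by (intro mult_left_mono) auto
  then have ec2: "2 * (real t * real K) \<le> real ec" using c1 by (simp add: algebra_simps)
  have "real t * ((real t + 1) * real (card C)) \<le> real t * (real ec + real K)" using c1 by (rule mult_left_mono) simp
  then have "real ec \<le> 2 * (real t + 1) * (real ec - real t * real (card C))"
    using ec2 by (simp add: algebra_simps)
  then have "1 / (2 * (real t + 1)) * real ec \<le> real ec - real t * real (card C)"
    by (simp add: field_simps)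
  moreover have "e' r t (n - card C) \<le> ec"
    using e'_le_card_edges[OF C(2)] C(3) S(2) unfolding ec_def by simp
  then have "1 / (2 * (real t + 1)) * real (e' r t (n - card C)) \<le> 1 / (2 * (real t + 1)) * real ec"
    by (intro mult_left_mono) auto
  ultimately have "real t * real n + 1 / (2 * (real t + 1)) * real (e' r t (n - card C)) \<le> real (tsat n r t)"
    using tE by linarith
  moreover have "real n - real (n - card C) \<le> real K + (real (tsat n r t) - real t * real n)"
    using tE c1 cCn by (simp add: of_nat_diff algebra_simps)
  ultimately show thesis using that[of "n - card C"] unfolding K_def by simp
qed

theorem theorem16:
  fixes r t :: nat
  assumes "r \<ge> 3" and "t \<ge> r + 3"
  shows "\<exists>(a :: nat \<Rightarrow> nat) (b :: nat \<Rightarrow> nat) (c :: real) (C :: real).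
    (\<lambda>n. real (a n) - real n) \<in> o(\<lambda>n. real n) \<and>
    (\<lambda>n. real (b n) - real n) \<in> o(\<lambda>n. real n) \<and>
    c > 0 \<and> C > 0 \<and>
    (\<forall>\<^sub>F n in sequentially.
       real t * real n + c * real (e' r t (a n)) \<le> real (tsat n r t) \<and>
       real (tsat n r t) \<le> real t * real n + C * real (e' r t (b n)))"
proof -
  have t1: "1 \<le> t" using assms by simp
  define K where "K = 4 * t * clique_pair_bound (4 * t + 1)"
  obtain b :: "nat \<Rightarrow> nat" and C :: real where C: "0 < C" and b2: "\<forall>\<^sub>F n in sequentially. b n \<le> 2 * n"
    and b1: "\<forall>\<^sub>F n in sequentially. n \<le> b n"
    and bC: "\<forall>\<^sub>F n in sequentially. real (b n) - real n \<le> C * real (e' r t (b n))"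
    and bG: "\<forall>\<^sub>F n in sequentially. \<exists>G :: nat graph. tsat_graph n r t G \<and> real (card (edges G)) \<le> real t * real n + C * real (e' r t (b n))"
    using tsat_graph_exists[OF assms] by blast
  \<comment> \<open>\<open>e'(s) = o(s)\<close> is applied at \<open>s = b n\<close>:
    \<open>b n \<ge> n\<close> makes \<open>s\<close> large, and \<open>b n \<le> 2 * n\<close>
    turns \<open>o(s)\<close> into \<open>o(n)\<close>.\<close>
  have small: "\<forall>\<^sub>F n in sequentially. C * real (e' r t (b n)) \<le> \<delta> * real n" if "0 < \<delta>" for \<delta> :: real
  proof -
    have pos: "0 < \<delta> / (2 * C)" using that C by simp
    from e'_small[OF assms pos] obtain N where N: "\<And>s. N \<le> s \<Longrightarrow> real (e' r t s) \<le> \<delta> / (2 * C) * real s"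
      unfolding eventually_sequentially by blast
    show ?thesis
      using b1 b2 eventually_ge_at_top[of N]
    proof eventually_elim
      case (elim n)
      have "real (e' r t (b n)) \<le> \<delta> / (2 * C) * real (b n)" using N[of "b n"] elim by linarith
      also have "\<dots> \<le> \<delta> / (2 * C) * (2 * real n)" using elim pos by (intro mult_left_mono) auto
      finally have "C * real (e' r t (b n)) \<le> C * (\<delta> / (2 * C) * (2 * real n))" using C by (intro mult_left_mono) auto
      also have "\<dots> = \<delta> * real n" using C by simp
      finally show ?case .
    qed
  qed
  have bo: "(\<lambda>n. real (b n) - real n) \<in> o(\<lambda>n. real n)"
  proof (rule landau_o.smallI)
    fix \<delta> :: real assume "0 < \<delta>"
    from small[OF this] show "\<forall>\<^sub>F n in sequentially. norm (real (b n) - real n) \<le> \<delta> * norm (real n)"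
      using b1 bC by eventually_elim auto
  qed
  \<comment> \<open>The surplus in the bound for \<open>n - a\<close> is replaced by its upper
    estimate \<open>C * e' r t (b n)\<close>; so \<open>a n = n + o(n)\<close> depends on the upper
    half of the theorem.\<close>
  define Q where "Q n a \<longleftrightarrow> a \<le> n \<and> real n - real a \<le> real K + C * real (e' r t (b n)) \<and>
    real t * real n + 1 / (2 * (real t + 1)) * real (e' r t a) \<le> real (tsat n r t)" for n a
  define a where "a n = (SOME a. Q n a)" for n
  have up: "\<forall>\<^sub>F n in sequentially. real (tsat n r t) \<le> real t * real n + C * real (e' r t (b n))"
    using bG
  proof eventually_elim
    case (elim n)
    then obtain G :: "nat graph" where "tsat_graph n r t G" "real (card (edges G)) \<le> real t * real n + C * real (e' r t (b n))"
      by blast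
    then show ?case using tsat_le_card_edges[of n r t G] by linarith
  qed
  have Qa: "\<forall>\<^sub>F n in sequentially. Q n (a n)"
    using up bG eventually_gt_at_top[of 0] eventually_gt_at_top[of "3 * K + 2 ^ (3 * K)"]
  proof eventually_elim
    case (elim n)
    then obtain G :: "nat graph" where G: "tsat_graph n r t G" by blast
    obtain a' where "a' \<le> n" "real n - real a' \<le> real K + (real (tsat n r t) - real t * real n)"
      "real t * real n + 1 / (2 * (real t + 1)) * real (e' r t a') \<le> real (tsat n r t)"
      using tsat_lower[OF assms(1) t1 elim(3) _ G] elim(4) unfolding K_def by blast
    then have "Q n a'" using elim(1) unfolding Q_def by linarith
    then show ?case unfolding a_def by (rule someI)
  qed
  have ao: "(\<lambda>n. real (a n) - real n) \<in> o(\<lambda>n. real n)"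
  proof (rule landau_o.smallI)
    fix \<delta> :: real assume d: "0 < \<delta>"
    then have "0 < \<delta> / 2" by simp
    from small[OF this] show "\<forall>\<^sub>F n in sequentially. norm (real (a n) - real n) \<le> \<delta> * norm (real n)"
      using Qa eventually_ge_at_top[of "nat \<lceil>2 * real K / \<delta>\<rceil>"]
    proof eventually_elim
      case (elim n)
      have "2 * real K / \<delta> \<le> real n" using elim(3) by linarith
      then have "real K \<le> \<delta> / 2 * real n" using d by (simp add: field_simps)
      then show ?case using elim(1,2) unfolding Q_def by auto
    qed
  qed
  have "\<forall>\<^sub>F n in sequentially. real t * real n + 1 / (2 * (real t + 1)) * real (e' r t (a n)) \<le> real (tsat n r t) \<and>
      real (tsat n r t) \<le> real t * real n + C * real (e' r t (b n))"
    using Qa up by eventually_elim (auto simp: Q_def)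
  moreover have "0 < 1 / (2 * (real t + 1))" by simp
  ultimately show ?thesis using ao bo C by blast
qed

end
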